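(* Let $p_1,p_2$ be primes with $p_1\neq p_2$. For an integer $n\ge 0$ and $i\in\{1,2\}$ write $n=\sum_{j\ge1} e_{i,j}(n)p_i^{j-1}$ with digits $e_{i,j}(n)\in\{0,1,\dots,p_i-1\}$, and set $\phi_i(n)=\sum_{j\ge1}e_{i,j}(n)p_i^{-j}$ (the van der Corput radical inverse in base $p_i$). Let $H_2(k)=(\phi_1(k),\phi_2(k))$, $k=0,1,2,\dots$ (the two-dimensional Halton sequence). Then there is a constant $C$ such that for all integers $Q\ge 0$ and $N\ge 2$, $$D_2\big((H_2(k))_{k=Q}^{Q+N-1}\big)\le C\log N,$$ where the constant $C$ is independent of $Q$ and $N$.
   Context: For an $N$-element point set $\mathcal P_N=(\beta_n)_{n=0}^{N-1}$ in $[0,1)^2$, the local discrepancy function is $D(\mathbf x,\mathcal P_N)=\sum_{n=0}^{N-1}\mathbf 1_{B_{\mathbf x}}(\beta_n)-Nx_1x_2$ for $\mathbf x=(x_1,x_2)\in[0,1]^2$, where $B_{\mathbf x}=[0,x_1)\times[0,x_2)$ and $\mathbf 1_{B_{\mathbf x}}$ is its indicator function. The $L_2$-discrepancy is $D_2(\mathcal P_N)=\big(\int_{[0,1]^2}|D(\mathbf x,\mathcal P_N)|^2\,d\mathbf x\big)^{1/2}$. *)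

theory Defs
  imports "HOL-Analysis.Analysis" "HOL-Computational_Algebra.Primes"
begin

text \<open>Digits are numbered from \<^term>\<open>1::nat\<close>, least significant first;
  the value at index \<^term>\<open>0::nat\<close> is never used.\<close>

definition digit :: "nat \<Rightarrow> nat \<Rightarrow> nat \<Rightarrow> nat" where
  "digit b j n = n div b ^ (j - 1) mod b"

definition radical_inverse :: "nat \<Rightarrow> nat \<Rightarrow> real" where
  "radical_inverse b n = (\<Sum>j. real (digit b (Suc j) n) / real b ^ Suc j)"

definition halton2 :: "nat \<Rightarrow> nat \<Rightarrow> nat \<Rightarrow> real \<times> real" where
  "halton2 p\<^sub>1 p\<^sub>2 k = (radical_inverse p\<^sub>1 k, radical_inverse p\<^sub>2 k)"

definition local_discrepancy :: "nat \<Rightarrow> (nat \<Rightarrow> real \<times> real) \<Rightarrow> real \<times> real \<Rightarrow> real" where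
  "local_discrepancy N \<beta> x =
     (\<Sum>n<N. indicator ({0..<fst x} \<times> {0..<snd x}) (\<beta> n)) - real N * fst x * snd x"

definition L2_discrepancy :: "nat \<Rightarrow> (nat \<Rightarrow> real \<times> real) \<Rightarrow> real" where
  "L2_discrepancy N \<beta> =
     sqrt (LINT x:{0..1} \<times> {0..1}|lborel. \<bar>local_discrepancy N \<beta> x\<bar>\<^sup>2)"

lemma digit_less: "b > 0 \<Longrightarrow> digit b j n < b"
  by (simp add: digit_def)

lemma digit_eq_0:
  assumes "b \<ge> 2" "n \<le> j"
  shows "digit b (Suc j) n = 0"
proof -
  have "n < b ^ n"
    using assms(1) by (intro less_exp[THEN order.strict_trans2] power_mono) auto
  also have "\<dots> \<le> b ^ j"
    using assms by (intro power_increasing) auto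
  finally show ?thesis by (simp add: digit_def)
qed

lemma digit_expansion_mod: "(\<Sum>j<m. digit b (Suc j) n * b ^ j) = n mod b ^ m"
proof (induction m)
  case (Suc m)
  have "n mod (b ^ m * b) = b ^ m * (n div b ^ m mod b) + n mod b ^ m"
    by (rule mod_mult2_eq)
  with Suc show ?case by (simp add: digit_def mult.commute)
qed simp

lemma digit_expansion:
  assumes "b \<ge> 2"
  shows "(\<lambda>j. digit b (Suc j) n * b ^ j) sums n"
proof -
  have "n < b ^ n"
    using assms by (intro less_exp[THEN order.strict_trans2] power_mono) auto
  moreover have "(\<lambda>j. digit b (Suc j) n * b ^ j) sums (\<Sum>j<n. digit b (Suc j) n * b ^ j)"
    using assms by (intro sums_finite) (auto simp: digit_eq_0)
  ultimately show ?thesis by (simp add: digit_expansion_mod)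
qed

lemma radical_inverse_sums:
  assumes "b \<ge> 2"
  shows "(\<lambda>j. real (digit b (Suc j) n) / real b ^ Suc j) sums radical_inverse b n"
proof -
  have "summable (\<lambda>j. real (digit b (Suc j) n) / real b ^ Suc j)"
    using assms by (intro summable_finite[of "{..<n}"]) (auto simp: digit_eq_0)
  then show ?thesis unfolding radical_inverse_def by (rule summable_sums)
qed

lemma local_discrepancy_measurable [measurable]: "local_discrepancy N \<beta> \<in> borel_measurable borel"
proof -
  have "local_discrepancy N \<beta> = (\<lambda>x. (\<Sum>n<N.
      if 0 \<le> fst (\<beta> n) \<and> fst (\<beta> n) < fst x \<and> 0 \<le> snd (\<beta> n) \<and> snd (\<beta> n) < snd x then 1 else 0)
      - real N * fst x * snd x)"
    unfolding local_discrepancy_def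
    by (intro ext arg_cong2[where f = minus] sum.cong) (auto simp: indicator_def mem_Times_iff)
  also have "\<dots> \<in> borel_measurable (borel \<Otimes>\<^sub>M borel)"
    by measurable
  finally show ?thesis by (simp add: borel_prod)
qed

lemma local_discrepancy_square_integrable:
  "set_integrable lborel ({0..1} \<times> {0..1}) (\<lambda>x. \<bar>local_discrepancy N \<beta> x\<bar>\<^sup>2)"
  unfolding set_integrable_def
proof (rule integrableI_bounded_set[where A = "{0..1} \<times> {0..1}" and B = "(2 * real N)\<^sup>2"])
  show "{0..1::real} \<times> {0..1::real} \<in> sets lborel"
    by (simp add: borel_closed closed_Times)
  then show "(\<lambda>x. indicat_real ({0..1} \<times> {0..1}) x *\<^sub>R \<bar>local_discrepancy N \<beta> x\<bar>\<^sup>2)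
      \<in> borel_measurable lborel"
    by measurable
  show "emeasure lborel ({0..1::real} \<times> {0..1::real}) < \<infinity>"
    by (intro emeasure_bounded_finite bounded_Times) auto
  have "\<bar>local_discrepancy N \<beta> x\<bar>\<^sup>2 \<le> (2 * real N)\<^sup>2" if "x \<in> {0..1} \<times> {0..1}" for x
  proof (rule power_mono)
    have "(\<Sum>n<N. indicator ({0..<fst x} \<times> {0..<snd x}) (\<beta> n) :: real) \<le> (\<Sum>n<N. 1)"
      by (intro sum_mono) (auto simp: indicator_def)
    moreover have "(\<Sum>n<N. indicator ({0..<fst x} \<times> {0..<snd x}) (\<beta> n) :: real) \<ge> 0"
      by (intro sum_nonneg) auto
    moreover have "fst x * snd x \<le> 1" "0 \<le> fst x * snd x"
      using that by (auto simp: mem_Times_iff mult_le_one)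
    then have "real N * (fst x * snd x) \<le> real N * 1" "0 \<le> real N * (fst x * snd x)"
      by (auto intro!: mult_left_mono simp del: mult_1_right)
    ultimately show "\<bar>local_discrepancy N \<beta> x\<bar> \<le> 2 * real N"
      by (simp add: local_discrepancy_def mult.assoc)
  qed auto
  then show "AE x in lborel. x \<in> {0..1} \<times> {0..1} \<longrightarrow>
      norm (indicat_real ({0..1} \<times> {0..1}) x *\<^sub>R \<bar>local_discrepancy N \<beta> x\<bar>\<^sup>2) \<le> (2 * real N)\<^sup>2"
    by (intro AE_I2) auto
qed (auto simp: indicator_def)

end

theory Submission
  imports Defs "HOL-Number_Theory.Residues" "HOL-Real_Asymp.Real_Asymp"
begin

text \<open>
  Fix \<open>L\<close> with \<open>2\<^sup>L \<ge> N\<close>. Up to a bounded error the local discrepancy at a point with digit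
  expansions \<open>u\<close> (base \<open>p\<close>) and \<open>v\<close> (base \<open>q\<close>) is a sum of terms \<open>T i j u v\<close>, \<open>i, j < L\<close>, each bounded
  and depending only on the first \<open>i + 1\<close> digits of \<open>u\<close> and the first \<open>j + 1\<close> digits of \<open>v\<close>: it
  counts the indices in residue classes modulo \<open>p\<^bsup>i+1\<^esup> q\<^bsup>j+1\<^esup>\<close>. It therefore suffices that the
  \<open>L\<^sup>4\<close> correlations of these terms sum to \<open>O(L\<^sup>2)\<close>. Averaging \<open>T i' j'\<close> over the \<open>m = i' - i\<close>
  digits of \<open>u\<close> that \<open>T i j\<close> does not see leaves the discrepancy \<open>\<eta>\<close> of the rotation by
  \<open>q\<^bsup>j'+1\<^esup> / p\<^sup>m\<close>, and similarly for \<open>v\<close>; a correlation is at most a constant times the geometric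
  mean of the two savings. So everything reduces to \<open>\<Sum>\<^bsub>m,j\<le>L\<^esub> \<surd>\<eta> = O(L)\<close>.

  By Dirichlet's theorem \<open>\<eta> > 6 / R\<close> forces \<open>s q\<^sup>j \<equiv> \<rho> (mod p\<^sup>m)\<close> with \<open>s \<le> R\<close> and \<open>\<bar>\<rho>\<bar> \<le> 2 R\<close>. For
  small \<open>m\<close> there are few such \<open>j\<close> because \<open>q\<close> has large order modulo \<open>p\<^sup>m\<close>. For large \<open>m\<close> a
  pigeonhole argument with multiplicatively independent ratios \<open>\<rho> / s\<close> shows that their number is
  polynomial in \<open>log R\<close>, uniformly in \<open>L\<close>.
\<close>

section \<open>Rotations by rational numbers\<close>

text \<open>Bounding each of the \<open>L^2\<close> terms by a constant only gives the classical
  bound of order \<open>L^2\<close> for the discrepancy itself; the gain of one factor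
  \<open>L\<close> comes entirely from near orthogonality of the terms. A single saving is not
  enough for this: it depends on one gap, \<open>i' - i\<close> or \<open>j' - j\<close>, and leaves
  the other gap free, so the sum over four indices would be of order \<open>L^3\<close>. Two
  positions ordered the same way admit either averaging, though not both at once, and the geometric
  mean of the two bounds makes the fourfold sum factor into two double sums; this is where the
  square root comes from. The obstacle is then uniformity in \<open>m\<close>. Separation of
  exponents controls scales \<open>R\<close> with \<open>R^8 \<le> p^m\<close> and
  \<open>R^4 \<le> L\<close>, hence saves at most about \<open>L^(-1/8)\<close> however large
  \<open>m\<close> is, and that is too little once \<open>m\<close> runs up to \<open>L\<close>. The
  pigeonhole argument is therefore used for all \<open>m\<close> beyond roughly
  \<open>L^(1/8)\<close>, and its polylogarithmic count makes each such \<open>m\<close> contribute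
  O(1).\<close>

lemma div_sum_consecutive:
  fixes k :: int and s :: nat
  assumes "s > 0"
  shows "(\<Sum>r<s. (k + int r) div int s) = k"
proof -
  \<comment> \<open>Hermite's identity: raising \<open>k\<close> by one drops \<open>k div s\<close>
    and appends \<open>(k + s) div s\<close>, which is larger by exactly one. Induction in both
    directions then covers negative \<open>k\<close>.\<close>
  have step: "(\<Sum>r<s. (k + 1 + int r) div int s) = (\<Sum>r<s. (k + int r) div int s) + 1" for k
  proof -
    have "(\<Sum>r<s. (k + 1 + int r) div int s) = (\<Sum>r<s. (k + int (Suc r)) div int s)"
      by (simp add: algebra_simps)
    also have "\<dots> = (\<Sum>r<Suc s. (k + int r) div int s) - k div int s"
      by (subst sum.lessThan_Suc_shift) simp
    also have "\<dots> = (\<Sum>r<s. (k + int r) div int s) + (k + int s) div int s - k div int s"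
      by simp
    finally show ?thesis using assms by simp
  qed
  show ?thesis
  proof (induction k rule: int_induct[where k = 0])
    case base
    have "(\<Sum>r<s. (0 + int r) div int s) = (\<Sum>r<s. 0)"
      by (intro sum.cong) auto
    then show ?case by simp
  next
    case (step1 i)
    then show ?case using step[of i] by simp
  next
    case (step2 i)
    then show ?case using step[of "i - 1"] by simp
  qed
qed

text \<open>Multiplication by \<open>h\<close> permutes the residues modulo \<open>s\<close>, so
  once the integer parts of \<open>h * t / s\<close> are split off, Hermite's identity evaluates the
  rest. The point of this form is that \<open>c\<close> does not depend on \<open>\<theta>\<close>
  and cancels when two floor sums are subtracted.\<close>

lemma floor_sum_rational_rotation:
  fixes h :: int and s :: nat
  assumes "s > 0" "coprime h (int s)"
  shows "\<exists>c. \<forall>\<theta>::real. (\<Sum>t<s. \<lfloor>\<theta> + of_int h * real t / real s\<rfloor>) = \<lfloor>real s * \<theta>\<rfloor> + c"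
proof -
  define f where "f t = nat (h * int t mod int s)" for t :: nat
  have f_int: "int (f t) = h * int t mod int s" for t
    using assms by (simp add: f_def)
  have "inj_on f {..<s}"
  proof (rule inj_onI)
    fix t t' assume t: "t \<in> {..<s}" "t' \<in> {..<s}" "f t = f t'"
    then have "h * int t mod int s = h * int t' mod int s" by (metis f_int)
    then have "int s dvd h * (int t - int t')"
      by (simp add: mod_eq_dvd_iff right_diff_distrib)
    then have "int s dvd int t - int t'"
      using assms(2) by (simp add: coprime_dvd_mult_right_iff coprime_commute)
    then have "int t mod int s = int t' mod int s" by (simp add: mod_eq_dvd_iff)
    then show "t = t'" using t by simp
  qed
  moreover have "f ` {..<s} \<subseteq> {..<s}"
    using assms(1) by (auto simp: f_def nat_less_iff)
  ultimately have bij: "bij_betw f {..<s} {..<s}"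
    by (simp add: bij_betw_def endo_inj_surj)
  have "(\<Sum>t<s. \<lfloor>\<theta> + of_int h * real t / real s\<rfloor>) = \<lfloor>real s * \<theta>\<rfloor> + (\<Sum>t<s. h * int t div int s)"
    for \<theta> :: real
  proof -
    have fl: "\<lfloor>\<theta> + of_int h * real t / real s\<rfloor> = (\<lfloor>real s * \<theta>\<rfloor> + int (f t)) div int s + h * int t div int s"
      for t
    proof -
      have "real_of_int (h * int t) = real_of_int (h * int t div int s) * real s + real (f t)"
        by (metis f_int div_mult_mod_eq of_int_add of_int_mult of_int_of_nat_eq)
      then have "\<theta> + of_int h * real t / real s
          = (real s * \<theta> + of_int (int (f t))) / real s + of_int (h * int t div int s)"
        using assms(1) by (simp add: field_simps)
      then have "\<lfloor>\<theta> + of_int h * real t / real s\<rfloor>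
          = \<lfloor>(real s * \<theta> + of_int (int (f t))) / real_of_int (int s)\<rfloor> + h * int t div int s"
        by (metis floor_add_int of_int_of_nat_eq)
      also have "\<lfloor>(real s * \<theta> + of_int (int (f t))) / real_of_int (int s)\<rfloor>
          = \<lfloor>real s * \<theta> + of_int (int (f t))\<rfloor> div int s"
        by (rule floor_divide_real_eq_div) simp
      finally show ?thesis by simp
    qed
    have "(\<Sum>t<s. (\<lfloor>real s * \<theta>\<rfloor> + int (f t)) div int s) = (\<Sum>r<s. (\<lfloor>real s * \<theta>\<rfloor> + int r) div int s)"
      using bij by (rule sum.reindex_bij_betw)
    then show ?thesis
      using assms(1) by (simp add: fl sum.distrib div_sum_consecutive)
  qed
  then show ?thesis by blast
qed

text \<open>For \<open>t < s\<close> the numbers \<open>\<alpha> * t\<close> and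
  \<open>h * t / s\<close> differ by at most \<open>1 / s\<close>, so the sum is squeezed between
  the rational ones at \<open>\<theta> - 1 / s\<close> and \<open>\<theta> + 1 / s\<close>. The
  shift costs one and the floor another one.\<close>

lemma floor_sum_rotation:
  fixes h :: int and s :: nat and \<alpha> :: real
  assumes "s > 0" "coprime h (int s)" "\<bar>of_nat s * \<alpha> - of_int h\<bar> \<le> 1 / real s"
  shows "\<exists>c. \<forall>\<theta>::real. \<bar>real_of_int ((\<Sum>t<s. \<lfloor>\<theta> + \<alpha> * real t\<rfloor>) - c) - real s * \<theta>\<bar> \<le> 2"
proof -
  obtain c where c: "\<And>\<theta>::real. (\<Sum>t<s. \<lfloor>\<theta> + of_int h * real t / real s\<rfloor>) = \<lfloor>real s * \<theta>\<rfloor> + c"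
    using floor_sum_rational_rotation[OF assms(1,2)] by blast
  have close: "\<bar>\<alpha> * real t - of_int h * real t / real s\<bar> \<le> 1 / real s" if "t < s" for t
  proof -
    have "\<alpha> * real t - of_int h * real t / real s = (real s * \<alpha> - of_int h) * (real t / real s)"
      using assms(1) by (simp add: field_simps)
    then have "\<bar>\<alpha> * real t - of_int h * real t / real s\<bar> = \<bar>real s * \<alpha> - of_int h\<bar> * (real t / real s)"
      by (simp add: abs_mult)
    also have "\<dots> \<le> (1 / real s) * 1"
      using assms that by (intro mult_mono) auto
    finally show ?thesis by simp
  qed
  have "\<bar>real_of_int ((\<Sum>t<s. \<lfloor>\<theta> + \<alpha> * real t\<rfloor>) - c) - real s * \<theta>\<bar> \<le> 2" for \<theta> :: real
  proof -
    have "(\<Sum>t<s. \<lfloor>\<theta> + \<alpha> * real t\<rfloor>) \<le> (\<Sum>t<s. \<lfloor>(\<theta> + 1 / real s) + of_int h * real t / real s\<rfloor>)"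
      using close by (intro sum_mono floor_mono) (fastforce simp: abs_le_iff)
    also have "\<dots> = \<lfloor>real s * \<theta> + 1\<rfloor> + c"
      using c[of "\<theta> + 1 / real s"] assms(1) by (simp add: distrib_left)
    finally have up: "(\<Sum>t<s. \<lfloor>\<theta> + \<alpha> * real t\<rfloor>) \<le> \<lfloor>real s * \<theta> + 1\<rfloor> + c" .
    have "\<lfloor>real s * \<theta> - 1\<rfloor> + c = (\<Sum>t<s. \<lfloor>(\<theta> - 1 / real s) + of_int h * real t / real s\<rfloor>)"
      using c[of "\<theta> - 1 / real s"] assms(1) by (simp add: right_diff_distrib)
    also have "\<dots> \<le> (\<Sum>t<s. \<lfloor>\<theta> + \<alpha> * real t\<rfloor>)"
      using close by (intro sum_mono floor_mono) (fastforce simp: abs_le_iff)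
    finally have "\<lfloor>real s * \<theta> - 1\<rfloor> + c \<le> (\<Sum>t<s. \<lfloor>\<theta> + \<alpha> * real t\<rfloor>)" .
    with up show ?thesis by linarith
  qed
  then show ?thesis by blast
qed

text \<open>Writes the indicator of an arc of residues as a difference of floors; an orbit count
  then becomes a difference of two floor sums with the same rotation and different
  \<open>\<theta>\<close>.\<close>

lemma mod_less_eq_floor_diff:
  fixes y P w :: int
  assumes "0 < P" "0 \<le> w" "w \<le> P"
  shows "(of_bool (y mod P < w) :: int) = \<lfloor>real_of_int y / real_of_int P\<rfloor> - \<lfloor>real_of_int y / real_of_int P - real_of_int w / real_of_int P\<rfloor>"
proof -
  have "\<lfloor>real_of_int y / real_of_int P\<rfloor> = y div P"
    by (rule floor_divide_of_int_eq)
  moreover have "\<lfloor>real_of_int y / real_of_int P - real_of_int w / real_of_int P\<rfloor> = (y - w) div P"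
    by (simp add: floor_divide_of_int_eq flip: diff_divide_distrib of_int_diff)
  moreover have "(y - w) div P = y div P + (y mod P - w) div P"
  proof -
    have "y - w = (y mod P - w) + (y div P) * P" by (simp add: algebra_simps)
    then show ?thesis using assms by (metis add.commute div_mult_self1 less_irrefl)
  qed
  moreover have "(y mod P - w) div P = (if y mod P < w then - 1 else 0)"
  proof -
    have b: "0 \<le> y mod P" "y mod P < P" using assms by auto
    show ?thesis
    proof (cases "y mod P < w")
      case True
      have "(y mod P - w) div P = (y mod P - w + P) div P - 1"
        using assms by simp
      also have "(y mod P - w + P) div P = 0"
      proof (rule div_pos_pos_trivial)
        show "0 \<le> y mod P - w + P" "y mod P - w + P < P" using True b assms by linarith+
      qed
      finally show ?thesis using True by simp
    next
      case False
      have "(y mod P - w) div P = 0"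
      proof (rule div_pos_pos_trivial)
        show "0 \<le> y mod P - w" "y mod P - w < P" using False b assms by linarith+
      qed
      then show ?thesis using False by simp
    qed
  qed
  ultimately show ?thesis by simp
qed

section \<open>Orbit counts of rotations modulo \<open>P\<close>\<close>

definition rotation_count :: "int \<Rightarrow> int \<Rightarrow> int \<Rightarrow> int \<Rightarrow> nat \<Rightarrow> real" where
  "rotation_count P w \<kappa> c T = (\<Sum>t<T. of_bool ((c + \<kappa> * int t) mod P < w))"

lemma rotation_count_add:
  "rotation_count P w \<kappa> c (T + T') = rotation_count P w \<kappa> c T + rotation_count P w \<kappa> (c + \<kappa> * int T) T'"
proof -
  have "(\<Sum>t<T + T'. of_bool ((c + \<kappa> * int t) mod P < w) :: real)
    = (\<Sum>t<T. of_bool ((c + \<kappa> * int t) mod P < w)) + (\<Sum>t=T..<T+T'. of_bool ((c + \<kappa> * int t) mod P < w))"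
    unfolding lessThan_atLeast0 by (rule sum.atLeastLessThan_concat[symmetric]) auto
  also have "(\<Sum>t=T..<T+T'. of_bool ((c + \<kappa> * int t) mod P < w) :: real)
    = (\<Sum>t<T'. of_bool ((c + \<kappa> * int (T + t)) mod P < w))"
    using sum.shift_bounds_nat_ivl[of "\<lambda>t. of_bool ((c + \<kappa> * int t) mod P < w)" 0 T T']
    unfolding lessThan_atLeast0 by (simp only: add_0 add.commute)
  finally show ?thesis unfolding rotation_count_def by (simp only: of_nat_add distrib_left add.assoc)
qed

lemma rotation_count_bounds: "0 \<le> rotation_count P w \<kappa> c T" "rotation_count P w \<kappa> c T \<le> real T"
proof -
  show "0 \<le> rotation_count P w \<kappa> c T" unfolding rotation_count_def by (intro sum_nonneg) auto
  have "rotation_count P w \<kappa> c T \<le> (\<Sum>t<T. 1)" unfolding rotation_count_def by (intro sum_mono) auto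
  then show "rotation_count P w \<kappa> c T \<le> real T" by simp
qed

lemma rotation_count_trivial:
  assumes "0 < P" "0 \<le> w" "w \<le> P"
  shows "\<bar>rotation_count P w \<kappa> c T - real T * of_int w / of_int P\<bar> \<le> real T"
proof -
  have "0 \<le> real_of_int w / of_int P" "real_of_int w / of_int P \<le> 1" using assms by auto
  then have "0 \<le> real T * (of_int w / of_int P)" "real T * (of_int w / of_int P) \<le> real T * 1"
    by (intro mult_nonneg_nonneg mult_left_mono; simp)+
  then show ?thesis using rotation_count_bounds[of P w \<kappa> c T] by simp
qed

text \<open>The two floor sums carry the same constant, which cancels, and each contributes an error
  of at most two.\<close>

lemma rotation_count_block:
  fixes h :: int and s :: nat
  assumes "0 < P" "0 \<le> w" "w \<le> P" "s > 0" "coprime h (int s)"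
    and "\<bar>real s * (of_int \<kappa> / of_int P) - of_int h\<bar> \<le> 1 / real s"
  shows "\<bar>rotation_count P w \<kappa> c s - real s * of_int w / of_int P\<bar> \<le> 4"
proof -
  define \<alpha> where "\<alpha> = real_of_int \<kappa> / of_int P"
  obtain k where k: "\<And>\<theta>::real. \<bar>real_of_int ((\<Sum>t<s. \<lfloor>\<theta> + \<alpha> * real t\<rfloor>) - k) - real s * \<theta>\<bar> \<le> 2"
    using floor_sum_rotation[OF assms(4,5), of \<alpha>] assms(6) by (auto simp: \<alpha>_def)
  define \<theta> where "\<theta> = real_of_int c / of_int P"
  have "of_bool ((c + \<kappa> * int t) mod P < w)
     = real_of_int (\<lfloor>\<theta> + \<alpha> * real t\<rfloor> - \<lfloor>(\<theta> - of_int w / of_int P) + \<alpha> * real t\<rfloor>)" for t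
  proof -
    have "of_bool ((c + \<kappa> * int t) mod P < w) = real_of_int (of_bool ((c + \<kappa> * int t) mod P < w))" by simp
    also have "\<dots> = real_of_int (\<lfloor>\<theta> + \<alpha> * real t\<rfloor> - \<lfloor>(\<theta> - of_int w / of_int P) + \<alpha> * real t\<rfloor>)"
      unfolding mod_less_eq_floor_diff[OF assms(1-3)]
      by (simp add: \<theta>_def \<alpha>_def add_divide_distrib algebra_simps)
    finally show ?thesis .
  qed
  then have "rotation_count P w \<kappa> c s = real_of_int ((\<Sum>t<s. \<lfloor>\<theta> + \<alpha> * real t\<rfloor>) - k)
     - real_of_int ((\<Sum>t<s. \<lfloor>(\<theta> - of_int w / of_int P) + \<alpha> * real t\<rfloor>) - k)"
    by (simp add: rotation_count_def sum_subtractf)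
  moreover have "real s * (\<theta> - of_int w / of_int P) = real s * \<theta> - real s * of_int w / of_int P"
    by (simp add: algebra_simps)
  ultimately show ?thesis
    using k[of \<theta>] k[of "\<theta> - of_int w / of_int P"] by linarith
qed

lemma rotation_count_blocks:
  fixes h :: int and s :: nat
  assumes "0 < P" "0 \<le> w" "w \<le> P" "s > 0" "coprime h (int s)"
    and "\<bar>real s * (of_int \<kappa> / of_int P) - of_int h\<bar> \<le> 1 / real s"
  shows "\<bar>rotation_count P w \<kappa> c (s * n) - real (s * n) * of_int w / of_int P\<bar> \<le> 4 * real n"
proof (induction n arbitrary: c)
  case 0
  then show ?case by (simp add: rotation_count_def)
next
  case (Suc n)
  have "rotation_count P w \<kappa> c (s * Suc n)
     = rotation_count P w \<kappa> c s + rotation_count P w \<kappa> (c + \<kappa> * int s) (s * n)"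
    by (simp flip: rotation_count_add)
  moreover have "real (s * Suc n) * of_int w / of_int P
     = real s * of_int w / of_int P + real (s * n) * of_int w / of_int P"
    by (simp add: algebra_simps add_divide_distrib)
  ultimately show ?case
    using Suc[of "c + \<kappa> * int s"] rotation_count_block[OF assms, of c] by (simp add: abs_le_iff)
qed

lemma rotation_count_period:
  assumes "0 < P" "0 \<le> w" "w \<le> P" "coprime \<kappa> P"
  shows "rotation_count P w \<kappa> c (nat P) = of_int w"
proof -
  define f where "f t = (c + \<kappa> * int t) mod P" for t
  have "inj_on f {..<nat P}"
  proof (rule inj_onI)
    fix t t' assume t: "t \<in> {..<nat P}" "t' \<in> {..<nat P}" "f t = f t'"
    then have "P dvd (c + \<kappa> * int t) - (c + \<kappa> * int t')"
      unfolding f_def by (simp only: mod_eq_dvd_iff)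
    then have "P dvd \<kappa> * (int t - int t')" by (simp add: algebra_simps)
    then have "P dvd int t - int t'"
      using assms(4) by (simp add: coprime_dvd_mult_right_iff coprime_commute)
    then have "int t mod P = int t' mod P" by (simp add: mod_eq_dvd_iff)
    then show "t = t'" using t by (simp add: nat_less_iff zless_nat_eq_int_zless)
  qed
  moreover have "f ` {..<nat P} \<subseteq> {0..<P}"
    using assms(1) by (auto simp: f_def)
  moreover have "card (f ` {..<nat P}) = card {0..<P}"
    using \<open>inj_on f {..<nat P}\<close> by (simp add: card_image)
  ultimately have bij: "bij_betw f {..<nat P} {0..<P}"
    by (simp add: bij_betw_def card_subset_eq)
  have "rotation_count P w \<kappa> c (nat P) = (\<Sum>y\<in>{0..<P}. of_bool (y < w))"
    unfolding rotation_count_def f_def[symmetric] using bij by (rule sum.reindex_bij_betw)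
  also have "\<dots> = (\<Sum>y\<in>{0..<w}. 1)"
    using assms by (intro sum.mono_neutral_cong_right) auto
  finally show ?thesis using assms by simp
qed

lemma rotation_count_reduce:
  assumes "0 < P" "0 \<le> w" "w \<le> P" "coprime \<kappa> P"
  shows "rotation_count P w \<kappa> c (nat P * n) = real n * of_int w"
proof (induction n arbitrary: c)
  case (Suc n)
  have "rotation_count P w \<kappa> c (nat P * Suc n)
     = rotation_count P w \<kappa> c (nat P) + rotation_count P w \<kappa> (c + \<kappa> * int (nat P)) (nat P * n)"
    unfolding mult_Suc_right by (rule rotation_count_add)
  then show ?case using Suc[of "c + \<kappa> * int (nat P)"] rotation_count_period[OF assms, of c]
    by (simp add: algebra_simps)
qed (simp add: rotation_count_def)

text \<open>Since \<open>\<kappa>\<close> is a unit, a full period meets every residue once and is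
  counted exactly; only the remainder of \<open>T\<close> modulo \<open>P\<close> can contribute an
  error.\<close>

lemma rotation_count_discrepancy_reduce:
  assumes "0 < P" "0 \<le> w" "w \<le> P" "coprime \<kappa> P"
    and "\<And>c T. T < nat P \<Longrightarrow> \<bar>rotation_count P w \<kappa> c T - real T * of_int w / of_int P\<bar> \<le> B"
  shows "\<bar>rotation_count P w \<kappa> c T - real T * of_int w / of_int P\<bar> \<le> B"
proof -
  define n r where "n = T div nat P" and "r = T mod nat P"
  have T: "T = nat P * n + r" by (simp add: n_def r_def)
  have "rotation_count P w \<kappa> c T = real n * of_int w + rotation_count P w \<kappa> (c + \<kappa> * int (nat P * n)) r"
    unfolding T rotation_count_add rotation_count_reduce[OF assms(1-4)] ..
  moreover have "real T * of_int w / of_int P = real n * of_int w + real r * of_int w / of_int P"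
    using assms(1) by (simp add: T field_simps)
  moreover have "r < nat P" using assms(1) by (simp add: r_def)
  ultimately show ?thesis using assms(5)[of r "c + \<kappa> * int (nat P * n)"] by simp
qed

text \<open>The exponents \<open>j\<close> for which \<open>q\<^sup>j / p\<^sup>m\<close> may be too close to a fraction with
  denominator at most \<open>R\<close> for the rotation by \<open>q\<^sup>j / p\<^sup>m\<close> to be well distributed.\<close>

definition near_powers :: "nat \<Rightarrow> nat \<Rightarrow> nat \<Rightarrow> nat \<Rightarrow> nat set" where
  "near_powers p q m R =
     {j. \<exists>s \<rho>. 1 \<le> s \<and> s \<le> R \<and> \<bar>\<rho>\<bar> \<le> 2 * int R \<and> int p ^ m dvd int s * int q ^ j - \<rho>}"

text \<open>Dirichlet approximation with denominators up to \<open>S\<close>, about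
  \<open>p ^ m / R\<close>, yields a denominator \<open>s\<close>. If \<open>s\<close> were below
  \<open>R\<close>, some residue of \<open>s * q ^ j\<close> would be at most \<open>2 * R\<close>
  in absolute value and \<open>j\<close> would be a near power. Hence
  \<open>R \<le> s \<le> S\<close>: a stretch shorter than \<open>p ^ m\<close> splits into at most
  \<open>p ^ m / R\<close> blocks of length \<open>s\<close>, each with error 4, and a remainder of
  length at most \<open>p ^ m / R\<close>, which makes 5 in all.\<close>

lemma rotation_count_not_near_power:
  fixes p q m j R :: nat and w c :: int
  assumes "p > 0" "coprime p q" "0 \<le> w" "w \<le> int p ^ m" "R \<ge> 1" "R\<^sup>2 \<le> p ^ m"
    and "j \<notin> near_powers p q m R"
  shows "\<bar>rotation_count (int p ^ m) w (int q ^ j) c T - real T * of_int w / real p ^ m\<bar>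
    \<le> 5 * real p ^ m / real R"
proof -
  define P where "P = p ^ m"
  define S where "S = P div R"
  have P: "0 < P" and Pint: "int p ^ m = int P" and Preal: "real p ^ m = real P"
    using assms by (auto simp: P_def)
  have RP: "R * R \<le> P" using assms by (simp add: P_def power2_eq_square)
  have S: "S \<ge> R" "S * R \<le> P"
    using RP assms(5) by (auto simp: S_def less_eq_div_iff_mult_less_eq mult.commute)
  \<comment> \<open>From \<open>1 \<le> R \<le> S\<close> follows \<open>S + 1 \<le> 2 * S\<close>,
    whence \<open>P / S \<le> 2 * R\<close>; this is the source of the factor two in
    \<open>near_powers\<close>.\<close>
  have "P < (S + 1) * R"
    unfolding S_def using assms(5) dividend_less_div_times[of R P] by (simp add: algebra_simps)
  also have "\<dots> \<le> 2 * S * R" using S assms(5) by (intro mult_right_mono) auto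
  finally have "real P < 2 * real S * real R"
    by (metis of_nat_less_iff of_nat_mult of_nat_numeral)
  then have PS: "real P / real S \<le> 2 * real R"
    using S assms(5) by (simp add: field_simps)
  have S0: "S > 0" using S assms(5) by simp
  define \<alpha> where "\<alpha> = real_of_int (int q ^ j) / real_of_int (int P)"
  obtain h k where hk: "coprime h k" "0 < k" "k \<le> int S" "\<bar>of_int k * \<alpha> - of_int h\<bar> < 1 / real S"
    using Dirichlet_approx_coprime[OF S0, of \<alpha>] by metis
  define s where "s = nat k"
  have s: "k = int s" "0 < s" "s \<le> S" using hk by (auto simp: s_def)
  have close: "\<bar>real s * \<alpha> - of_int h\<bar> \<le> 1 / real s"
  proof -
    have "1 / real S \<le> 1 / real s" using s by (intro divide_left_mono) auto
    then show ?thesis using hk(4) s(1) by simp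
  qed
  have "R \<le> s"
  proof (rule ccontr)
    assume "\<not> R \<le> s"
    define \<rho> where "\<rho> = int s * int q ^ j - h * int P"
    have "real_of_int \<rho> = (real s * \<alpha> - of_int h) * real P"
      using P by (simp add: \<rho>_def \<alpha>_def field_simps)
    then have "\<bar>real_of_int \<rho>\<bar> = \<bar>real s * \<alpha> - of_int h\<bar> * real P"
      by (simp add: abs_mult)
    also have "\<dots> \<le> (1 / real S) * real P"
      using hk(4) s(1) by (intro mult_right_mono) auto
    also have "\<dots> \<le> 2 * real R" using PS by simp
    finally have "\<bar>\<rho>\<bar> \<le> 2 * int R" by linarith
    moreover have "int p ^ m dvd int s * int q ^ j - \<rho>"
      by (simp add: \<rho>_def Pint)
    ultimately have "j \<in> near_powers p q m R"
      unfolding near_powers_def using s \<open>\<not> R \<le> s\<close>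
      by (intro CollectI exI[of _ s] exI[of _ \<rho>] conjI) linarith+
    then show False using assms(7) by simp
  qed
  have cop: "coprime (int q ^ j) (int P)"
    using assms(2) by (simp add: P_def coprime_commute)
  have w: "0 < int P" "0 \<le> w" "w \<le> int P" using P assms Pint by auto
  have "\<bar>rotation_count (int P) w (int q ^ j) c T - real T * of_int w / of_int (int P)\<bar>
     \<le> 5 * real P / real R"
  proof (rule rotation_count_discrepancy_reduce[OF w cop])
    fix c T assume "T < nat (int P)"
    define n r where "n = T div s" and "r = T mod s"
    have T: "T = s * n + r" by (simp add: n_def r_def)
    have "rotation_count (int P) w (int q ^ j) c T = rotation_count (int P) w (int q ^ j) c (s * n)
        + rotation_count (int P) w (int q ^ j) (c + int q ^ j * int (s * n)) r"
      unfolding T by (rule rotation_count_add)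
    moreover have "real T * of_int w / of_int (int P)
        = real (s * n) * of_int w / of_int (int P) + real r * of_int w / of_int (int P)"
      by (simp add: T algebra_simps add_divide_distrib)
    moreover note rotation_count_blocks[OF w s(2) hk(1)[unfolded s(1)] close[unfolded \<alpha>_def], of c n]
      rotation_count_trivial[OF w, of "int q ^ j" "c + int q ^ j * int (s * n)" r]
    ultimately have "\<bar>rotation_count (int P) w (int q ^ j) c T - real T * of_int w / of_int (int P)\<bar>
        \<le> 4 * real n + real r" by linarith
    also have "real n \<le> real P / real R"
    proof -
      have "R * n \<le> s * n" using \<open>R \<le> s\<close> by simp
      also have "\<dots> \<le> P" using T \<open>T < nat (int P)\<close> by simp
      finally show ?thesis using assms(5) by (simp add: field_simps flip: of_nat_mult)
    qed
    also have "real r \<le> real P / real R"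
    proof -
      have "r \<le> S" using s mod_less_divisor[of s T] unfolding r_def by linarith
      then have "r * R \<le> P" using S(2) mult_le_mono1 order.trans by blast
      then show ?thesis using assms(5) by (simp add: field_simps flip: of_nat_mult)
    qed
    finally show "\<bar>rotation_count (int P) w (int q ^ j) c T - real T * of_int w / of_int (int P)\<bar>
        \<le> 5 * real P / real R" by simp
  qed
  then show ?thesis by (simp add: Pint Preal)
qed

text \<open>The saving \<eta>, relative to the period \<open>p ^ m\<close>. Dyadic values of
  \<open>R\<close> suffice, and \<open>4 ^ k \<le> p ^ m\<close> is the condition
  \<open>R\<^sup>2 \<le> p ^ m\<close>. The numerator is 6 rather than 5 to leave room for one unit
  of rounding; the inserted 1 is the trivial bound and keeps the set nonempty.\<close>

definition rotation_bound :: "nat \<Rightarrow> nat \<Rightarrow> nat \<Rightarrow> nat \<Rightarrow> real" where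
  "rotation_bound p q m j =
     Min (insert 1 ((\<lambda>k. 6 / 2 ^ k) ` {k. 4 ^ k \<le> p ^ m \<and> j \<notin> near_powers p q m (2 ^ k)}))"

lemma finite_rotation_bound:
  "finite (insert (1::real) ((\<lambda>k. 6 / 2 ^ k) ` {k. 4 ^ k \<le> p ^ m \<and> j \<notin> near_powers p q m (2 ^ k)}))"
proof -
  have "k < p ^ m" if "4 ^ k \<le> p ^ m" for k
  proof -
    have "k < 2 ^ k" by (rule less_exp)
    also have "(2::nat) ^ k \<le> 4 ^ k" by (rule power_mono) auto
    finally show ?thesis using that by simp
  qed
  then have "{k. 4 ^ k \<le> p ^ m \<and> j \<notin> near_powers p q m (2 ^ k)} \<subseteq> {..<p ^ m}" by auto
  then show ?thesis by (simp add: finite_subset)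
qed

lemma rotation_bound_le_1: "rotation_bound p q m j \<le> 1"
  unfolding rotation_bound_def by (rule Min_le[OF finite_rotation_bound]) simp

lemma rotation_bound_nonneg: "0 \<le> rotation_bound p q m j"
  unfolding rotation_bound_def by (subst Min_ge_iff[OF finite_rotation_bound]) auto

lemma rotation_bound_le:
  assumes "4 ^ k \<le> p ^ m" "j \<notin> near_powers p q m (2 ^ k)"
  shows "rotation_bound p q m j \<le> 6 / 2 ^ k"
  unfolding rotation_bound_def by (rule Min_le[OF finite_rotation_bound]) (use assms in auto)

text \<open>The extra 1 on the left is reserved for replacing the number of terms of a progression
  by its expected value.\<close>

lemma rotation_count_le_rotation_bound:
  fixes p q m j :: nat and w c :: int
  assumes "p > 0" "coprime p q" "0 \<le> w" "w \<le> int p ^ m"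
  shows "\<bar>rotation_count (int p ^ m) w (int q ^ j) c T - real T * of_int w / real p ^ m\<bar> + 1
    \<le> rotation_bound p q m j * real p ^ m"
proof -
  have "rotation_bound p q m j \<in> insert 1 ((\<lambda>k. 6 / 2 ^ k) ` {k. 4 ^ k \<le> p ^ m \<and> j \<notin> near_powers p q m (2 ^ k)})"
    unfolding rotation_bound_def using finite_rotation_bound by (rule Min_in) simp
  then consider "rotation_bound p q m j = 1"
    | k where "4 ^ k \<le> p ^ m" "j \<notin> near_powers p q m (2 ^ k)" "rotation_bound p q m j = 6 / 2 ^ k"
    by auto
  then show ?thesis
  proof cases
    case 1
    have P: "0 < int p ^ m" using assms by simp
    have cop: "coprime (int q ^ j) (int p ^ m)"
      using assms(2) by (simp add: coprime_commute)
    \<comment> \<open>Restricting to \<open>T < p ^ m\<close> gives \<open>p ^ m - 1\<close> instead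
      of \<open>p ^ m\<close>; the missing unit pays for the extra 1.\<close>
    have "\<bar>rotation_count (int p ^ m) w (int q ^ j) c T - real T * of_int w / of_int (int p ^ m)\<bar> \<le> real p ^ m - 1"
    proof (rule rotation_count_discrepancy_reduce[OF P assms(3,4) cop])
      fix c T assume "T < nat (int p ^ m)"
      then have "T < p ^ m" by (simp add: nat_power_eq)
      then have "real T \<le> real p ^ m - 1" by (simp flip: of_nat_power)
      then show "\<bar>rotation_count (int p ^ m) w (int q ^ j) c T - real T * of_int w / of_int (int p ^ m)\<bar>
          \<le> real p ^ m - 1"
        using rotation_count_trivial[OF P assms(3,4), of "int q ^ j" c T] by linarith
    qed
    then show ?thesis using 1 by simp
  next
    case (2 k)
    have "(2 ^ k)\<^sup>2 = (4::nat) ^ k" by (simp add: power2_eq_square flip: power_mult_distrib)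
    then have "\<bar>rotation_count (int p ^ m) w (int q ^ j) c T - real T * of_int w / real p ^ m\<bar>
        \<le> 5 * real p ^ m / 2 ^ k"
      using rotation_count_not_near_power[OF assms, of "2 ^ k" j c T] 2 by simp
    moreover have "1 \<le> real p ^ m / 2 ^ k"
    proof -
      have "(2::nat) ^ k \<le> 4 ^ k" by (rule power_mono) auto
      also have "\<dots> \<le> p ^ m" by (rule 2)
      finally have "(2::real) ^ k \<le> real p ^ m"
        by (metis of_nat_le_iff of_nat_numeral of_nat_power)
      then show ?thesis by simp
    qed
    ultimately have "\<bar>rotation_count (int p ^ m) w (int q ^ j) c T - real T * of_int w / real p ^ m\<bar> + 1
        \<le> 5 * real p ^ m / 2 ^ k + real p ^ m / 2 ^ k" by (rule add_mono)
    also have "\<dots> = rotation_bound p q m j * real p ^ m" by (simp add: 2(3))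
    finally show ?thesis .
  qed
qed

section \<open>Powers of one prime near small fractions modulo powers of another\<close>

text \<open>Lifting the exponent; \<open>c \<ge> 2\<close> also covers \<open>p = 2\<close>.\<close>

lemma prime_power_dvd_power_minus_1:
  fixes p \<Delta> c :: nat and w :: int
  assumes "prime p" "c \<ge> 2" "\<not> int p dvd w" "\<Delta> \<ge> 1" "int p ^ e dvd (1 + int p ^ c * w) ^ \<Delta> - 1"
  shows "p ^ e \<le> p ^ c * \<Delta>"
  using assms(2-)
proof (induction \<Delta> arbitrary: c w rule: less_induct)
  case (less \<Delta>)
  define x where "x = int p ^ c * w"
  have p: "prime (int p)" "int p > 0" using assms(1) by (auto simp: prime_gt_0_nat)
  have p2x: "(int p)\<^sup>2 dvd x"
    unfolding x_def using less.prems(1) by (intro dvd_mult2 le_imp_power_dvd)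
  have cong1: "(int p)\<^sup>2 dvd (1 + x) ^ i - 1" for i
  proof -
    have "(1 + x) ^ i - 1 = x * (\<Sum>k<i. (1 + x) ^ k)"
      using power_diff_1_eq[of "1 + x" i] by simp
    then show ?thesis using p2x by simp
  qed
  \<comment> \<open>As \<open>c \<ge> 2\<close>, the square of \<open>p\<close> divides
    \<open>x\<close>, so the sum is \<open>n\<close> modulo that square. With \<open>x\<close>
    divisible by \<open>p\<close> only once, the sum of \<open>p\<close> terms could contain a
    higher power of \<open>p\<close>, which does happen for \<open>p = 2\<close>.\<close>
  have sum_cong: "(int p)\<^sup>2 dvd (\<Sum>i<n. (1 + x) ^ i) - int n" for n
  proof -
    have "(\<Sum>i<n. (1 + x) ^ i) - int n = (\<Sum>i<n. (1 + x) ^ i - 1)"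
      by (simp add: sum_subtractf)
    then show ?thesis using cong1 by (simp add: dvd_sum)
  qed
  have eq: "(1 + x) ^ n - 1 = int p ^ c * (w * (\<Sum>i<n. (1 + x) ^ i))" for n
    using power_diff_1_eq[of "1 + x" n] by (simp add: x_def mult.assoc)
  show ?case
  proof (cases "p dvd \<Delta>")
    case False
    define \<sigma> where "\<sigma> = (\<Sum>i<\<Delta>. (1 + x) ^ i)"
    have "int p dvd \<sigma> - int \<Delta>"
      using sum_cong[of \<Delta>] unfolding \<sigma>_def power2_eq_square by (rule dvd_mult_left)
    then have "\<not> int p dvd \<sigma>"
      using False dvd_diff[of "int p" \<sigma> "\<sigma> - int \<Delta>"] by auto
    then have "\<not> int p dvd w * \<sigma>"
      using less.prems(2) p(1) by (simp add: prime_dvd_mult_iff)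
    then have "coprime (int p ^ e) (w * \<sigma>)"
      using p(1) by (simp add: prime_imp_coprime coprime_power_left_iff del: coprime_mult_right_iff)
    moreover have "int p ^ e dvd int p ^ c * (w * \<sigma>)"
      using less.prems(4) eq[of \<Delta>] by (simp add: x_def \<sigma>_def)
    ultimately have "int p ^ e dvd int p ^ c"
      by (simp add: coprime_dvd_mult_left_iff del: coprime_mult_right_iff)
    then have "int p ^ e \<le> int p ^ c" using p(2) by (intro zdvd_imp_le) auto
    then have "p ^ e \<le> p ^ c" by (metis of_nat_le_iff of_nat_power)
    also have "\<dots> \<le> p ^ c * \<Delta>" using less.prems(3) by simp
    finally show ?thesis .
  next
    case True
    then obtain \<Delta>' where \<Delta>': "\<Delta> = p * \<Delta>'" by blast
    have lt: "\<Delta>' < \<Delta>" "\<Delta>' \<ge> 1"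
    proof -
      show "\<Delta>' \<ge> 1" using \<Delta>' less.prems(3) by (cases \<Delta>') auto
      then show "\<Delta>' < \<Delta>" using \<Delta>' prime_gt_1_nat[OF assms(1)] by simp
    qed
    \<comment> \<open>The sum is \<open>p\<close> times a number prime to \<open>p\<close>: raising
      to the power \<open>p\<close> lifts the exponent by exactly one and keeps the cofactor prime
      to \<open>p\<close>, so the induction continues with \<open>\<Delta>'\<close> and
      \<open>Suc c\<close>.\<close>
    obtain z where z: "(\<Sum>i<p. (1 + x) ^ i) = int p * (1 + int p * z)"
    proof -
      obtain z where "(\<Sum>i<p. (1 + x) ^ i) - int p = (int p)\<^sup>2 * z"
        using sum_cong[of p] by blast
      then have "(\<Sum>i<p. (1 + x) ^ i) = int p * (1 + int p * z)"
        by (simp add: algebra_simps power2_eq_square)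
      then show ?thesis by (rule that)
    qed
    define w' where "w' = w * (1 + int p * z)"
    have "(1 + x) ^ p = 1 + int p ^ Suc c * w'"
      using eq[of p] unfolding z by (simp add: w'_def algebra_simps)
    then have "(1 + x) ^ \<Delta> = (1 + int p ^ Suc c * w') ^ \<Delta>'"
      by (simp add: \<Delta>' power_mult)
    then have "int p ^ e dvd (1 + int p ^ Suc c * w') ^ \<Delta>' - 1"
      using less.prems(4) by (simp add: x_def)
    moreover have "\<not> int p dvd w'"
    proof -
      have "\<not> int p dvd 1 + int p * z"
        using prime_gt_1_nat[OF assms(1)] by (simp add: dvd_add_left_iff)
      then show ?thesis using less.prems(2) p(1) by (simp add: w'_def prime_dvd_mult_iff)
    qed
    ultimately have "p ^ e \<le> p ^ Suc c * \<Delta>'"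
      using less.IH[OF lt(1), of "Suc c" w'] lt(2) less.prems(1) by simp
    then show ?thesis by (simp add: \<Delta>' ac_simps)
  qed
qed

text \<open>By Euler's theorem \<open>q ^ f\<close> is 1 modulo \<open>p\<^sup>2\<close> for
  \<open>f = totient (p\<^sup>2)\<close>. With \<open>c\<close> the exact exponent of
  \<open>p\<close> in \<open>q ^ f - 1\<close>, the exponent can be lifted along multiples of
  \<open>f\<close>, and \<open>q ^ \<Delta> - 1\<close> divides
  \<open>q ^ (f * \<Delta>) - 1\<close>. The factor \<open>s\<close> absorbs a power of
  \<open>p\<close> of size at most \<open>s\<close>. So \<open>K = p ^ c\<close> works; in
  particular \<open>q\<close> has order at least \<open>p ^ m / K\<close> modulo
  \<open>p ^ m\<close>.\<close>

lemma prime_power_dvd_mult_power_minus_1: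
  fixes p q :: nat
  assumes "prime p" "coprime p q" "q \<ge> 2"
  shows "\<exists>K\<ge>1. \<forall>m s \<Delta>. s \<ge> 1 \<longrightarrow> \<Delta> \<ge> 1 \<longrightarrow> int p ^ m dvd int s * (int q ^ \<Delta> - 1) \<longrightarrow> p ^ m \<le> K * s * \<Delta>"
proof -
  have p: "prime (int p)" "p \<ge> 2" using assms(1) by (auto simp: prime_ge_2_nat)
  define f where "f = totient (p\<^sup>2)"
  define x where "x = int q ^ f - 1"
  have "[q ^ f = 1] (mod p\<^sup>2)"
    unfolding f_def using assms(2) by (intro euler_theorem) (simp add: coprime_commute)
  then have "[int q ^ f = 1] (mod (int p)\<^sup>2)"
    by (metis cong_int_iff of_nat_1 of_nat_power)
  then have p2: "(int p)\<^sup>2 dvd x"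
    by (simp add: x_def cong_iff_dvd_diff)
  have f: "f \<ge> 1" using p by (simp add: f_def Suc_le_eq)
  have "int q ^ f > 1" using f assms(3) by (intro one_less_power) auto
  then have x0: "x \<noteq> 0" by (simp add: x_def)
  define c where "c = multiplicity (int p) x"
  have c2: "c \<ge> 2"
    unfolding c_def using p2 x0 p by (intro multiplicity_geI) (auto simp: not_prime_unit)
  obtain w where w: "x = int p ^ c * w" "\<not> int p dvd w"
  proof -
    have "\<not> is_unit (int p)" using p(1) not_prime_unit by blast
    from multiplicity_decompose'[OF x0 this] show ?thesis
      using that unfolding c_def by (metis mult.commute)
  qed
  have main: "p ^ e \<le> p ^ c * \<Delta>" if "\<Delta> \<ge> 1" "int p ^ e dvd int q ^ \<Delta> - 1" for e \<Delta>
  proof (rule prime_power_dvd_power_minus_1[OF assms(1) c2 w(2) that(1)])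
    have "1 + int p ^ c * w = int q ^ f" using w(1) by (simp add: x_def)
    then have "(1 + int p ^ c * w) ^ \<Delta> - 1 = (int q ^ \<Delta>) ^ f - 1"
      by (simp add: mult.commute flip: power_mult)
    then have "int q ^ \<Delta> - 1 dvd (1 + int p ^ c * w) ^ \<Delta> - 1"
      using power_diff_1_eq[of "int q ^ \<Delta>" f] by simp
    then show "int p ^ e dvd (1 + int p ^ c * w) ^ \<Delta> - 1"
      using that(2) dvd_trans by blast
  qed
  have "p ^ m \<le> p ^ c * s * \<Delta>"
    if "s \<ge> 1" "\<Delta> \<ge> 1" "int p ^ m dvd int s * (int q ^ \<Delta> - 1)" for m s \<Delta>
  proof -
    define y where "y = int q ^ \<Delta> - 1"
    have "int q ^ \<Delta> > 1" using that assms(3) by (intro one_less_power) auto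
    then have y0: "y \<noteq> 0" by (simp add: y_def)
    have "m \<le> multiplicity (int p) (int s * y)"
      using that y0 p by (intro multiplicity_geI) (auto simp: y_def not_prime_unit)
    also have "\<dots> = multiplicity (int p) (int s) + multiplicity (int p) y"
      using that y0 p by (intro prime_elem_multiplicity_mult_distrib) auto
    finally have "p ^ m \<le> p ^ multiplicity (int p) (int s) * p ^ multiplicity (int p) y"
      using p(2) by (simp flip: power_add)
    also have "p ^ multiplicity (int p) (int s) \<le> s"
    proof -
      have "int p ^ multiplicity (int p) (int s) \<le> int s"
        using that(1) by (intro zdvd_imp_le multiplicity_dvd) auto
      then show ?thesis by (metis of_nat_le_iff of_nat_power)
    qed
    also have "p ^ multiplicity (int p) y \<le> p ^ c * \<Delta>"
      using that(2) by (intro main) (simp_all add: multiplicity_dvd flip: y_def)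
    finally show ?thesis by (simp add: ac_simps)
  qed
  then show ?thesis using p(2) by (intro exI[of _ "p ^ c"]) auto
qed

section \<open>Counting near powers by separation of exponents\<close>

lemma card_separated_le:
  fixes J :: "nat set" and \<delta> :: real
  assumes "\<delta> > 0" "J \<subseteq> {1..L}" "\<And>j j'. j \<in> J \<Longrightarrow> j' \<in> J \<Longrightarrow> j < j' \<Longrightarrow> \<delta> \<le> real (j' - j)"
  shows "real (card J) \<le> 1 + real L / \<delta>"
proof -
  define g where "g j = nat \<lfloor>real j / \<delta>\<rfloor>" for j :: nat
  have lt: "g j < g j'" if "j \<in> J" "j' \<in> J" "j < j'" for j j'
  proof -
    have "\<delta> \<le> real j' - real j" using assms(3)[OF that] that by (simp add: of_nat_diff)
    then have "(real j + \<delta>) / \<delta> \<le> real j' / \<delta>" using assms(1) by (intro divide_right_mono) auto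
    then have "real j / \<delta> + 1 \<le> real j' / \<delta>" using assms(1) by (simp add: add_divide_distrib)
    moreover have "real j / \<delta> \<ge> 0" using assms(1) by simp
    ultimately show ?thesis unfolding g_def by linarith
  qed
  then have "inj_on g J" by (intro inj_onI) (metis linorder_neqE_nat order_less_irrefl)
  moreover have "g ` J \<subseteq> {..nat \<lfloor>real L / \<delta>\<rfloor>}"
    using assms(1,2) by (auto simp: g_def intro!: nat_mono floor_mono divide_right_mono)
  ultimately have "card J \<le> card {..nat \<lfloor>real L / \<delta>\<rfloor>}"
    by (rule card_inj_on_le) simp
  also have "\<dots> = Suc (nat \<lfloor>real L / \<delta>\<rfloor>)" by simp
  finally have "real (card J) \<le> 1 + real (nat \<lfloor>real L / \<delta>\<rfloor>)" by simp
  moreover have "real (nat \<lfloor>real L / \<delta>\<rfloor>) \<le> real L / \<delta>" using assms(1) by simp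
  ultimately show ?thesis by linarith
qed

text \<open>For a fixed pair \<open>(s, \<rho>)\<close> two solutions differ by a
  \<open>\<Delta>\<close> with \<open>s * (q ^ \<Delta> - 1)\<close> divisible by
  \<open>p ^ m\<close>, so solutions are at least \<open>p ^ m / (K * R)\<close> apart. There are
  \<open>R * (4 * R + 1)\<close> pairs, at most \<open>5 * R\<^sup>2\<close>.\<close>

lemma card_near_powers_le:
  fixes p q K :: nat
  assumes "prime p" "coprime p q" "K \<ge> 1"
    and K: "\<And>m s \<Delta>. s \<ge> 1 \<Longrightarrow> \<Delta> \<ge> 1 \<Longrightarrow> int p ^ m dvd int s * (int q ^ \<Delta> - 1) \<Longrightarrow> p ^ m \<le> K * s * \<Delta>"
    and "R \<ge> 1"
  shows "real (card (near_powers p q m R \<inter> {1..L}))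
    \<le> 5 * (real R)\<^sup>2 * (1 + real K * real R * real L / real p ^ m)"
proof -
  define J where "J = (\<lambda>(s, \<rho>). {j \<in> {1..L}. int p ^ m dvd int s * int q ^ j - \<rho>})"
  define I where "I = {1..R} \<times> {- 2 * int R .. 2 * int R}"
  define \<delta> where "\<delta> = real p ^ m / (real K * real R)"
  have p0: "p > 0" using assms(1) by (rule prime_gt_0_nat)
  have \<delta>: "\<delta> > 0" using p0 assms(3,5) by (simp add: \<delta>_def)
  have J: "real (card (J i)) \<le> 1 + real L / \<delta>" if "i \<in> I" for i
  proof (rule card_separated_le[OF \<delta>])
    obtain s \<rho> where i: "i = (s, \<rho>)" by (cases i)
    have s: "1 \<le> s" "s \<le> R" using that by (auto simp: i I_def)
    show "J i \<subseteq> {1..L}" by (auto simp: J_def i)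
    fix j j' assume j: "j \<in> J i" "j' \<in> J i" "j < j'"
    have "int p ^ m dvd (int s * int q ^ j' - \<rho>) - (int s * int q ^ j - \<rho>)"
      by (rule dvd_diff) (use j in \<open>auto simp: J_def i\<close>)
    also have "\<dots> = int q ^ j * (int s * (int q ^ (j' - j) - 1))"
      using j(3) by (simp add: algebra_simps flip: power_add)
    finally have "int p ^ m dvd int s * (int q ^ (j' - j) - 1)"
      using assms(2) by (subst (asm) coprime_dvd_mult_right_iff) auto
    then have "p ^ m \<le> K * s * (j' - j)" using s j(3) by (intro K) auto
    also have "\<dots> \<le> K * R * (j' - j)" using s by simp
    finally have "real (p ^ m) \<le> real (K * R * (j' - j))" by (rule of_nat_mono)
    then show "\<delta> \<le> real (j' - j)"
      using assms(3,5) by (simp add: \<delta>_def divide_le_eq mult.commute)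
  qed
  have "near_powers p q m R \<inter> {1..L} \<subseteq> (\<Union>i\<in>I. J i)"
  proof
    fix j assume "j \<in> near_powers p q m R \<inter> {1..L}"
    then obtain s \<rho> where "1 \<le> s" "s \<le> R" "\<bar>\<rho>\<bar> \<le> 2 * int R" "int p ^ m dvd int s * int q ^ j - \<rho>"
      and "j \<in> {1..L}" by (auto simp: near_powers_def)
    then have "(s, \<rho>) \<in> I" "j \<in> J (s, \<rho>)" by (auto simp: I_def J_def)
    then show "j \<in> (\<Union>i\<in>I. J i)" by blast
  qed
  moreover have "finite (\<Union>i\<in>I. J i)" by (auto simp: I_def J_def)
  ultimately have "card (near_powers p q m R \<inter> {1..L}) \<le> card (\<Union>i\<in>I. J i)" by (rule card_mono[rotated])
  also have "\<dots> \<le> (\<Sum>i\<in>I. card (J i))" by (rule card_UN_le) (simp add: I_def)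
  finally have "real (card (near_powers p q m R \<inter> {1..L})) \<le> (\<Sum>i\<in>I. real (card (J i)))"
    by (metis of_nat_le_iff of_nat_sum)
  also have "\<dots> \<le> (\<Sum>i\<in>I. 1 + real L / \<delta>)" using J by (rule sum_mono)
  also have "\<dots> = real R * (4 * real R + 1) * (1 + real L / \<delta>)"
    using assms(5) by (simp add: I_def card_cartesian_product algebra_simps)
  also have "\<dots> \<le> (5 * (real R)\<^sup>2) * (1 + real L / \<delta>)"
    using assms(5) \<delta> by (intro mult_right_mono) (auto simp: power2_eq_square algebra_simps)
  also have "real L / \<delta> = real K * real R * real L / real p ^ m"
    by (simp add: \<delta>_def)
  finally show ?thesis .
qed

text \<open>Induction on \<open>d\<close> by slicing. A coordinate on which two points differ takes
  at most \<open>2 * B + 1\<close> values, so some slice is large enough for the induction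
  hypothesis, and a point outside that slice is affinely independent of it. Affine independence
  suits this because a slice need not contain the origin; the price is that coefficient vectors must
  have sum zero. The bound is free of the number of coordinates, which in the application are the
  primes.\<close>

lemma exists_affinely_independent:
  fixes f :: "'a \<Rightarrow> 'c \<Rightarrow> int"
  assumes "finite F" "\<And>x c. x \<in> F \<Longrightarrow> \<bar>f x c\<bar> \<le> int B"
    and "\<And>x y. x \<in> F \<Longrightarrow> y \<in> F \<Longrightarrow> x \<noteq> y \<Longrightarrow> \<exists>c. f x c \<noteq> f y c"
    and "card F > (2 * B + 1) ^ d"
  shows "\<exists>G\<subseteq>F. card G = d + 2 \<and>
    (\<forall>e::'a \<Rightarrow> int. (\<Sum>x\<in>G. e x) = 0 \<longrightarrow> (\<forall>c. (\<Sum>x\<in>G. e x * f x c) = 0) \<longrightarrow> (\<forall>x\<in>G. e x = 0))"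
  using assms
proof (induction d arbitrary: F)
  case 0
  then have "card F > 1" by simp
  then obtain x y where xy: "x \<in> F" "y \<in> F" "x \<noteq> y"
    by (metis card_le_Suc0_iff_eq 0(1) One_nat_def not_less)
  obtain c where c: "f x c \<noteq> f y c" using 0(3)[OF xy] by blast
  show ?case
  proof (intro exI[of _ "{x, y}"] conjI allI impI)
    fix e :: "'a \<Rightarrow> int"
    assume e: "(\<Sum>x\<in>{x, y}. e x) = 0" "\<forall>c. (\<Sum>x\<in>{x, y}. e x * f x c) = 0"
    have "e y = - e x" using e(1) xy(3) by simp
    moreover have "e x * f x c + e y * f y c = 0" using e(2)[rule_format, of c] xy(3) by simp
    ultimately have "e x * (f x c - f y c) = 0" by (simp add: algebra_simps)
    then show "\<forall>x\<in>{x, y}. e x = 0" using c \<open>e y = - e x\<close> by simp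
  qed (use xy in auto)
next
  case (Suc d)
  have "(1::nat) \<le> (2 * B + 1) ^ Suc d" by (rule one_le_power) simp
  then have "card F > 1" using Suc.prems(4) by simp
  then obtain x y where xy: "x \<in> F" "y \<in> F" "x \<noteq> y"
    by (metis card_le_Suc0_iff_eq Suc.prems(1) One_nat_def not_less)
  obtain c where c: "f x c \<noteq> f y c" using Suc.prems(3)[OF xy] by blast
  define fib where "fib \<beta> = {z \<in> F. f z c = \<beta>}" for \<beta>
  have "\<exists>\<beta>. card (fib \<beta>) > (2 * B + 1) ^ d"
  proof (rule ccontr)
    assume "\<not> ?thesis"
    then have small: "card (fib \<beta>) \<le> (2 * B + 1) ^ d" for \<beta> by (meson not_less)
    have "F = (\<Union>\<beta>\<in>{- int B..int B}. fib \<beta>)"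
    proof (intro equalityI subsetI)
      fix z assume "z \<in> F"
      then have "f z c \<in> {- int B..int B}" "z \<in> fib (f z c)"
        using Suc.prems(2)[of z c] by (auto simp: fib_def)
      then show "z \<in> (\<Union>\<beta>\<in>{- int B..int B}. fib \<beta>)" by blast
    qed (auto simp: fib_def)
    then have "card F \<le> (\<Sum>\<beta>\<in>{- int B..int B}. card (fib \<beta>))"
      by (metis card_UN_le finite_atLeastAtMost_int)
    also have "\<dots> \<le> (\<Sum>\<beta>\<in>{- int B..int B}. (2 * B + 1) ^ d)"
      using small by (intro sum_mono)
    also have "\<dots> = (2 * B + 1) ^ Suc d" by (simp add: nat_add_distrib nat_mult_distrib)
    finally show False using Suc.prems(4) by simp
  qed
  then obtain \<beta> where \<beta>: "card (fib \<beta>) > (2 * B + 1) ^ d" by blast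
  have fib: "fib \<beta> \<subseteq> F" "finite (fib \<beta>)" using Suc.prems(1) by (auto simp: fib_def)
  have "\<exists>G\<subseteq>fib \<beta>. card G = d + 2 \<and>
    (\<forall>e::'a \<Rightarrow> int. (\<Sum>x\<in>G. e x) = 0 \<longrightarrow> (\<forall>c. (\<Sum>x\<in>G. e x * f x c) = 0) \<longrightarrow> (\<forall>x\<in>G. e x = 0))"
    using fib Suc.prems(2,3) \<beta> by (intro Suc.IH) blast+
  then obtain G where G: "G \<subseteq> fib \<beta>" "card G = d + 2"
    and ind: "\<And>e::'a \<Rightarrow> int. (\<Sum>x\<in>G. e x) = 0 \<Longrightarrow> (\<And>c. (\<Sum>x\<in>G. e x * f x c) = 0) \<Longrightarrow> (\<forall>x\<in>G. e x = 0)"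
    by blast
  obtain x0 where x0: "x0 \<in> F" "f x0 c \<noteq> \<beta>" using xy c by metis
  have finG: "finite G" using G(1) fib(2) finite_subset by blast
  have x0G: "x0 \<notin> G" using x0 G(1) by (auto simp: fib_def)
  show ?case
  proof (intro exI[of _ "insert x0 G"] conjI allI impI)
    show "insert x0 G \<subseteq> F" using x0 G fib by blast
    show "card (insert x0 G) = Suc d + 2" using x0G finG G(2) by simp
    fix e :: "'a \<Rightarrow> int"
    assume e: "(\<Sum>x\<in>insert x0 G. e x) = 0" "\<forall>c. (\<Sum>x\<in>insert x0 G. e x * f x c) = 0"
    have s1: "e x0 + (\<Sum>x\<in>G. e x) = 0" using e(1) x0G finG by simp
    have s2: "e x0 * f x0 c + (\<Sum>x\<in>G. e x * f x c) = 0" for c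
      using e(2)[rule_format, of c] x0G finG by simp
    have "(\<Sum>x\<in>G. e x * f x c) = (\<Sum>x\<in>G. e x * \<beta>)"
      using G(1) by (intro sum.cong) (auto simp: fib_def)
    also have "\<dots> = (\<Sum>x\<in>G. e x) * \<beta>" by (simp add: sum_distrib_right)
    also have "(\<Sum>x\<in>G. e x) = - e x0" using s1 by simp
    finally have "e x0 * (f x0 c - \<beta>) = 0" using s2[of c] by (simp add: algebra_simps)
    then have e0: "e x0 = 0" using x0(2) by simp
    then have "\<forall>x\<in>G. e x = 0" using s1 s2 by (intro ind) auto
    then show "\<forall>x\<in>insert x0 G. e x = 0" using e0 by simp
  qed
qed

lemma multiplicity_prod_power:
  fixes s e :: "'a \<Rightarrow> nat" and l :: nat
  assumes "prime l" "finite G" "\<And>x. x \<in> G \<Longrightarrow> s x \<noteq> 0"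
  shows "multiplicity l (\<Prod>x\<in>G. s x ^ e x) = (\<Sum>x\<in>G. e x * multiplicity l (s x))"
  using assms(2,3)
proof (induction G rule: finite_induct)
  case (insert x G)
  then have "(\<Prod>x\<in>G. s x ^ e x) \<noteq> 0" by simp
  then show ?case
    using insert assms(1)
    by (simp add: prime_elem_multiplicity_mult_distrib prime_elem_multiplicity_power_distrib)
qed simp

lemma multiplicity_le_of_less_power:
  fixes l s B :: nat
  assumes "prime l" "0 < s" "s < 2 ^ Suc B"
  shows "multiplicity l s \<le> B"
proof -
  have "2 ^ multiplicity l s \<le> l ^ multiplicity l s"
    using prime_ge_2_nat[OF assms(1)] by (intro power_mono) auto
  also have "\<dots> \<le> s" using assms(2) by (intro dvd_imp_le multiplicity_dvd)
  also have "\<dots> < 2 ^ Suc B" by (rule assms)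
  finally have "multiplicity l s < Suc B" by (simp only: power_strict_increasing_iff)
  then show ?thesis by simp
qed


text \<open>This replaces a lower bound for \<open>p\<close>-adic linear forms in logarithms. Congruences
  \<open>s q\<^sup>j \<equiv> \<rho> (mod p\<^sup>m)\<close> are squared to remove signs. Among \<open>d + 2\<close> multiplicatively independent
  ratios \<open>s / \<rho>\<close>, two products with different exponents have the same power of \<open>q\<close> on the other side,
  so they agree modulo \<open>p\<^sup>m\<close> and, having small height, are equal.\<close>

lemma card_near_powers_le_polylog:
  fixes p q K :: nat
  assumes "prime p" "coprime p q" "K \<ge> 1"
    and K: "\<And>m s \<Delta>. s \<ge> 1 \<Longrightarrow> \<Delta> \<ge> 1 \<Longrightarrow> int p ^ m dvd int s * (int q ^ \<Delta> - 1) \<Longrightarrow> p ^ m \<le> K * s * \<Delta>"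
    and "R \<ge> 1" "2 * R < 2 ^ Suc B"
    and m1: "8 * K * R ^ 4 * L < p ^ m"
    and m2: "(2 * R) ^ (4 * (d + 2) * E) < p ^ m"
    and E: "((d + 2) * E + 1) * ((d + 2) * E * L + 1) < (E + 1) ^ (d + 2)"
  shows "card (near_powers p q m R \<inter> {1..L}) \<le> (2 * B + 1) ^ d"
proof (rule ccontr)
  define F where "F = near_powers p q m R \<inter> {1..L}"
  assume "\<not> card (near_powers p q m R \<inter> {1..L}) \<le> (2 * B + 1) ^ d"
  then have big: "card F > (2 * B + 1) ^ d" by (simp add: F_def)
  have finF: "finite F" by (simp add: F_def)
  have FL: "1 \<le> j" "j \<le> L" if "j \<in> F" for j using that by (auto simp: F_def)
  have cop: "coprime (p ^ m) (q ^ j)" for j using assms(2) by simp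
  have "\<exists>s r. 1 \<le> s \<and> s \<le> R \<and> 1 \<le> r \<and> r \<le> 2 * R \<and> [s\<^sup>2 * q ^ (2 * j) = r\<^sup>2] (mod p ^ m)"
    if "j \<in> F" for j
  proof -
    obtain s \<rho> where s: "1 \<le> s" "s \<le> R" "\<bar>\<rho>\<bar> \<le> 2 * int R" "int p ^ m dvd int s * int q ^ j - \<rho>"
      using \<open>j \<in> F\<close> by (auto simp: F_def near_powers_def)
    define r where "r = nat \<bar>\<rho>\<bar>"
    \<comment> \<open>A zero right-hand side would make \<open>p ^ m\<close> divide
      \<open>s\<close>, as \<open>q\<close> is a unit, and \<open>s\<close> is too small for
      that.\<close>
    have "\<rho> \<noteq> 0"
    proof
      assume "\<rho> = 0"
      then have "int (p ^ m) dvd int (s * q ^ j)" using s(4) by simp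
      then have "p ^ m dvd s * q ^ j" by (simp only: int_dvd_int_iff)
      then have "p ^ m dvd s" using cop by (simp add: coprime_dvd_mult_left_iff)
      then have "p ^ m \<le> s" using s(1) by (intro dvd_imp_le) auto
      also have "\<dots> \<le> 8 * K * R ^ 4 * L"
      proof -
        have "R * 1 \<le> R ^ 4 * (8 * K * L)"
          using assms(3,5) FL[OF \<open>j \<in> F\<close>] by (intro mult_mono) (auto simp: self_le_power)
        then show ?thesis using s(2) by (simp add: ac_simps)
      qed
      finally show False using m1 by simp
    qed
    then have r: "1 \<le> r" "r \<le> 2 * R" "(int r)\<^sup>2 = \<rho>\<^sup>2" using s(3) by (auto simp: r_def)
    have "(int s)\<^sup>2 * int q ^ (2 * j) - \<rho>\<^sup>2 = (int s * int q ^ j - \<rho>) * (int s * int q ^ j + \<rho>)"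
    proof -
      have "int q ^ (2 * j) = int q ^ j * int q ^ j" by (simp add: mult_2 power_add)
      then show ?thesis by (simp add: power2_eq_square algebra_simps)
    qed
    then have "int p ^ m dvd (int s)\<^sup>2 * int q ^ (2 * j) - (int r)\<^sup>2"
      using s(4) r(3) by simp
    then have "[int (s\<^sup>2 * q ^ (2 * j)) = int (r\<^sup>2)] (mod int (p ^ m))"
      by (simp add: cong_iff_dvd_diff)
    then have "[s\<^sup>2 * q ^ (2 * j) = r\<^sup>2] (mod p ^ m)" by (simp only: cong_int_iff)
    then show ?thesis using s r by blast
  qed
  then obtain s r where sr: "\<And>j. j \<in> F \<Longrightarrow> 1 \<le> s j" "\<And>j. j \<in> F \<Longrightarrow> s j \<le> R"
      "\<And>j. j \<in> F \<Longrightarrow> 1 \<le> r j" "\<And>j. j \<in> F \<Longrightarrow> r j \<le> 2 * R"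
      "\<And>j. j \<in> F \<Longrightarrow> [(s j)\<^sup>2 * q ^ (2 * j) = (r j)\<^sup>2] (mod p ^ m)"
    by metis
  \<comment> \<open>Exponent vector of the fraction \<open>s j / r j\<close>, indexed by the primes.
    Its entries are bounded by \<open>B\<close> because numerator and denominator are below
    \<open>2 ^ Suc B\<close>.\<close>
  define f :: "nat \<Rightarrow> nat \<Rightarrow> int" where
    "f j l = (if prime l then int (multiplicity l (s j)) - int (multiplicity l (r j)) else 0)" for j l
  have "\<bar>f j l\<bar> \<le> int B" if "j \<in> F" for j l
  proof (cases "prime l")
    case True
    have "s j < 2 ^ Suc B" "r j < 2 ^ Suc B" using sr[OF that] assms(6) by linarith+
    then have "multiplicity l (s j) \<le> B" "multiplicity l (r j) \<le> B"
      using sr[OF that] by (auto intro!: multiplicity_le_of_less_power[OF True])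
    then show ?thesis using True by (simp add: f_def)
  qed (simp add: f_def)
  \<comment> \<open>Equal vectors mean equal fractions. Both congruences can then be put over the
    common number \<open>X\<close>, and up to a power of \<open>q\<close> they differ by
    \<open>X\<^sup>2 * (q ^ (2 * (j - i)) - 1)\<close>; the order estimate bounds
    \<open>p ^ m\<close> by \<open>8 * K * R ^ 4 * L\<close>.\<close>
  moreover have separated: "\<exists>l. f i l \<noteq> f j l" if "i \<in> F" "j \<in> F" "i < j" for i j
  proof (rule ccontr)
    assume "\<not> ?thesis"
    then have eq: "f i l = f j l" for l by blast
    have pos: "0 < s i" "0 < s j" "0 < r i" "0 < r j" using sr that by fastforce+
    define X where "X = s i * r j"
    have "s i * r j = s j * r i"
    proof (rule multiplicity_eq_nat)
      fix l :: nat assume "prime l"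
      then show "multiplicity l (s i * r j) = multiplicity l (s j * r i)"
        using eq[of l] pos by (simp add: f_def prime_elem_multiplicity_mult_distrib)
    qed (use pos in auto)
    then have X: "X = s j * r i" by (simp add: X_def)
    have "[X\<^sup>2 * q ^ (2 * i) = (s i)\<^sup>2 * q ^ (2 * i) * (r j)\<^sup>2] (mod p ^ m)"
      by (simp add: X_def power_mult_distrib ac_simps)
    also have "[(s i)\<^sup>2 * q ^ (2 * i) * (r j)\<^sup>2 = (r i)\<^sup>2 * (r j)\<^sup>2] (mod p ^ m)"
      using sr(5)[OF that(1)] by (rule cong_scalar_right)
    also have "[(r i)\<^sup>2 * (r j)\<^sup>2 = (r i)\<^sup>2 * ((s j)\<^sup>2 * q ^ (2 * j))] (mod p ^ m)"
      using sr(5)[OF that(2)] by (intro cong_scalar_left) (rule cong_sym)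
    also have "(r i)\<^sup>2 * ((s j)\<^sup>2 * q ^ (2 * j)) = X\<^sup>2 * q ^ (2 * j)"
      by (simp add: X power_mult_distrib ac_simps)
    finally have "[int (X\<^sup>2 * q ^ (2 * j)) = int (X\<^sup>2 * q ^ (2 * i))] (mod int (p ^ m))"
      by (simp only: cong_int_iff cong_sym_eq)
    then have "int p ^ m dvd int (X\<^sup>2 * q ^ (2 * j)) - int (X\<^sup>2 * q ^ (2 * i))"
      by (simp add: cong_iff_dvd_diff)
    also have "int (X\<^sup>2 * q ^ (2 * j)) - int (X\<^sup>2 * q ^ (2 * i))
        = int q ^ (2 * i) * (int (X\<^sup>2) * (int q ^ (2 * (j - i)) - 1))"
    proof -
      have "int q ^ (2 * j) = int q ^ (2 * i) * int q ^ (2 * (j - i))"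
      proof -
        have "2 * j = 2 * i + 2 * (j - i)" using that(3) by simp
        then show ?thesis by (metis power_add)
      qed
      then show ?thesis by (simp add: algebra_simps)
    qed
    finally have "int p ^ m dvd int (X\<^sup>2) * (int q ^ (2 * (j - i)) - 1)"
      using assms(2) by (subst (asm) coprime_dvd_mult_right_iff) auto
    then have "p ^ m \<le> K * X\<^sup>2 * (2 * (j - i))"
      using that(3) pos by (intro K) (auto simp: X_def)
    also have "\<dots> \<le> K * (R * (2 * R))\<^sup>2 * (2 * L)"
      using sr[OF that(1)] sr[OF that(2)] FL[OF that(2)]
      by (intro mult_mono power_mono order.refl) (auto simp: X_def intro!: mult_mono)
    also have "\<dots> = 8 * K * R ^ 4 * L" by (simp add: power2_eq_square power4_eq_xxxx algebra_simps)
    finally show False using m1 by simp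
  qed
  then have "\<exists>l. f i l \<noteq> f j l" if "i \<in> F" "j \<in> F" "i \<noteq> j" for i j
    using that by (metis linorder_neqE_nat)
  ultimately obtain G where G: "G \<subseteq> F" "card G = d + 2"
    and ind: "\<And>e::nat \<Rightarrow> int. (\<Sum>x\<in>G. e x) = 0 \<Longrightarrow> (\<And>c. (\<Sum>x\<in>G. e x * f x c) = 0) \<Longrightarrow> (\<forall>x\<in>G. e x = 0)"
    using exists_affinely_independent[OF finF, of f B d] big by blast
  have finG: "finite G" using G(1) finF finite_subset by blast
  \<comment> \<open>Exponent tuples with entries in \<open>{0..E}\<close>. They outnumber the
    possible pairs of a plain sum and a sum weighted by the elements of \<open>G\<close>. Equality
    of the former is the sum-zero condition of affine independence, equality of the latter makes the
    powers of \<open>q\<close> agree.\<close>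
  define X where "X = G \<rightarrow>\<^sub>E {0..E}"
  define h where "h e = ((\<Sum>x\<in>G. e x), (\<Sum>x\<in>G. e x * x))" for e :: "nat \<Rightarrow> nat"
  have eE: "e x \<le> E" if "e \<in> X" "x \<in> G" for e x using that by (auto simp: X_def)
  have "h ` X \<subseteq> {0..(d + 2) * E} \<times> {0..(d + 2) * E * L}"
  proof (clarsimp simp: h_def, intro conjI)
    fix e assume e: "e \<in> X"
    have "(\<Sum>x\<in>G. e x) \<le> (\<Sum>x\<in>G. E)" using eE[OF e] by (rule sum_mono)
    then show "(\<Sum>x\<in>G. e x) \<le> E + (E + d * E)" using G(2) by simp
    have "(\<Sum>x\<in>G. e x * x) \<le> (\<Sum>x\<in>G. E * L)"
      using eE[OF e] FL G(1) by (intro sum_mono mult_mono) auto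
    then show "(\<Sum>x\<in>G. e x * x) \<le> (E + (E + d * E)) * L" using G(2) by (simp add: algebra_simps)
  qed
  then have "card (h ` X) \<le> card ({0..(d + 2) * E} \<times> {0..(d + 2) * E * L})"
    by (intro card_mono) auto
  also have "\<dots> = ((d + 2) * E + 1) * ((d + 2) * E * L + 1)" by (simp add: card_cartesian_product)
  also have "\<dots> < (E + 1) ^ (d + 2)" by (rule E)
  also have "\<dots> = card X" using finG G(2) by (simp add: X_def card_PiE)
  finally have "\<not> inj_on h X" by (rule pigeonhole)
  then obtain e e' where ee: "e \<in> X" "e' \<in> X" "e \<noteq> e'" and heq: "h e = h e'"
    by (auto simp: inj_on_def)
  have sume: "(\<Sum>x\<in>G. e x) = (\<Sum>x\<in>G. e' x)" "(\<Sum>x\<in>G. e x * x) = (\<Sum>x\<in>G. e' x * x)"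
    using heq by (auto simp: h_def)
  define A where "A e = (\<Prod>x\<in>G. ((s x)\<^sup>2) ^ e x)" for e :: "nat \<Rightarrow> nat"
  define C where "C e = (\<Prod>x\<in>G. ((r x)\<^sup>2) ^ e x)" for e :: "nat \<Rightarrow> nat"
  define J where "J = (\<Sum>x\<in>G. e x * x)"
  have cong: "[A e * q ^ (2 * (\<Sum>x\<in>G. e x * x)) = C e] (mod p ^ m)" for e
  proof -
    have "A e * q ^ (2 * (\<Sum>x\<in>G. e x * x)) = (\<Prod>x\<in>G. ((s x)\<^sup>2 * q ^ (2 * x)) ^ e x)"
      by (simp add: A_def power_mult_distrib prod.distrib sum_distrib_left power_sum ac_simps
          flip: power_mult)
    moreover have "[(\<Prod>x\<in>G. ((s x)\<^sup>2 * q ^ (2 * x)) ^ e x) = C e] (mod p ^ m)"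
      unfolding C_def using sr(5) G(1) by (intro cong_prod cong_pow) auto
    ultimately show ?thesis by simp
  qed
  have A1: "[A e * q ^ (2 * J) = C e] (mod p ^ m)" using cong[of e] by (simp add: J_def)
  have A2: "[A e' * q ^ (2 * J) = C e'] (mod p ^ m)" using cong[of e'] by (simp add: J_def sume)
  \<comment> \<open>Cross multiplication: the relation for \<open>e'\<close> times
    \<open>A e\<close> and the one for \<open>e\<close> times \<open>A e'\<close> meet in the common
    power \<open>q ^ (2 * J)\<close>, so no division modulo \<open>p ^ m\<close> occurs.\<close>
  have "[A e * C e' = A e * (A e' * q ^ (2 * J))] (mod p ^ m)"
    using A2 by (intro cong_scalar_left) (rule cong_sym)
  also have "A e * (A e' * q ^ (2 * J)) = A e' * (A e * q ^ (2 * J))" by (simp add: ac_simps)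
  also have "[A e' * (A e * q ^ (2 * J)) = A e' * C e] (mod p ^ m)"
    using A1 by (rule cong_scalar_left)
  finally have congAC: "[A e * C e' = A e' * C e] (mod p ^ m)" .
  \<comment> \<open>Each side of the congruence is a product of two such products, hence at most
    \<open>(2 * R) ^ (4 * (d + 2) * E)\<close>. This is below the modulus, so the congruence becomes
    an equality.\<close>
  have bound: "(\<Prod>x\<in>G. ((t x)\<^sup>2) ^ e x) \<le> (2 * R) ^ (2 * (d + 2) * E)"
    if "e \<in> X" "\<And>x. x \<in> G \<Longrightarrow> t x \<le> 2 * R" for t e :: "nat \<Rightarrow> nat"
  proof -
    have "(\<Prod>x\<in>G. ((t x)\<^sup>2) ^ e x) \<le> (\<Prod>x\<in>G. (2 * R) ^ (2 * E))"
    proof (rule prod_mono, rule conjI)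
      fix x assume "x \<in> G"
      have "((t x)\<^sup>2) ^ e x = t x ^ (2 * e x)" by (simp add: power_mult)
      also have "\<dots> \<le> (2 * R) ^ (2 * e x)" using that(2)[OF \<open>x \<in> G\<close>] by (rule power_mono) simp
      also have "\<dots> \<le> (2 * R) ^ (2 * E)"
        using assms(5) eE[OF that(1) \<open>x \<in> G\<close>] by (intro power_increasing) auto
      finally show "((t x)\<^sup>2) ^ e x \<le> (2 * R) ^ (2 * E)" .
    qed simp
    also have "\<dots> = ((2 * R) ^ (2 * E)) ^ (d + 2)" using G(2) by simp
    also have "\<dots> = (2 * R) ^ (2 * (d + 2) * E)" by (simp only: ac_simps flip: power_mult)
    finally show ?thesis .
  qed
  have s2R: "s x \<le> 2 * R" "r x \<le> 2 * R" if "x \<in> G" for x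
    using sr(2,4)[of x] G(1) that by auto
  have ACbound: "A e * C e' < p ^ m" if "e \<in> X" "e' \<in> X" for e e'
  proof -
    have "A e * C e' \<le> (2 * R) ^ (2 * (d + 2) * E) * (2 * R) ^ (2 * (d + 2) * E)"
      unfolding A_def C_def using that s2R by (intro mult_mono bound) auto
    also have "\<dots> = (2 * R) ^ (4 * (d + 2) * E)"
      by (simp add: algebra_simps flip: power_add)
    finally show ?thesis using m2 by simp
  qed
  have AC: "A e * C e' = A e' * C e"
    using congAC ACbound[OF ee(1,2)] ACbound[OF ee(2,1)] by (rule cong_less_modulus_unique_nat)
  \<comment> \<open>Comparing prime exponents in the equality gives a relation among the vectors
    with coefficients \<open>\<epsilon>\<close> of sum zero; affine independence makes them vanish
    although \<open>e\<close> and \<open>e'\<close> differ.\<close>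
  define \<epsilon> where "\<epsilon> x = int (e x) - int (e' x)" for x
  have "\<forall>x\<in>G. \<epsilon> x = 0"
  proof (rule ind)
    show "(\<Sum>x\<in>G. \<epsilon> x) = 0" using sume(1) by (simp add: \<epsilon>_def sum_subtractf flip: of_nat_sum)
    fix l
    show "(\<Sum>x\<in>G. \<epsilon> x * f x l) = 0"
    proof (cases "prime l")
      case True
      have s0: "s x \<noteq> 0" "r x \<noteq> 0" if "x \<in> G" for x using sr that G(1) by fastforce+
      have mult: "multiplicity l (\<Prod>x\<in>G. ((t x)\<^sup>2) ^ e x) = 2 * (\<Sum>x\<in>G. e x * multiplicity l (t x))"
        if "\<And>x. x \<in> G \<Longrightarrow> t x \<noteq> 0" for t e :: "nat \<Rightarrow> nat"
        using multiplicity_prod_power[OF True finG, of "\<lambda>x. (t x)\<^sup>2" e] that True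
        by (simp add: sum_distrib_left prime_elem_multiplicity_power_distrib ac_simps)
      have nz: "A e \<noteq> 0" "C e \<noteq> 0" for e using s0 finG by (auto simp: A_def C_def)
      have "multiplicity l (A e * C e') = multiplicity l (A e' * C e)" by (simp add: AC)
      then have "multiplicity l (A e) + multiplicity l (C e') = multiplicity l (A e') + multiplicity l (C e)"
        using True nz by (simp add: prime_elem_multiplicity_mult_distrib)
      then have "(\<Sum>x\<in>G. e x * multiplicity l (s x)) + (\<Sum>x\<in>G. e' x * multiplicity l (r x))
          = (\<Sum>x\<in>G. e' x * multiplicity l (s x)) + (\<Sum>x\<in>G. e x * multiplicity l (r x))"
        unfolding A_def C_def using s0 by (simp add: mult)
      then have "(\<Sum>x\<in>G. int (e x) * int (multiplicity l (s x))) + (\<Sum>x\<in>G. int (e' x) * int (multiplicity l (r x)))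
          = (\<Sum>x\<in>G. int (e' x) * int (multiplicity l (s x))) + (\<Sum>x\<in>G. int (e x) * int (multiplicity l (r x)))"
        by (simp flip: of_nat_mult of_nat_sum of_nat_add)
      then show ?thesis
        using True by (simp add: f_def \<epsilon>_def algebra_simps sum.distrib sum_subtractf)
    qed (simp add: f_def)
  qed
  then have "e x = e' x" if "x \<in> G" for x using that by (simp add: \<epsilon>_def)
  then have "e = e'" using ee by (intro PiE_ext[of e G "\<lambda>_. {0..E}" e']) (auto simp: X_def)
  then show False using ee(3) by simp
qed

section \<open>Summing the rotation bounds\<close>

text \<open>One scale only: near powers count 1 each, every other exponent contributes at most
  \<open>sqrt (6 / 2 ^ k)\<close>, and \<open>sqrt 6 \<le> 3\<close>.\<close>

lemma sum_sqrt_rotation_bound_le_card: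
  assumes "4 ^ k \<le> p ^ m"
  shows "(\<Sum>j=1..L. sqrt (rotation_bound p q m j))
    \<le> real (card (near_powers p q m (2 ^ k) \<inter> {1..L})) + 3 * real L * sqrt (1 / 2) ^ k"
proof -
  have "sqrt (rotation_bound p q m j) \<le> of_bool (j \<in> near_powers p q m (2 ^ k)) + 3 * sqrt (1 / 2) ^ k" for j
  proof (cases "j \<in> near_powers p q m (2 ^ k)")
    case True
    then show ?thesis using rotation_bound_le_1[of p q m j] by (simp add: add_increasing2)
  next
    case False
    have "sqrt (rotation_bound p q m j) \<le> sqrt (6 / 2 ^ k)"
      using rotation_bound_le[OF assms False] by simp
    also have "\<dots> = sqrt 6 * sqrt (1 / 2) ^ k"
      by (simp add: real_sqrt_divide real_sqrt_power power_divide)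
    also have "\<dots> \<le> 3 * sqrt (1 / 2) ^ k"
      by (intro mult_right_mono real_le_lsqrt) auto
    finally show ?thesis using False by simp
  qed
  then have "(\<Sum>j=1..L. sqrt (rotation_bound p q m j))
      \<le> (\<Sum>j=1..L. of_bool (j \<in> near_powers p q m (2 ^ k)) + 3 * sqrt (1 / 2) ^ k)"
    by (rule sum_mono)
  also have "\<dots> = real (card (near_powers p q m (2 ^ k) \<inter> {1..L})) + 3 * real L * sqrt (1 / 2) ^ k"
    by (simp add: sum.distrib Int_commute)
  finally show ?thesis .
qed

lemma sqrt_half_power_even: "sqrt (1 / 2) ^ (2 * k) = 1 / 2 ^ k"
  by (simp add: power_mult power_divide)

text \<open>With \<open>R = 2 ^ k\<close> the separation count is at most
  \<open>5 * R\<^sup>2 + 5 * K * R ^ 3 * L / p ^ m\<close>. The two conditions give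
  \<open>R ^ 8 \<le> p ^ m\<close> and \<open>R ^ 4 \<le> L\<close>, which make either part at most
  \<open>5 * K * L / R\<close>, no worse in order than the \<open>L / sqrt R\<close> from the
  remaining exponents.\<close>

lemma sum_sqrt_rotation_bound_small:
  fixes p q K :: nat
  assumes "prime p" "coprime p q" "K \<ge> 1"
    and K: "\<And>m s \<Delta>. s \<ge> 1 \<Longrightarrow> \<Delta> \<ge> 1 \<Longrightarrow> int p ^ m dvd int s * (int q ^ \<Delta> - 1) \<Longrightarrow> p ^ m \<le> K * s * \<Delta>"
    and "8 * k \<le> m" "16 ^ k \<le> L"
  shows "(\<Sum>j=1..L. sqrt (rotation_bound p q m j)) \<le> (10 * real K + 3) * real L * sqrt (1 / 2) ^ k"
proof -
  define R where "R = (2::real) ^ k"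
  have R: "R \<ge> 1" by (simp add: R_def)
  have p2: "p \<ge> 2" using assms(1) by (rule prime_ge_2_nat)
  have "(2::real) ^ (8 * k) \<le> 2 ^ m" using assms(5) by (intro power_increasing) auto
  also have "\<dots> \<le> real p ^ m" using p2 by (intro power_mono) auto
  finally have pm: "R ^ 8 \<le> real p ^ m" by (simp add: R_def mult.commute flip: power_mult)
  have "(16::real) ^ k \<le> real L"
    by (metis assms(6) of_nat_le_iff of_nat_numeral of_nat_power)
  also have "(16::real) ^ k = R ^ 4"
  proof -
    have "(16::real) ^ k = (2 ^ 4) ^ k" by simp
    also have "\<dots> = R ^ 4" by (simp only: R_def mult.commute flip: power_mult)
    finally show ?thesis .
  qed
  finally have L: "R ^ 4 \<le> real L" .
  have "(4::nat) ^ k \<le> p ^ m"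
  proof -
    have "(4::nat) ^ k = 2 ^ (2 * k)" by (simp add: power_mult)
    also have "\<dots> \<le> 2 ^ m" using assms(5) by (intro power_increasing) auto
    also have "\<dots> \<le> p ^ m" using p2 by (intro power_mono) auto
    finally show ?thesis .
  qed
  then have "(\<Sum>j=1..L. sqrt (rotation_bound p q m j))
      \<le> real (card (near_powers p q m (2 ^ k) \<inter> {1..L})) + 3 * real L * sqrt (1 / 2) ^ k"
    by (rule sum_sqrt_rotation_bound_le_card)
  also have "real (card (near_powers p q m (2 ^ k) \<inter> {1..L}))
      \<le> 5 * R\<^sup>2 * (1 + real K * R * real L / real p ^ m)"
    using card_near_powers_le[OF assms(1-3) K, of "2 ^ k" m L] by (simp add: R_def)
  also have "\<dots> \<le> 5 * R\<^sup>2 * (1 + real K * R * real L / R ^ 8)"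
    using pm R p2 by (intro mult_left_mono add_left_mono divide_left_mono mult_pos_pos) auto
  also have "\<dots> = 5 * R\<^sup>2 + 5 * real K * real L / R ^ 5"
    using R by (simp add: field_simps flip: power_Suc power_add)
  also have "5 * R\<^sup>2 \<le> 5 * real K * real L / R"
  proof -
    have "R\<^sup>2 * R \<le> R ^ 4" using R by (simp add: power_increasing flip: power_Suc2)
    also have "\<dots> \<le> real K * real L" using L assms(3) mult_right_mono[of 1 "real K" "real L"] by simp
    finally show ?thesis using R by (simp add: field_simps)
  qed
  also have "5 * real K * real L / R ^ 5 \<le> 5 * real K * real L / R"
    using R self_le_power[of R 5] by (intro divide_left_mono) auto
  also have "5 * real K * real L / R + 5 * real K * real L / R = 10 * real K * real L * (1 / R)" by simp
  also have "\<dots> \<le> 10 * real K * real L * sqrt (1 / 2) ^ k"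
  proof (rule mult_left_mono)
    have "sqrt (1 / 2) ^ (2 * k) \<le> sqrt (1 / 2) ^ k"
      by (rule power_decreasing) auto
    then show "1 / R \<le> sqrt (1 / 2) ^ k" by (simp add: sqrt_half_power_even R_def)
  qed simp
  finally show ?thesis by (simp add: algebra_simps)
qed

text \<open>Each \<open>j\<close> is charged to the least scale \<open>k\<close> at which it is a
  near power. At scale \<open>k - 1\<close> it is not, so with \<open>x = sqrt (1 / 2)\<close> it
  contributes at most \<open>3 * x ^ (k - 1) \<le> 6 * x ^ k\<close>. Unlike the one-scale bound,
  this lets counts polynomial in \<open>k\<close> be summed to a constant.\<close>

lemma sum_sqrt_rotation_bound_dyadic:
  assumes "4 ^ n \<le> p ^ m" and "\<And>k. k \<le> n \<Longrightarrow> real (card (near_powers p q m (2 ^ k) \<inter> {1..L})) \<le> a k"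
  shows "(\<Sum>j=1..L. sqrt (rotation_bound p q m j))
    \<le> (\<Sum>k\<le>n. 6 * a k * sqrt (1 / 2) ^ k) + 3 * real L * sqrt (1 / 2) ^ n"
proof -
  define x where "x = sqrt (1 / 2)"
  have x: "0 \<le> x" "1 \<le> 2 * x"
  proof -
    have "1 / 2 \<le> x" unfolding x_def by (rule real_le_rsqrt) (simp add: power2_eq_square)
    then show "1 \<le> 2 * x" "0 \<le> x" by auto
  qed
  have le: "sqrt (rotation_bound p q m j) \<le> 3 * x ^ k"
    if "k \<le> n" "j \<notin> near_powers p q m (2 ^ k)" for j k
  proof -
    have "(4::nat) ^ k \<le> 4 ^ n" using that by (intro power_increasing) auto
    then have "4 ^ k \<le> p ^ m" using assms(1) by (rule order.trans)
    then have "sqrt (rotation_bound p q m j) \<le> sqrt (6 / 2 ^ k)"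
      using rotation_bound_le[of k p m j q] that(2) by simp
    also have "\<dots> = sqrt 6 * x ^ k"
      by (simp add: x_def real_sqrt_divide real_sqrt_power power_divide)
    also have "\<dots> \<le> 3 * x ^ k"
      using x by (intro mult_right_mono real_le_lsqrt) auto
    finally show ?thesis .
  qed
  have point: "sqrt (rotation_bound p q m j)
      \<le> (\<Sum>k\<le>n. 6 * x ^ k * of_bool (j \<in> near_powers p q m (2 ^ k))) + 3 * x ^ n" for j
  proof (cases "j \<in> near_powers p q m (2 ^ n)")
    case False
    then have "sqrt (rotation_bound p q m j) \<le> 3 * x ^ n" by (rule le[rotated]) simp
    then show ?thesis using x by (intro add_increasing sum_nonneg) auto
  next
    case True
    define k where "k = (LEAST k. j \<in> near_powers p q m (2 ^ k))"
    have k: "j \<in> near_powers p q m (2 ^ k)" unfolding k_def using True by (rule LeastI)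
    have kn: "k \<le> n" unfolding k_def using True by (rule Least_le)
    have "sqrt (rotation_bound p q m j) \<le> 6 * x ^ k"
    proof (cases k)
      case 0
      have "sqrt (rotation_bound p q m j) \<le> 1" using rotation_bound_le_1[of p q m j] by simp
      then show ?thesis unfolding 0 power_0 by linarith
    next
      case (Suc i)
      have "j \<notin> near_powers p q m (2 ^ i)" using Suc k_def by (metis lessI not_less_Least)
      then have "sqrt (rotation_bound p q m j) \<le> 3 * x ^ i" using Suc kn by (intro le) auto
      also have "\<dots> \<le> (3 * x ^ i) * (2 * x)"
        using x mult_left_mono[of 1 "2 * x" "3 * x ^ i"] by simp
      finally show ?thesis using Suc by (simp add: ac_simps)
    qed
    also have "\<dots> \<le> (\<Sum>k\<le>n. 6 * x ^ k * of_bool (j \<in> near_powers p q m (2 ^ k)))"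
      using member_le_sum[of k "{..n}" "\<lambda>k. 6 * x ^ k * of_bool (j \<in> near_powers p q m (2 ^ k))"] k kn x
      by simp
    finally show ?thesis using x by (simp add: add_increasing2)
  qed
  have "(\<Sum>j=1..L. sqrt (rotation_bound p q m j))
      \<le> (\<Sum>j=1..L. (\<Sum>k\<le>n. 6 * x ^ k * of_bool (j \<in> near_powers p q m (2 ^ k))) + 3 * x ^ n)"
    using point by (rule sum_mono)
  also have "\<dots> = (\<Sum>j=1..L. \<Sum>k\<le>n. 6 * x ^ k * of_bool (j \<in> near_powers p q m (2 ^ k))) + 3 * real L * x ^ n"
    by (simp only: sum.distrib) simp
  also have "(\<Sum>j=1..L. \<Sum>k\<le>n. 6 * x ^ k * of_bool (j \<in> near_powers p q m (2 ^ k)))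
      = (\<Sum>k\<le>n. \<Sum>j=1..L. 6 * x ^ k * of_bool (j \<in> near_powers p q m (2 ^ k)))" by (rule sum.swap)
  also have "\<dots> = (\<Sum>k\<le>n. 6 * x ^ k * real (card (near_powers p q m (2 ^ k) \<inter> {1..L})))"
    by (intro sum.cong refl) (simp add: Int_commute flip: sum_distrib_left)
  also have "\<dots> \<le> (\<Sum>k\<le>n. 6 * x ^ k * a k)"
    using assms(2) x by (intro sum_mono mult_left_mono) auto
  finally show ?thesis by (simp add: x_def ac_simps)
qed

text \<open>The factor \<open>2 * k + 3\<close> is \<open>2 * B + 1\<close> with
  \<open>B = k + 1\<close>, raised to the power \<open>d = 33\<close>.\<close>

lemma summable_poly_times_geometric:
  "summable (\<lambda>k. 6 * real ((2 * k + 3) ^ 33) * sqrt (1 / 2) ^ k)"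
proof (rule summable_comparison_test_bigo[where g = "\<lambda>k. (4 / 5) ^ k"])
  have le: "sqrt (1 / 2) \<le> 3 / 4" by (rule real_le_lsqrt) (auto simp: power2_eq_square)
  have "(\<lambda>k. 6 * real ((2 * k + 3) ^ 33) * sqrt (1 / 2) ^ k)
      \<in> O(\<lambda>k. 6 * real ((2 * k + 3) ^ 33) * (3 / 4) ^ k)"
    using le by (intro bigoI[of _ 1] always_eventually) (auto intro!: mult_left_mono power_mono)
  also have "(\<lambda>k. 6 * real ((2 * k + 3) ^ 33) * (3 / 4) ^ k) = (\<lambda>k. 6 * (2 * real k + 3) ^ 33 * (3 / 4) ^ k)"
    by simp
  also have "\<dots> \<in> O(\<lambda>k::nat. (4 / 5) ^ k)"
    by real_asymp
  finally show "(\<lambda>k. 6 * real ((2 * k + 3) ^ 33) * sqrt (1 / 2) ^ k) \<in> O(\<lambda>k::nat. (4 / 5) ^ k)" .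
qed (simp add: summable_geometric)

text \<open>Here 140 is \<open>4 * (33 + 2)\<close>, from the height bound, and
  \<open>32 * h + 33\<close> bounds \<open>Suc k\<close> for the scales
  \<open>k \<le> 8 * Suc \<kappa>\<close> when \<open>\<kappa> \<le> 4 * h + 3\<close>.\<close>

lemma linear_le_power_two:
  assumes "h \<ge> 17"
  shows "(32 * h + 33) * 140 \<le> (2::nat) ^ h"
  using assms by (induction h rule: nat_induct_at_least) auto

text \<open>With \<open>d = 33\<close> the pigeonhole argument works for exponents up to about the 16th root of \<open>L\<close>.\<close>

lemma card_near_powers_large_modulus:
  fixes p q K :: nat
  assumes "prime p" "coprime p q" "K \<ge> 1"
    and K: "\<And>m s \<Delta>. s \<ge> 1 \<Longrightarrow> \<Delta> \<ge> 1 \<Longrightarrow> int p ^ m dvd int s * (int q ^ \<Delta> - 1) \<Longrightarrow> p ^ m \<le> K * s * \<Delta>"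
    and \<kappa>: "L \<ge> 1" "L < 16 ^ Suc \<kappa>" "\<kappa> div 4 \<ge> 17" "\<kappa> div 4 \<ge> K"
    and m: "m > 2 ^ (\<kappa> div 2)" and k: "k \<le> 8 * Suc \<kappa>"
  shows "card (near_powers p q m (2 ^ k) \<inter> {1..L}) \<le> (2 * k + 3) ^ 33" "4 ^ k \<le> p ^ m"
proof -
  define h where "h = \<kappa> div 4"
  have h: "h \<ge> 17" "h \<ge> K" "4 * h \<le> \<kappa>" "\<kappa> \<le> 4 * h + 3" "2 * h \<le> \<kappa> div 2"
    using \<kappa> by (auto simp: h_def)
  \<comment> \<open>One factor \<open>2 ^ h\<close> is used up by the range of the exponents in the
    pigeonhole argument; the other dominates the linear term \<open>140 * Suc k\<close> of the
    height bound.\<close>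
  have m': "m > 2 ^ h * 2 ^ h"
  proof -
    have "2 ^ h * 2 ^ h = (2::nat) ^ (2 * h)" by (simp add: mult_2 power_add)
    also have "\<dots> \<le> 2 ^ (\<kappa> div 2)" using h(5) by (intro power_increasing) auto
    finally show ?thesis using m by simp
  qed
  have lin: "(32 * h + 33) * 140 \<le> 2 ^ h" using h(1) by (rule linear_le_power_two)
  have m2: "(32 * h + 33) * 140 * 2 ^ h < m"
    using mult_right_mono[OF lin, of "2 ^ h"] m' by linarith
  have m1: "4480 * h + 4620 < m"
  proof -
    have "4480 * h + 4620 = (32 * h + 33) * 140 * 1" by simp
    also have "\<dots> \<le> (32 * h + 33) * 140 * 2 ^ h" by (intro mult_left_mono) auto
    also note m2
    finally show ?thesis .
  qed
  have k9: "k \<le> 8 * \<kappa> + 8" using k by simp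
  have pow: "(2::nat) ^ n < p ^ m" if "n < m" for n
  proof -
    have "(2::nat) ^ n < 2 ^ m" using that by (intro power_strict_increasing) auto
    also have "\<dots> \<le> p ^ m" using prime_ge_2_nat[OF assms(1)] by (intro power_mono) auto
    finally show ?thesis .
  qed
  have "(4::nat) ^ k = 2 ^ (2 * k)" by (simp add: power_mult)
  also have "\<dots> < p ^ m" using k9 h(2,4) m1 by (intro pow) linarith
  finally show "4 ^ k \<le> p ^ m" by simp
  have sixteen: "(16::nat) ^ Suc \<kappa> = 2 ^ (4 * Suc \<kappa>)" unfolding power_mult by simp
  have L: "L \<le> 2 ^ (4 * Suc \<kappa>)" using \<kappa>(2) unfolding sixteen by simp
  have "card (near_powers p q m (2 ^ k) \<inter> {1..L}) \<le> (2 * (k + 1) + 1) ^ 33"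
  proof (rule card_near_powers_le_polylog[OF assms(1-3) K, where E = "2 ^ h - 1"])
    show "1 \<le> (2::nat) ^ k" "2 * 2 ^ k < (2::nat) ^ Suc (k + 1)" by simp_all
    have "8 * K * (2 ^ k) ^ 4 * L \<le> 2 ^ 3 * 2 ^ K * 2 ^ (4 * k) * 2 ^ (4 * Suc \<kappa>)"
      using L less_exp[of K] by (intro mult_mono) (auto simp: mult.commute simp flip: power_mult)
    also have "\<dots> = 2 ^ (3 + K + 4 * k + 4 * Suc \<kappa>)" by (simp only: power_add)
    also have "\<dots> < p ^ m" using k9 h(2,4) m1 by (intro pow) simp
    finally show "8 * K * (2 ^ k) ^ 4 * L < p ^ m" .
    have "(2 * 2 ^ k) ^ (4 * (33 + 2) * (2 ^ h - 1)) = (2::nat) ^ (Suc k * (140 * (2 ^ h - 1)))"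
    proof -
      have "4 * (33 + 2) * (2 ^ h - 1) = 140 * (2 ^ h - 1 :: nat)" by simp
      then show ?thesis by (simp only: power_Suc[symmetric] power_mult[symmetric])
    qed
    also have "\<dots> < p ^ m"
    proof (rule pow)
      have "Suc k * (140 * (2 ^ h - 1)) \<le> (32 * h + 33) * (140 * 2 ^ h)"
        using k9 h(4) by (intro mult_mono) auto
      also have "\<dots> = (32 * h + 33) * 140 * 2 ^ h" by (simp only: mult.assoc)
      also note m2
      finally show "Suc k * (140 * (2 ^ h - 1)) < m" .
    qed
    finally show "(2 * 2 ^ k) ^ (4 * (33 + 2) * (2 ^ h - 1)) < p ^ m" .
    define X where "X = (2::nat) ^ h"
    have X1: "X \<ge> 1" by (simp add: X_def)
    have XX: "2 ^ h - 1 + 1 = X" using X1 by (simp add: X_def)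
    have "((33 + 2) * (X - 1) + 1) * ((33 + 2) * (X - 1) * L + 1) \<le> (35 * X) * (35 * X * L)"
    proof (rule mult_mono)
      have "35 * (X - 1) * L + 1 \<le> 35 * (X - 1) * L + L" using \<kappa>(1) by simp
      also have "\<dots> = (35 * (X - 1) + 1) * L" by simp
      also have "\<dots> \<le> 35 * X * L" using X1 by (intro mult_mono) auto
      finally show "(33 + 2) * (X - 1) * L + 1 \<le> 35 * X * L" by simp
    qed (use X1 in auto)
    also have "\<dots> = 1225 * X ^ 2 * L" by (simp add: power2_eq_square)
    also have "\<dots> < 1225 * X ^ 2 * 16 ^ Suc \<kappa>" using \<kappa>(2) X1 by simp
    \<comment> \<open>This is where \<open>d = 33\<close> comes from: the constant
      \<open>1225 = 35 * 35\<close> costs one power of \<open>X\<close>, the two ranges of sums cost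
      two, and \<open>L < 16 ^ Suc \<kappa>\<close> costs at most 32, in total
      \<open>d + 2\<close>.\<close>
    also have "\<dots> \<le> X * X ^ 2 * X ^ 32"
    proof (intro mult_mono order.refl)
      have "(2::nat) ^ 17 \<le> X" unfolding X_def using h(1) by (intro power_increasing) auto
      then show "1225 \<le> X" by simp
      have "(16::nat) ^ Suc \<kappa> \<le> 2 ^ (h * 32)"
        unfolding sixteen using h(1,4) by (intro power_increasing) auto
      then show "16 ^ Suc \<kappa> \<le> X ^ 32" by (simp only: X_def power_mult)
    qed auto
    also have "\<dots> = X ^ (33 + 2)" by (simp flip: power_Suc power_add)
    finally show "((33 + 2) * (2 ^ h - 1) + 1) * ((33 + 2) * (2 ^ h - 1) * L + 1)
        < (2 ^ h - 1 + 1) ^ (33 + 2)"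
      unfolding XX by (simp only: X_def)
  qed auto
  also have "2 * (k + 1) + 1 = 2 * k + 3" by simp
  finally show "card (near_powers p q m (2 ^ k) \<inter> {1..L}) \<le> (2 * k + 3) ^ 33" .
qed


text \<open>Scales run up to \<open>n = 8 * Suc \<kappa>\<close>, where
  \<open>sqrt (1 / 2) ^ n = 1 / 16 ^ Suc \<kappa> < 1 / L\<close>. The exponents left over at the
  last scale thus contribute at most 3 altogether, and the bound is independent of \<open>L\<close>
  and \<open>m\<close>.\<close>

lemma sum_sqrt_rotation_bound_large:
  fixes p q K :: nat
  assumes "prime p" "coprime p q" "K \<ge> 1"
    and K: "\<And>m s \<Delta>. s \<ge> 1 \<Longrightarrow> \<Delta> \<ge> 1 \<Longrightarrow> int p ^ m dvd int s * (int q ^ \<Delta> - 1) \<Longrightarrow> p ^ m \<le> K * s * \<Delta>"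
    and \<kappa>: "L \<ge> 1" "L < 16 ^ Suc \<kappa>" "\<kappa> div 4 \<ge> 17" "\<kappa> div 4 \<ge> K"
    and m: "m > 2 ^ (\<kappa> div 2)"
  shows "(\<Sum>j=1..L. sqrt (rotation_bound p q m j))
    \<le> (\<Sum>k. 6 * real ((2 * k + 3) ^ 33) * sqrt (1 / 2) ^ k) + 3"
proof -
  note card = card_near_powers_large_modulus[OF assms]
  define n where "n = 8 * Suc \<kappa>"
  have "(\<Sum>j=1..L. sqrt (rotation_bound p q m j))
    \<le> (\<Sum>k\<le>n. 6 * real ((2 * k + 3) ^ 33) * sqrt (1 / 2) ^ k) + 3 * real L * sqrt (1 / 2) ^ n"
    using card by (intro sum_sqrt_rotation_bound_dyadic of_nat_mono) (auto simp: n_def)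
  also have "(\<Sum>k\<le>n. 6 * real ((2 * k + 3) ^ 33) * sqrt (1 / 2) ^ k)
    \<le> (\<Sum>k. 6 * real ((2 * k + 3) ^ 33) * sqrt (1 / 2) ^ k)"
    by (intro sum_le_suminf summable_poly_times_geometric) auto
  also have "3 * real L * sqrt (1 / 2) ^ n \<le> 3"
  proof -
    have "sqrt (1 / 2) ^ n = 1 / 2 ^ (4 * Suc \<kappa>)"
      unfolding n_def using sqrt_half_power_even[of "4 * Suc \<kappa>"] by simp
    also have "(2::real) ^ (4 * Suc \<kappa>) = 16 ^ Suc \<kappa>" unfolding power_mult by simp
    finally have eq: "sqrt (1 / 2) ^ n = 1 / 16 ^ Suc \<kappa>" .
    have "real L \<le> real (16 ^ Suc \<kappa>)" using \<kappa>(2) by (intro of_nat_mono) simp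
    then have "real L / 16 ^ Suc \<kappa> \<le> 1" by simp
    then have "3 * (real L / 16 ^ Suc \<kappa>) \<le> 3 * 1" by (intro mult_left_mono) auto
    then show ?thesis unfolding eq by simp
  qed
  finally show ?thesis by simp
qed

text \<open>Smooths the floor in the exponent: \<open>(24 / 25) ^ 8\<close> is still above
  \<open>sqrt (1 / 2)\<close>, and the at most seven missing factors are absorbed by the 2.\<close>

lemma sqrt_half_power_div_8: "sqrt (1 / 2) ^ (m div 8) \<le> 2 * (24 / 25) ^ m"
proof -
  have "sqrt (1 / 2) \<le> (24 / 25) ^ 8" by (rule real_le_lsqrt) (simp_all add: power_divide)
  then have "sqrt (1 / 2) ^ (m div 8) \<le> ((24 / 25) ^ 8) ^ (m div 8)" by (intro power_mono) auto
  also have "\<dots> = (24 / 25) ^ (8 * (m div 8)) * 1" by (simp add: power_mult)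
  also have "\<dots> \<le> (24 / 25) ^ (8 * (m div 8)) * (2 * (24 / 25) ^ 7)"
    by (intro mult_left_mono) (simp_all add: power_divide)
  also have "\<dots> \<le> (24 / 25) ^ (8 * (m div 8)) * (2 * (24 / 25) ^ (m mod 8))"
    by (intro mult_left_mono power_decreasing) auto
  also have "\<dots> = 2 * (24 / 25) ^ (8 * (m div 8) + m mod 8)" by (simp only: power_add ac_simps)
  finally show ?thesis by simp
qed

text \<open>For \<open>L\<close> between \<open>16 ^ \<kappa>\<close> and
  \<open>16 ^ Suc \<kappa>\<close> the split is at \<open>M = 2 ^ (\<kappa> div 2)\<close>. Up to
  \<open>M\<close> the scale is \<open>min (m div 8) \<kappa>\<close>: the first choice gives a
  geometric series in \<open>m\<close>, the second a plateau \<open>L * x ^ \<kappa>\<close>, with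
  \<open>x = sqrt (1 / 2)\<close>, that occurs at most \<open>M\<close> times, and
  \<open>M * x ^ \<kappa> \<le> 1\<close>. Beyond \<open>M\<close> every \<open>m\<close>
  contributes at most a constant. Each piece is of order \<open>L\<close>.\<close>

lemma sum_sqrt_rotation_bound:
  fixes p q :: nat
  assumes "prime p" "coprime p q" "q \<ge> 2"
  shows "\<exists>C. \<forall>L. (\<Sum>m=1..L. \<Sum>j=1..L. sqrt (rotation_bound p q m j)) \<le> C * real L"
proof -
  obtain K where K: "K \<ge> 1"
      "\<And>m s \<Delta>. s \<ge> 1 \<Longrightarrow> \<Delta> \<ge> 1 \<Longrightarrow> int p ^ m dvd int s * (int q ^ \<Delta> - 1) \<Longrightarrow> p ^ m \<le> K * s * \<Delta>"
    using prime_power_dvd_mult_power_minus_1[OF assms] by blast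
  define H where "H = max 17 K"
  define C\<^sub>1 where "C\<^sub>1 = 10 * real K + 3"
  define C\<^sub>2 where "C\<^sub>2 = (\<Sum>k. 6 * real ((2 * k + 3) ^ 33) * sqrt (1 / 2) ^ k) + 3"
  define x where "x = sqrt (1 / 2)"
  have x: "0 \<le> x" "x \<le> 1" by (auto simp: x_def)
  have C2: "0 \<le> C\<^sub>2" unfolding C\<^sub>2_def
    by (intro add_nonneg_nonneg suminf_nonneg summable_poly_times_geometric) auto
  have C1: "0 \<le> C\<^sub>1" by (simp add: C\<^sub>1_def)
  \<comment> \<open>The first summand covers small \<open>L\<close> trivially; 51 is
    \<open>2 * 25 + 1\<close>, from the geometric series with ratio \<open>24 / 25\<close> and from
    the plateau.\<close>
  define C where "C = 16 ^ (4 * H) + C\<^sub>1 * 51 + C\<^sub>2"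
  have "(\<Sum>m=1..L. \<Sum>j=1..L. sqrt (rotation_bound p q m j)) \<le> C * real L" for L :: nat
  proof (cases "L < 16 ^ (4 * H)")
    case True
    have "(\<Sum>m=1..L. \<Sum>j=1..L. sqrt (rotation_bound p q m j)) \<le> (\<Sum>m=1..L. \<Sum>j=1..L. 1)"
      using rotation_bound_le_1 by (intro sum_mono) simp
    also have "\<dots> = real L * real L" by simp
    also have "\<dots> \<le> C * real L"
    proof (rule mult_right_mono)
      have "real L \<le> real (16 ^ (4 * H))" using True by (intro of_nat_mono) simp
      also have "\<dots> \<le> C" using C1 C2 by (simp add: C_def)
      finally show "real L \<le> C" .
    qed simp
    finally show ?thesis .
  next
    case False
    then have L1: "L \<ge> 1" by (metis less_one linorder_not_less zero_less_power zero_less_numeral)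
    obtain \<kappa> where \<kappa>: "16 ^ \<kappa> \<le> L" "L < 16 ^ Suc \<kappa>"
      using ex_power_ivl1[of 16 L] L1 by auto
    have "\<not> \<kappa> < 4 * H"
    proof
      assume "\<kappa> < 4 * H"
      then have "(16::nat) ^ Suc \<kappa> \<le> 16 ^ (4 * H)" by (intro power_increasing) auto
      then show False using \<kappa>(2) False by linarith
    qed
    then have H: "\<kappa> div 4 \<ge> 17" "\<kappa> div 4 \<ge> K" by (auto simp: H_def)
    define M where "M = (2::nat) ^ (\<kappa> div 2)"
    have point: "(\<Sum>j=1..L. sqrt (rotation_bound p q m j))
        \<le> C\<^sub>1 * real L * (2 * (24 / 25) ^ m) + C\<^sub>1 * real L * (of_bool (m \<le> M) * x ^ \<kappa>) + C\<^sub>2" for m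
    proof (cases "m \<le> M")
      case True
      define k where "k = min (m div 8) \<kappa>"
      have "(16::nat) ^ k \<le> 16 ^ \<kappa>" by (intro power_increasing) (auto simp: k_def)
      then have "16 ^ k \<le> L" using \<kappa>(1) by (rule order.trans)
      moreover have "8 * k \<le> m" by (auto simp: k_def min_def)
      ultimately have "(\<Sum>j=1..L. sqrt (rotation_bound p q m j)) \<le> C\<^sub>1 * real L * x ^ k"
        unfolding C\<^sub>1_def x_def by (intro sum_sqrt_rotation_bound_small assms K)
      also have "\<dots> \<le> C\<^sub>1 * real L * (2 * (24 / 25) ^ m + x ^ \<kappa>)"
      proof (rule mult_left_mono)
        have "x ^ k \<le> x ^ (m div 8) + x ^ \<kappa>" using x by (auto simp: k_def min_def)
        then show "x ^ k \<le> 2 * (24 / 25) ^ m + x ^ \<kappa>"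
          using sqrt_half_power_div_8[of m] by (simp add: x_def)
      qed (use C1 in simp)
      finally show ?thesis using True C2 by (simp add: distrib_left)
    next
      case False
      then have "(\<Sum>j=1..L. sqrt (rotation_bound p q m j)) \<le> C\<^sub>2"
        unfolding C\<^sub>2_def M_def
        by (intro sum_sqrt_rotation_bound_large[OF assms(1,2) K L1 \<kappa>(2) H]) auto
      then show ?thesis using False C1 by (simp add: add_increasing)
    qed
    have "(\<Sum>m=1..L. \<Sum>j=1..L. sqrt (rotation_bound p q m j))
        \<le> (\<Sum>m=1..L. C\<^sub>1 * real L * (2 * (24 / 25) ^ m) + C\<^sub>1 * real L * (of_bool (m \<le> M) * x ^ \<kappa>) + C\<^sub>2)"
      using point by (rule sum_mono)
    also have "\<dots> = C\<^sub>1 * real L * (2 * (\<Sum>m=1..L. (24 / 25) ^ m))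
        + C\<^sub>1 * real L * ((\<Sum>m=1..L. of_bool (m \<le> M)) * x ^ \<kappa>) + C\<^sub>2 * real L"
      by (simp add: sum.distrib sum_distrib_left sum_distrib_right del: sum_of_bool_eq sum_of_bool_mult_eq)
    finally have bound: "(\<Sum>m=1..L. \<Sum>j=1..L. sqrt (rotation_bound p q m j))
        \<le> C\<^sub>1 * real L * (2 * (\<Sum>m=1..L. (24 / 25) ^ m))
        + C\<^sub>1 * real L * ((\<Sum>m=1..L. of_bool (m \<le> M)) * x ^ \<kappa>) + C\<^sub>2 * real L" .
    have geo: "(\<Sum>m=1..L. (24 / 25 :: real) ^ m) \<le> 25"
    proof -
      have "(\<Sum>m=1..L. (24 / 25 :: real) ^ m) \<le> (\<Sum>m. (24 / 25) ^ m)"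
        by (intro sum_le_suminf summable_geometric) auto
      also have "\<dots> = 25" by (subst suminf_geometric) auto
      finally show ?thesis .
    qed
    have cnt: "(\<Sum>m=1..L. of_bool (m \<le> M)) * x ^ \<kappa> \<le> 1"
    proof -
      have "(\<Sum>m=1..L. of_bool (m \<le> M)) = real (card ({1..L} \<inter> {m. m \<le> M}))" by simp
      also have "\<dots> \<le> real (card {1..M})" by (intro of_nat_mono card_mono) auto
      also have "\<dots> = 2 ^ (\<kappa> div 2)" by (simp add: M_def)
      finally have "(\<Sum>m=1..L. of_bool (m \<le> M)) * x ^ \<kappa> \<le> 2 ^ (\<kappa> div 2) * x ^ \<kappa>"
        using x by (intro mult_right_mono) auto
      also have "\<dots> \<le> 2 ^ (\<kappa> div 2) * x ^ (2 * (\<kappa> div 2))"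
        using x by (intro mult_left_mono power_decreasing) auto
      also have "\<dots> = 1" unfolding x_def sqrt_half_power_even by simp
      finally show ?thesis .
    qed
    note bound
    also have "C\<^sub>1 * real L * (2 * (\<Sum>m=1..L. (24 / 25) ^ m))
        + C\<^sub>1 * real L * ((\<Sum>m=1..L. of_bool (m \<le> M)) * x ^ \<kappa>) + C\<^sub>2 * real L
        \<le> C\<^sub>1 * real L * (2 * 25) + C\<^sub>1 * real L * 1 + C\<^sub>2 * real L"
      using C1 geo cnt by (intro add_mono mult_left_mono order.refl) auto
    also have "\<dots> \<le> C * real L"
      by (simp add: C_def algebra_simps)
    finally show ?thesis .
  qed
  then show ?thesis by blast
qed

section \<open>From the discrepancy to residue classes\<close>

lemma radical_inverse_rec:
  assumes "b \<ge> 2"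
  shows "radical_inverse b n = (real (n mod b) + radical_inverse b (n div b)) / real b"
proof -
  define f where "f j = real (digit b (Suc j) n) / real b ^ Suc j" for j
  have f: "f sums radical_inverse b n" unfolding f_def by (rule radical_inverse_sums[OF assms])
  then have "(\<lambda>j. f (Suc j)) sums (radical_inverse b n - f 0)" by (simp add: sums_Suc_iff)
  moreover have "(\<lambda>j. f (Suc j)) = (\<lambda>j. (1 / real b) * (real (digit b (Suc j) (n div b)) / real b ^ Suc j))"
    by (simp add: f_def digit_def fun_eq_iff div_mult2_eq)
  moreover have "\<dots> sums ((1 / real b) * radical_inverse b (n div b))"
    by (intro sums_mult radical_inverse_sums[OF assms])
  ultimately have "radical_inverse b n - f 0 = (1 / real b) * radical_inverse b (n div b)"
    by (metis sums_unique2)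
  then show ?thesis by (simp add: f_def digit_def add_divide_distrib)
qed

lemma radical_inverse_0 [simp]: "radical_inverse b 0 = 0"
  by (simp add: radical_inverse_def digit_def)

lemma radical_inverse_nonneg: "0 \<le> radical_inverse b n" if "b \<ge> 2"
  using sums_le[OF _ sums_zero radical_inverse_sums[OF that, of n]] by simp

lemma radical_inverse_less_1:
  assumes "b \<ge> 2"
  shows "radical_inverse b n < 1"
proof (induction n rule: less_induct)
  case (less n)
  show ?case
  proof (cases "n = 0")
    case False
    then have "radical_inverse b (n div b) < 1" using assms by (intro less) auto
    moreover have "real (n mod b) \<le> real b - 1"
      using assms mod_less_divisor[of b n] by linarith
    ultimately show ?thesis using assms by (simp add: radical_inverse_rec[of b n])
  qed simp
qed

lemma radical_inverse_eq_sum: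
  assumes "b \<ge> 2" "u < b ^ a"
  shows "radical_inverse b u = (\<Sum>i<a. real (u div b ^ i mod b) / real b ^ Suc i)"
  using assms(2)
proof (induction a arbitrary: u)
  case (Suc a)
  have "u div b < b ^ a" using Suc.prems assms(1) by (simp add: less_mult_imp_div_less mult.commute)
  from Suc.IH[OF this] show ?case
    using assms(1) unfolding radical_inverse_rec[OF assms(1), of u] sum.lessThan_Suc_shift
    by (simp add: add_divide_distrib sum_divide_distrib div_mult2_eq mult.commute)
qed simp

lemma radical_inverse_add_le_1:
  assumes "b \<ge> 2" "u < b ^ a"
  shows "radical_inverse b u + 1 / real b ^ a \<le> 1"
  using assms(2)
proof (induction a arbitrary: u)
  case (Suc a)
  have "u div b < b ^ a" using Suc.prems assms(1) by (simp add: less_mult_imp_div_less mult.commute)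
  from Suc.IH[OF this] have IH: "radical_inverse b (u div b) + 1 / real b ^ a \<le> 1" .
  have "real (u mod b) \<le> real b - 1" using assms mod_less_divisor[of b u] by linarith
  then have "(real (u mod b) + (radical_inverse b (u div b) + 1 / real b ^ a)) / real b \<le> 1"
    using IH assms(1) by simp
  then show ?case by (simp add: radical_inverse_rec[OF assms(1), of u] add_divide_distrib mult.commute)
qed simp

lemma radical_inverse_intervals_cover:
  assumes "b \<ge> 2" "0 \<le> x" "x \<le> 1"
  shows "\<exists>u<b ^ a. radical_inverse b u \<le> x \<and> x \<le> radical_inverse b u + 1 / real b ^ a"
  using assms(2,3)
proof (induction a arbitrary: x)
  case (Suc a)
  \<comment> \<open>The minimum takes effect at \<open>x = 1\<close>, where the floor of
    \<open>b * x\<close> is no digit and the closed last interval has to be used.\<close>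
  define d where "d = min (nat \<lfloor>real b * x\<rfloor>) (b - 1)"
  have db: "d < b" using assms(1) by (auto simp: d_def)
  have bx: "0 \<le> real b * x" "real b * x \<le> real b"
    using Suc.prems assms(1) by (auto simp: mult_left_le)
  have "real d \<le> real b * x" "real b * x \<le> real d + 1"
    using bx assms(1) by (auto simp: d_def min_def of_nat_diff) linarith+
  then obtain u where u: "u < b ^ a" "radical_inverse b u \<le> real b * x - real d"
      "real b * x - real d \<le> radical_inverse b u + 1 / real b ^ a"
    using Suc.IH[of "real b * x - real d"] by auto
  define u' where "u' = d + b * u"
  have ri: "radical_inverse b u' = (real d + radical_inverse b u) / real b"
    unfolding radical_inverse_rec[OF assms(1), of u'] using db by (simp add: u'_def)
  have "u' < b ^ Suc a"
  proof -
    have "u' < b * Suc u" using db by (simp add: u'_def)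
    also have "\<dots> \<le> b * b ^ a" using u(1) by (intro mult_le_mono) auto
    finally show ?thesis by simp
  qed
  moreover have "radical_inverse b u' \<le> x"
    unfolding ri using u(2) assms(1) by (simp add: divide_le_eq mult.commute)
  moreover have "x \<le> radical_inverse b u' + 1 / real b ^ Suc a"
  proof -
    have "x = (real b * x) / real b" using assms(1) by simp
    also have "\<dots> \<le> (real d + (radical_inverse b u + 1 / real b ^ a)) / real b"
      using u(3) by (intro divide_right_mono) auto
    also have "\<dots> = radical_inverse b u' + 1 / real b ^ Suc a"
      unfolding ri by (simp add: add_divide_distrib mult.commute)
    finally show ?thesis .
  qed
  ultimately show ?case by blast
qed (use assms in \<open>auto intro!: exI[of _ 0]\<close>)

text \<open>Reversing the digits turns \<open>{n. radical_inverse b n < radical_inverse b u}\<close> into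
  a disjoint union of residue classes.\<close>

definition below :: "nat \<Rightarrow> nat \<Rightarrow> nat \<Rightarrow> nat \<Rightarrow> real" where
  "below b a u n = (\<Sum>i<a. \<Sum>d<u div b ^ i mod b. of_bool (n mod b ^ Suc i = u mod b ^ i + d * b ^ i))"

lemma mod_power_Suc_eq_iff:
  fixes b i n u d :: nat
  assumes "b > 0"
  shows "n mod b ^ Suc (Suc i) = u mod b ^ Suc i + d * b ^ Suc i
    \<longleftrightarrow> n mod b = u mod b \<and> n div b mod b ^ Suc i = u div b mod b ^ i + d * b ^ i"
proof -
  have n: "n mod b ^ Suc (Suc i) = n mod b + b * (n div b mod b ^ Suc i)"
    using mod_mult2_eq[of n b "b ^ Suc i"] by simp
  have u: "u mod b ^ Suc i + d * b ^ Suc i = u mod b + b * (u div b mod b ^ i + d * b ^ i)"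
    using mod_mult2_eq[of u b "b ^ i"] by (simp add: algebra_simps)
  have "r + b * x = r' + b * y \<longleftrightarrow> r = r' \<and> x = y" if "r < b" "r' < b" for r r' x y :: nat
  proof
    assume eq: "r + b * x = r' + b * y"
    have "r = r'" using arg_cong[OF eq, of "\<lambda>z. z mod b"] that by simp
    then show "r = r' \<and> x = y" using eq assms by simp
  qed simp
  then show ?thesis unfolding n u using assms by simp
qed

text \<open>Reversed digits compare lexicographically: the lowest digit decides unless it
  agrees.\<close>

lemma below_Suc:
  assumes "b \<ge> 2"
  shows "below b (Suc a) u n
    = of_bool (n mod b < u mod b) + of_bool (n mod b = u mod b) * below b a (u div b) (n div b)"
proof -
  have "(\<Sum>d<u mod b. of_bool (n mod b = d) :: real) = of_bool (n mod b < u mod b)"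
    by (simp add: of_bool_def)
  moreover have "(\<Sum>i<a. \<Sum>d<u div b ^ Suc i mod b. of_bool (n mod b ^ Suc (Suc i) = u mod b ^ Suc i + d * b ^ Suc i))
      = of_bool (n mod b = u mod b) * below b a (u div b) (n div b)"
    unfolding below_def sum_distrib_left mod_power_Suc_eq_iff[OF less_le_trans[OF zero_less_numeral assms]]
    by (intro sum.cong) (simp_all add: div_mult2_eq)
  ultimately show ?thesis unfolding below_def sum.lessThan_Suc_shift by (simp del: power_Suc) 
qed

lemma below_bounds:
  assumes "b \<ge> 2"
  shows "0 \<le> below b a u n" "below b a u n \<le> 1"
proof (induction a arbitrary: u n)
  case (Suc a)
  { case 1 then show ?case by (simp add: below_def sum_nonneg) }
  { case 2 then show ?case using Suc(2)[of "u div b" "n div b"] by (simp add: below_Suc[OF assms]) }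
qed (simp_all add: below_def)

text \<open>Outside the class of \<open>u\<close> modulo \<open>b ^ a\<close>, the first digit at
  which \<open>n\<close> and \<open>u\<close> differ decides the comparison with every
  \<open>x\<close> in the closed elementary interval at \<open>u\<close>. The right end point is
  allowed because \<open>radical_inverse b n < x\<close> is strict.\<close>

lemma below_eq_indicator:
  assumes "b \<ge> 2" "u < b ^ a" "n mod b ^ a \<noteq> u"
    and "radical_inverse b u \<le> x" "x \<le> radical_inverse b u + 1 / real b ^ a"
  shows "below b a u n = of_bool (radical_inverse b n < x)"
  using assms(2-)
proof (induction a arbitrary: u n x)
  case (Suc a)
  have b: "real b > 0" using assms(1) by simp
  have u': "u div b < b ^ a" using Suc.prems assms(1) by (simp add: less_mult_imp_div_less mult.commute)
  define x' where "x' = real b * x - real (u mod b)"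
  have x': "radical_inverse b (u div b) \<le> x'" "x' \<le> radical_inverse b (u div b) + 1 / real b ^ a"
  proof -
    show "radical_inverse b (u div b) \<le> x'"
      using Suc.prems(3) b by (simp add: x'_def radical_inverse_rec[OF assms(1), of u] field_simps)
    have "real b * x \<le> real b * (radical_inverse b u + 1 / real b ^ Suc a)"
      using Suc.prems(4) b by (intro mult_left_mono) auto
    also have "\<dots> = real (u mod b) + (radical_inverse b (u div b) + 1 / real b ^ a)"
    proof -
      have "real b * radical_inverse b u = real (u mod b) + radical_inverse b (u div b)"
        using b by (simp add: radical_inverse_rec[OF assms(1), of u])
      moreover have "real b * (1 / real b ^ Suc a) = 1 / real b ^ a" using b by simp
      ultimately show ?thesis by (simp only: distrib_left add.assoc)
    qed
    finally show "x' \<le> radical_inverse b (u div b) + 1 / real b ^ a" by (simp add: x'_def)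
  qed
  have n: "radical_inverse b n < x \<longleftrightarrow> real (n mod b) + radical_inverse b (n div b) < real (u mod b) + x'"
    using b by (simp add: x'_def radical_inverse_rec[OF assms(1), of n] field_simps)
  consider "n mod b < u mod b" | "n mod b = u mod b" | "u mod b < n mod b" by linarith
  then show ?case
  proof cases
    case 1
    have "real (n mod b) + 1 \<le> real (u mod b)" using 1 by linarith
    then have "radical_inverse b n < x"
      unfolding n using radical_inverse_less_1[OF assms(1), of "n div b"]
        radical_inverse_nonneg[OF assms(1), of "u div b"] x' by linarith
    then show ?thesis using 1 by (simp add: below_Suc[OF assms(1)])
  next
    case 2
    have "n div b mod b ^ a \<noteq> u div b"
    proof
      assume "n div b mod b ^ a = u div b"
      then have "n mod b ^ Suc a = u mod b + b * (u div b)"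
        using mod_mult2_eq[of n b "b ^ a"] 2 by simp
      then show False using Suc.prems(2) by simp
    qed
    then have "below b a (u div b) (n div b) = of_bool (radical_inverse b (n div b) < x')"
      using u' x' by (intro Suc.IH) auto
    then show ?thesis using 2 n by (simp add: below_Suc[OF assms(1)])
  next
    case 3
    have "real (u mod b) + 1 \<le> real (n mod b)" using 3 by linarith
    moreover have "x' \<le> 1" using x'(2) radical_inverse_add_le_1[OF assms(1) u'] by linarith
    ultimately have "\<not> radical_inverse b n < x"
      unfolding n using radical_inverse_nonneg[OF assms(1), of "n div b"] by linarith
    then show ?thesis using 3 by (simp add: below_Suc[OF assms(1)])
  qed
qed simp

section \<open>From the integral over the square to sums over digit strings\<close>

lemma sum_residue_indicator_le_1:
  fixes Q N M r :: nat
  assumes "N \<le> M"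
  shows "(\<Sum>n<N. of_bool ((Q + n) mod M = r) :: real) \<le> 1"
proof -
  have "card {n\<in>{..<N}. (Q + n) mod M = r} \<le> 1"
  proof (rule card_le_Suc0_iff_eq[THEN iffD2, folded One_nat_def])
    show "\<forall>n\<in>{n\<in>{..<N}. (Q + n) mod M = r}. \<forall>n'\<in>{n\<in>{..<N}. (Q + n) mod M = r}. n = n'"
    proof (intro ballI)
      fix n n' assume *: "n \<in> {n\<in>{..<N}. (Q + n) mod M = r}" "n' \<in> {n\<in>{..<N}. (Q + n) mod M = r}"
      then have "(Q + n) mod M = (Q + n') mod M" by simp
      then have "int (Q + n) mod int M = int (Q + n') mod int M" by (simp only: flip: zmod_int)
      then have "int M dvd int n - int n'" by (simp add: mod_eq_dvd_iff)
      moreover have "\<bar>int n - int n'\<bar> < int M" using * assms by auto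
      ultimately have "int n - int n' = 0" using dvd_imp_le_int[of "int n - int n'" "int M"] by auto
      then show "n = n'" by simp
    qed
  qed simp
  moreover have "{n\<in>{..<N}. (Q + n) mod M = r} = {..<N} \<inter> {n. (Q + n) mod M = r}" by auto
  ultimately show ?thesis by simp
qed

text \<open>The local discrepancy at the lower left corner of an elementary box, with the indicators
  of both coordinates in digit form.\<close>

definition class_discrepancy :: "nat \<Rightarrow> nat \<Rightarrow> nat \<Rightarrow> nat \<Rightarrow> nat \<Rightarrow> nat \<Rightarrow> nat \<Rightarrow> real" where
  "class_discrepancy p q a Q N u v =
     (\<Sum>n<N. below p a u (Q + n) * below q a v (Q + n)) - real N * radical_inverse p u * radical_inverse q v"

text \<open>In each coordinate only indices of one residue class can be misjudged, and
  \<open>N \<le> p ^ a\<close>, \<open>N \<le> q ^ a\<close> allow one such index each. The area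
  term moves by at most \<open>N / p ^ a + N / q ^ a\<close>. This gives 2 + 2.\<close>

lemma local_discrepancy_approx:
  assumes "p \<ge> 2" "q \<ge> 2" "N \<le> p ^ a" "N \<le> q ^ a" "u < p ^ a" "v < q ^ a"
    and x: "radical_inverse p u \<le> x" "x \<le> radical_inverse p u + 1 / real p ^ a"
    and y: "radical_inverse q v \<le> y" "y \<le> radical_inverse q v + 1 / real q ^ a"
  shows "\<bar>local_discrepancy N (\<lambda>n. halton2 p q (Q + n)) (x, y)\<bar> \<le> \<bar>class_discrepancy p q a Q N u v\<bar> + 4"
proof -
  define \<alpha> \<beta> where "\<alpha> n = (of_bool (radical_inverse p (Q + n) < x) :: real)"
    and "\<beta> n = (of_bool (radical_inverse q (Q + n) < y) :: real)" for n
  define A B where "A n = below p a u (Q + n)" and "B n = below q a v (Q + n)" for n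
  define \<epsilon> \<delta> where "\<epsilon> n = (of_bool ((Q + n) mod p ^ a = u) :: real)"
    and "\<delta> n = (of_bool ((Q + n) mod q ^ a = v) :: real)" for n
  have unit: "0 \<le> \<alpha> n" "\<alpha> n \<le> 1" "0 \<le> \<beta> n" "\<beta> n \<le> 1" "0 \<le> A n" "A n \<le> 1" "0 \<le> B n" "B n \<le> 1" for n
    using below_bounds[OF assms(1)] below_bounds[OF assms(2)] by (auto simp: \<alpha>_def \<beta>_def A_def B_def)
  have "\<bar>\<alpha> n - A n\<bar> \<le> \<epsilon> n" for n
  proof (cases "(Q + n) mod p ^ a = u")
    case True
    then show ?thesis using unit[of n] by (simp add: \<epsilon>_def)
  next
    case False
    then have "A n = \<alpha> n"
      unfolding A_def \<alpha>_def by (rule below_eq_indicator[OF assms(1,5) _ x])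
    then show ?thesis by (simp add: \<epsilon>_def)
  qed
  moreover have "\<bar>\<beta> n - B n\<bar> \<le> \<delta> n" for n
  proof (cases "(Q + n) mod q ^ a = v")
    case True
    then show ?thesis using unit[of n] by (simp add: \<delta>_def)
  next
    case False
    then have "B n = \<beta> n"
      unfolding B_def \<beta>_def by (rule below_eq_indicator[OF assms(2,6) _ y])
    then show ?thesis by (simp add: \<delta>_def)
  qed
  moreover have "\<bar>\<alpha> n * \<beta> n - A n * B n\<bar> \<le> \<bar>\<alpha> n - A n\<bar> + \<bar>\<beta> n - B n\<bar>" for n
  proof -
    have "\<alpha> n * \<beta> n - A n * B n = (\<alpha> n - A n) * \<beta> n + A n * (\<beta> n - B n)" by (simp add: algebra_simps)
    also have "\<bar>\<dots>\<bar> \<le> \<bar>\<alpha> n - A n\<bar> * \<bar>\<beta> n\<bar> + \<bar>A n\<bar> * \<bar>\<beta> n - B n\<bar>"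
      by (rule order.trans[OF abs_triangle_ineq]) (simp add: abs_mult)
    also have "\<dots> \<le> \<bar>\<alpha> n - A n\<bar> * 1 + 1 * \<bar>\<beta> n - B n\<bar>"
      using unit[of n] by (intro add_mono mult_mono) auto
    finally show ?thesis by simp
  qed
  ultimately have "\<bar>\<alpha> n * \<beta> n - A n * B n\<bar> \<le> \<epsilon> n + \<delta> n" for n
    by (meson add_mono order.trans)
  then have "\<bar>\<Sum>n<N. \<alpha> n * \<beta> n - A n * B n\<bar> \<le> (\<Sum>n<N. \<epsilon> n + \<delta> n)"
    by (intro order.trans[OF sum_abs] sum_mono)
  also have "\<dots> = (\<Sum>n<N. \<epsilon> n) + (\<Sum>n<N. \<delta> n)" by (rule sum.distrib)
  also have "\<dots> \<le> 1 + 1"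
    unfolding \<epsilon>_def \<delta>_def using assms(3,4) by (intro add_mono sum_residue_indicator_le_1)
  finally have sum: "\<bar>(\<Sum>n<N. \<alpha> n * \<beta> n) - (\<Sum>n<N. A n * B n)\<bar> \<le> 2" by (simp add: sum_subtractf)
  have area: "\<bar>real N * x * y - real N * radical_inverse p u * radical_inverse q v\<bar> \<le> 2"
  proof -
    have pos: "0 \<le> radical_inverse p u" "radical_inverse p u \<le> 1" "0 \<le> radical_inverse q v"
      using radical_inverse_nonneg[OF assms(1)] radical_inverse_nonneg[OF assms(2)]
        radical_inverse_less_1[OF assms(1), of u] by auto
    have xy: "0 \<le> x" "0 \<le> y" "y \<le> 1"
      using x y pos radical_inverse_add_le_1[OF assms(2,6)] by linarith+
    have "real N \<le> real p ^ a" "real N \<le> real q ^ a"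
      using assms(3,4) by (metis of_nat_le_iff of_nat_power)+
    then have N: "real N * (1 / real p ^ a) \<le> 1" "real N * (1 / real q ^ a) \<le> 1"
      using assms(1,2) by simp_all
    have "real N * x * y - real N * radical_inverse p u * radical_inverse q v
      = real N * (x - radical_inverse p u) * y + real N * (y - radical_inverse q v) * radical_inverse p u"
      by (simp add: algebra_simps)
    moreover have "0 \<le> real N * (x - radical_inverse p u) * y" "0 \<le> real N * (y - radical_inverse q v) * radical_inverse p u"
      using x y xy pos by auto
    moreover have "real N * (x - radical_inverse p u) * y \<le> (real N * (1 / real p ^ a)) * 1"
      using x xy by (intro mult_mono) auto
    moreover have "real N * (y - radical_inverse q v) * radical_inverse p u \<le> (real N * (1 / real q ^ a)) * 1"
      using y pos by (intro mult_mono) auto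
    ultimately show ?thesis using N by linarith
  qed
  have "local_discrepancy N (\<lambda>n. halton2 p q (Q + n)) (x, y) = (\<Sum>n<N. \<alpha> n * \<beta> n) - real N * x * y"
  proof -
    have "indicator ({0..<x} \<times> {0..<y}) (halton2 p q (Q + n)) = \<alpha> n * \<beta> n" for n
      using radical_inverse_nonneg[OF assms(1)] radical_inverse_nonneg[OF assms(2)]
      by (simp add: \<alpha>_def \<beta>_def halton2_def indicator_def)
    then show ?thesis by (simp add: local_discrepancy_def)
  qed
  then show ?thesis
    using sum area unfolding class_discrepancy_def A_def B_def by linarith
qed

text \<open>The closed elementary boxes cover the unit square and have equal area, so the integral
  is at most the average of the squared bounds; common edges are counted more than once, which only
  enlarges the majorant.\<close>

lemma L2_discrepancy_le:
  assumes "p \<ge> 2" "q \<ge> 2" "N \<le> p ^ a" "N \<le> q ^ a"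
  shows "(L2_discrepancy N (\<lambda>n. halton2 p q (Q + n)))\<^sup>2 * (real p ^ a * real q ^ a)
    \<le> (\<Sum>u<p ^ a. \<Sum>v<q ^ a. (\<bar>class_discrepancy p q a Q N u v\<bar> + 4)\<^sup>2)"
proof -
  define D where "D = local_discrepancy N (\<lambda>n. halton2 p q (Q + n))"
  define c where "c u v = (\<bar>class_discrepancy p q a Q N u v\<bar> + 4)\<^sup>2" for u v
  define I where "I u v = cbox (radical_inverse p u, radical_inverse q v)
      (radical_inverse p u + 1 / real p ^ a, radical_inverse q v + 1 / real q ^ a)" for u v
  define S where "S = {0..1::real} \<times> {0..1::real}"
  have le: "indicat_real S z *\<^sub>R \<bar>D z\<bar>\<^sup>2 \<le> (\<Sum>u<p ^ a. \<Sum>v<q ^ a. c u v * indicat_real (I u v) z)" for z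
  proof (cases "z \<in> S")
    case True
    obtain x y where z: "z = (x, y)" by (cases z)
    have xy: "0 \<le> x" "x \<le> 1" "0 \<le> y" "y \<le> 1" using True by (auto simp: S_def z)
    obtain u where u: "u < p ^ a" "radical_inverse p u \<le> x" "x \<le> radical_inverse p u + 1 / real p ^ a"
      using radical_inverse_intervals_cover[OF assms(1) xy(1,2)] by blast
    obtain v where v: "v < q ^ a" "radical_inverse q v \<le> y" "y \<le> radical_inverse q v + 1 / real q ^ a"
      using radical_inverse_intervals_cover[OF assms(2) xy(3,4)] by blast
    have "\<bar>D z\<bar>\<^sup>2 \<le> c u v"
      unfolding D_def c_def z
      by (intro power_mono local_discrepancy_approx[OF assms u(1) v(1) u(2,3) v(2,3)]) auto
    also have "\<dots> = c u v * indicat_real (I u v) z"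
      using u v by (simp add: I_def z cbox_Pair_eq)
    also have "\<dots> \<le> (\<Sum>v<q ^ a. c u v * indicat_real (I u v) z)"
      using v(1) by (intro member_le_sum[of v "{..<q ^ a}" "\<lambda>v. c u v * indicat_real (I u v) z"]) (auto simp: c_def)
    also have "\<dots> \<le> (\<Sum>u<p ^ a. \<Sum>v<q ^ a. c u v * indicat_real (I u v) z)"
      using u(1) by (intro member_le_sum[of u "{..<p ^ a}" "\<lambda>u. \<Sum>v<q ^ a. c u v * indicat_real (I u v) z"])
        (auto simp: c_def intro!: sum_nonneg)
    finally show ?thesis using True by simp
  qed (auto simp: c_def intro!: sum_nonneg)
  have intI: "integrable lborel (\<lambda>z. c u v * indicat_real (I u v) z)" for u v
    unfolding I_def by (intro integrable_mult_right integrable_real_indicator) (auto simp: emeasure_lborel_cbox_eq)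
  have meas: "measure lborel (I u v) = 1 / (real p ^ a * real q ^ a)" for u v
    using assms(1,2) unfolding I_def by (simp add: content_Pair)
  have "(L2_discrepancy N (\<lambda>n. halton2 p q (Q + n)))\<^sup>2 = (LINT z|lborel. indicat_real S z *\<^sub>R \<bar>D z\<bar>\<^sup>2)"
    unfolding L2_discrepancy_def set_lebesgue_integral_def D_def S_def
    by (subst real_sqrt_pow2) (auto intro!: integral_nonneg)
  also have "\<dots> \<le> (LINT z|lborel. (\<Sum>u<p ^ a. \<Sum>v<q ^ a. c u v * indicat_real (I u v) z))"
  proof (rule integral_mono)
    show "integrable lborel (\<lambda>z. indicat_real S z *\<^sub>R \<bar>D z\<bar>\<^sup>2)"
      using local_discrepancy_square_integrable unfolding set_integrable_def D_def S_def .
    show "integrable lborel (\<lambda>z. \<Sum>u<p ^ a. \<Sum>v<q ^ a. c u v * indicat_real (I u v) z)"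
      by (intro Bochner_Integration.integrable_sum intI)
  qed (rule le)
  also have "\<dots> = (\<Sum>u<p ^ a. LINT z|lborel. (\<Sum>v<q ^ a. c u v * indicat_real (I u v) z))"
    by (rule Bochner_Integration.integral_sum) (intro Bochner_Integration.integrable_sum intI)
  also have "\<dots> = (\<Sum>u<p ^ a. \<Sum>v<q ^ a. LINT z|lborel. c u v * indicat_real (I u v) z)"
    by (intro sum.cong refl Bochner_Integration.integral_sum intI)
  also have "\<dots> = (\<Sum>u<p ^ a. \<Sum>v<q ^ a. c u v * measure lborel (I u v))"
    by simp
  also have "\<dots> = (\<Sum>u<p ^ a. \<Sum>v<q ^ a. c u v) / (real p ^ a * real q ^ a)"
    by (simp add: meas sum_divide_distrib)
  finally show ?thesis using assms(1,2) by (simp add: c_def pos_le_divide_eq)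
qed

text \<open>\<open>c\<close> and \<open>T\<close> are chosen before \<open>f\<close>: the
  progression that gives the plain count then also serves for counts weighted by a further condition
  on the index.\<close>

lemma arithmetic_progression_sum:
  fixes M r Q N :: nat
  assumes "r < M"
  shows "\<exists>c T. \<bar>real T - real N / real M\<bar> \<le> 1 \<and>
    (\<forall>f::nat \<Rightarrow> real. (\<Sum>n<N. of_bool ((Q + n) mod M = r) * f (Q + n)) = (\<Sum>t<T. f (c + M * t)))"
proof -
  define s where "s = nat ((int r - int Q) mod int M)"
  have M0: "M > 0" using assms by simp
  have s_int: "int s = (int r - int Q) mod int M" using M0 by (simp add: s_def)
  have sM: "s < M" using M0 s_int by (metis of_nat_0_less_iff of_nat_less_iff pos_mod_bound)
  have iff: "(Q + n) mod M = r \<longleftrightarrow> n mod M = s" for n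
  proof -
    have "(Q + n) mod M = r \<longleftrightarrow> int (Q + n) mod int M = int r mod int M"
    proof -
      have "int (Q + n) mod int M = int ((Q + n) mod M)" "int r mod int M = int r"
        using assms by (simp_all only: zmod_int) simp
      then show ?thesis by (simp only: of_nat_eq_iff)
    qed
    also have "\<dots> \<longleftrightarrow> int M dvd int n - (int r - int Q)"
      by (simp add: mod_eq_dvd_iff algebra_simps)
    also have "\<dots> \<longleftrightarrow> int n mod int M = (int r - int Q) mod int M"
      by (simp only: mod_eq_dvd_iff)
    also have "\<dots> \<longleftrightarrow> n mod M = s" unfolding s_int[symmetric] zmod_int[symmetric] of_nat_eq_iff ..
    finally show ?thesis .
  qed
  \<comment> \<open>The ceiling of \<open>(N - s) / M\<close>, arranged so that natural subtraction
    never truncates.\<close>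
  define T where "T = (N + (M - 1 - s)) div M"
  have tT: "t < T \<longleftrightarrow> s + M * t < N" for t
  proof -
    have "t < T \<longleftrightarrow> Suc t * M \<le> N + (M - 1 - s)"
      unfolding T_def using M0 by (simp add: less_eq_div_iff_mult_less_eq Suc_le_eq[symmetric])
    also have "\<dots> \<longleftrightarrow> s + M * t < N" using sM by (simp add: mult.commute) linarith
    finally show ?thesis .
  qed
  have "real T \<le> real N / real M + 1"
  proof -
    have "T * M \<le> N + (M - 1 - s)" unfolding T_def by simp
    then have "T * M \<le> N + M" using sM by linarith
    then have "real T * real M \<le> real N + real M" by (metis of_nat_add of_nat_le_iff of_nat_mult)
    then show ?thesis using M0 by (simp add: field_simps)
  qed
  moreover have "real N / real M - 1 \<le> real T"
  proof -
    have "N + (M - 1 - s) < (T + 1) * M"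
      unfolding T_def using M0 dividend_less_div_times[of M "N + (M - 1 - s)"] by (simp add: algebra_simps)
    then have "N \<le> (T + 1) * M" by linarith
    then have "real N \<le> (real T + 1) * real M" by (metis of_nat_1 of_nat_add of_nat_le_iff of_nat_mult)
    then show ?thesis using M0 by (simp add: field_simps)
  qed
  moreover have "(\<Sum>n<N. of_bool ((Q + n) mod M = r) * f (Q + n)) = (\<Sum>t<T. f (Q + s + M * t))"
    for f :: "nat \<Rightarrow> real"
  proof -
    have bij: "bij_betw (\<lambda>t. s + M * t) {..<T} {n\<in>{..<N}. n mod M = s}"
    proof (rule bij_betw_imageI)
      show "inj_on (\<lambda>t. s + M * t) {..<T}" using M0 by (auto simp: inj_on_def)
      show "(\<lambda>t. s + M * t) ` {..<T} = {n\<in>{..<N}. n mod M = s}"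
      proof (intro equalityI subsetI)
        fix n assume n: "n \<in> {n\<in>{..<N}. n mod M = s}"
        then have eq: "s + M * (n div M) = n" using mod_mult_div_eq[of n M] by simp
        moreover have "n div M < T" unfolding tT eq using n by simp
        ultimately show "n \<in> (\<lambda>t. s + M * t) ` {..<T}" by (metis image_eqI lessThan_iff)
      next
        fix n assume "n \<in> (\<lambda>t. s + M * t) ` {..<T}"
        then obtain t where "n = s + M * t" "t < T" by auto
        then show "n \<in> {n\<in>{..<N}. n mod M = s}" using sM tT[of t] by simp
      qed
    qed
    have "(\<Sum>n<N. of_bool ((Q + n) mod M = r) * f (Q + n)) = (\<Sum>n\<in>{n\<in>{..<N}. n mod M = s}. f (Q + n))"
      unfolding iff by (intro sum.mono_neutral_cong_right) auto
    also have "\<dots> = (\<Sum>t<T. f (Q + (s + M * t)))"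
      using sum.reindex_bij_betw[OF bij, of "\<lambda>n. f (Q + n)"] by simp
    finally show ?thesis by (simp add: add.assoc)
  qed
  ultimately show ?thesis by (intro exI[of _ "Q + s"] exI[of _ T]) (auto simp: abs_le_iff)
qed

text \<open>The Chinese remainder theorem merges both conditions into one class modulo
  \<open>P * P'\<close>.\<close>

lemma residue_classes_sum:
  fixes P P' \<alpha> \<beta> Q N :: nat
  assumes "coprime P P'" "\<alpha> < P" "\<beta> < P'"
  shows "\<exists>c T. \<bar>real T - real N / (real P * real P')\<bar> \<le> 1 \<and>
    (\<forall>f::nat \<Rightarrow> real. (\<Sum>n<N. of_bool ((Q + n) mod P = \<alpha> \<and> (Q + n) mod P' = \<beta>) * f (Q + n))
      = (\<Sum>t<T. f (c + P * P' * t)))"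
proof -
  have pos: "P \<noteq> 0" "P' \<noteq> 0" using assms by auto
  obtain r where r: "r < P * P'" "[r = \<alpha>] (mod P)" "[r = \<beta>] (mod P')"
    using binary_chinese_remainder_unique_nat[OF assms(1) pos, of \<alpha> \<beta>] by blast
  have iff: "x mod P = \<alpha> \<and> x mod P' = \<beta> \<longleftrightarrow> x mod (P * P') = r" for x
  proof -
    have "x mod P = \<alpha> \<and> x mod P' = \<beta> \<longleftrightarrow> [x = r] (mod P) \<and> [x = r] (mod P')"
      using r(2,3) assms(2,3) by (simp add: cong_def)
    also have "\<dots> \<longleftrightarrow> [x = r] (mod (P * P'))"
      using assms(1) coprime_cong_mult_nat cong_modulus_mult_nat[of x r P P']
        cong_modulus_mult_nat[of x r P' P] by (auto simp: mult.commute)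
    also have "\<dots> \<longleftrightarrow> x mod (P * P') = r" using r(1) by (simp add: cong_def)
    finally show ?thesis .
  qed
  show ?thesis
    unfolding iff using arithmetic_progression_sum[OF r(1), of N Q] by simp
qed

definition residue_discrepancy :: "nat \<Rightarrow> nat \<Rightarrow> nat \<Rightarrow> nat \<Rightarrow> nat \<Rightarrow> nat \<Rightarrow> real" where
  "residue_discrepancy P P' Q N \<alpha> \<beta> =
     (\<Sum>n<N. of_bool ((Q + n) mod P = \<alpha> \<and> (Q + n) mod P' = \<beta>)) - real N / (real P * real P')"

lemma residue_discrepancy_commute: "residue_discrepancy P P' Q N \<alpha> \<beta> = residue_discrepancy P' P Q N \<beta> \<alpha>"
  unfolding residue_discrepancy_def by (simp only: conj_commute mult.commute)

lemma abs_residue_discrepancy_le_1: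
  assumes "coprime P P'" "\<alpha> < P" "\<beta> < P'"
  shows "\<bar>residue_discrepancy P P' Q N \<alpha> \<beta>\<bar> \<le> 1"
proof -
  obtain c T where T: "\<bar>real T - real N / (real P * real P')\<bar> \<le> 1"
    and sum: "\<And>f::nat \<Rightarrow> real. (\<Sum>n<N. of_bool ((Q + n) mod P = \<alpha> \<and> (Q + n) mod P' = \<beta>) * f (Q + n))
      = (\<Sum>t<T. f (c + P * P' * t))"
    using residue_classes_sum[OF assms, of N Q] by blast
  show ?thesis using T sum[of "\<lambda>_. 1"] by (simp add: residue_discrepancy_def del: sum_of_bool_eq)
qed

text \<open>Summing over \<open>\<Xi>\<close> frees the digits at positions \<open>k\<close> to
  \<open>k + m - 2\<close>, counted from zero. What remains is the class of \<open>\<alpha>\<close>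
  modulo \<open>p ^ k\<close>, together with \<open>n div p ^ k\<close> modulo \<open>p ^ m\<close>
  lying in an arc of length \<open>p ^ (m - 1)\<close>. Along a progression of step
  \<open>p ^ k * q ^ l\<close> the quotient \<open>n div p ^ k\<close> advances by
  \<open>q ^ l\<close>, so this is an orbit count for the rotation by
  \<open>q ^ l / p ^ m\<close>.\<close>

lemma sum_residue_discrepancy_le:
  fixes p q k l m d \<alpha> \<beta> :: nat
  assumes "p > 0" "coprime p q" "m \<ge> 1" "\<alpha> < p ^ k" "d < p" "\<beta> < q ^ l"
  shows "\<bar>\<Sum>\<Xi><p ^ (m - 1). residue_discrepancy (p ^ (k + m)) (q ^ l) Q N (\<alpha> + p ^ k * \<Xi> + d * p ^ (k + m - 1)) \<beta>\<bar>
    \<le> rotation_bound p q m l * real p ^ m"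
proof -
  define w where "w = p ^ (m - 1)"
  have pm: "p ^ m = p * w" and pkm: "p ^ (k + m - 1) = p ^ k * w"
    using assms(3) by (simp_all add: w_def flip: power_Suc power_add)
  have w0: "w > 0" using assms(1) by (simp add: w_def)
  \<comment> \<open>Subtracting \<open>d * w\<close> moves the arc so that it starts at 0, the form
    in which orbits are counted.\<close>
  define g where "g x = (of_bool ((int (x div p ^ k) - int (d * w)) mod int (p ^ m) < int w) :: real)" for x
  have class_sum: "(\<Sum>\<Xi><w. of_bool (x mod p ^ (k + m) = \<alpha> + p ^ k * \<Xi> + d * p ^ (k + m - 1)) :: real)
      = of_bool (x mod p ^ k = \<alpha>) * g x" for x
  proof -
    define z where "z = x div p ^ k mod p ^ m"
    have dw: "d * w + w \<le> p ^ m"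
      using mult_le_mono1[of "Suc d" p w] assms(5) by (simp add: pm)
    have x: "x mod p ^ (k + m) = x mod p ^ k + p ^ k * z"
      using mod_mult2_eq[of x "p ^ k" "p ^ m"] by (simp add: power_add z_def)
    have iff: "x mod p ^ (k + m) = \<alpha> + p ^ k * \<Xi> + d * p ^ (k + m - 1)
        \<longleftrightarrow> x mod p ^ k = \<alpha> \<and> z = \<Xi> + d * w" for \<Xi>
    proof -
      have "x mod p ^ k + p ^ k * z = \<alpha> + p ^ k * (\<Xi> + d * w) \<longleftrightarrow> x mod p ^ k = \<alpha> \<and> z = \<Xi> + d * w"
      proof
        assume eq: "x mod p ^ k + p ^ k * z = \<alpha> + p ^ k * (\<Xi> + d * w)"
        have "x mod p ^ k = \<alpha>" using arg_cong[OF eq, of "\<lambda>y. y mod p ^ k"] assms(4) by simp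
        then show "x mod p ^ k = \<alpha> \<and> z = \<Xi> + d * w" using eq assms(1) by simp
      qed simp
      then show ?thesis unfolding x pkm by (simp add: algebra_simps)
    qed
    have g: "g x = of_bool (d * w \<le> z \<and> z < d * w + w)"
    proof -
      have zb: "z < p ^ m" using assms(1) by (simp add: z_def)
      have "(int (x div p ^ k) - int (d * w)) mod int (p ^ m) = (int z - int (d * w)) mod int (p ^ m)"
        unfolding z_def zmod_int by (simp add: mod_diff_left_eq)
      also have "\<dots> < int w \<longleftrightarrow> d * w \<le> z \<and> z < d * w + w"
      proof (cases "d * w \<le> z")
        case True
        have "(int z - int (d * w)) mod int (p ^ m) = int z - int (d * w)"
          using True zb by (intro mod_pos_pos_trivial) linarith+
        then show ?thesis using True by linarith
      next
        case False
        have "(int z - int (d * w)) mod int (p ^ m) = (int z - int (d * w) + int (p ^ m)) mod int (p ^ m)"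
          by simp
        also have "\<dots> = int z - int (d * w) + int (p ^ m)"
          using False dw by (intro mod_pos_pos_trivial) linarith+
        finally show ?thesis using False dw by linarith
      qed
      finally show ?thesis by (simp add: g_def)
    qed
    have "(\<Sum>\<Xi><w. of_bool (z = \<Xi> + d * w) :: real) = of_bool (d * w \<le> z \<and> z < d * w + w)"
    proof (cases "d * w \<le> z \<and> z < d * w + w")
      case True
      have "(\<Sum>\<Xi><w. of_bool (z = \<Xi> + d * w) :: real) = (\<Sum>\<Xi><w. if \<Xi> = z - d * w then 1 else 0)"
        using True by (intro sum.cong) auto
      also have "\<dots> = 1" using True by (subst sum.delta) auto
      finally show ?thesis using True by simp
    next
      case False
      have "(\<Sum>\<Xi><w. of_bool (z = \<Xi> + d * w) :: real) = (\<Sum>\<Xi><w. 0)"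
        using False by (intro sum.cong) auto
      then show ?thesis using False by (simp del: sum_of_bool_eq)
    qed
    then show ?thesis unfolding iff g
      by (simp add: of_bool_conj flip: sum_distrib_left del: sum_of_bool_eq sum_of_bool_mult_eq sum_mult_of_bool_eq)
  qed
  have "coprime (p ^ k) (q ^ l)" using assms(2) by simp
  from residue_classes_sum[OF this assms(4,6), of N Q]
  obtain c T where T: "\<bar>real T - real N / (real (p ^ k) * real (q ^ l))\<bar> \<le> 1"
    and sum: "\<And>f::nat \<Rightarrow> real. (\<Sum>n<N. of_bool ((Q + n) mod p ^ k = \<alpha> \<and> (Q + n) mod q ^ l = \<beta>) * f (Q + n))
      = (\<Sum>t<T. f (c + p ^ k * q ^ l * t))"
    by blast
  have gAP: "g (c + p ^ k * q ^ l * t)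
      = of_bool ((int (c div p ^ k) - int (d * w) + int q ^ l * int t) mod int p ^ m < int w)" for t
  proof -
    have "(c + p ^ k * q ^ l * t) div p ^ k = c div p ^ k + q ^ l * t"
      using assms(1) by (simp add: mult.assoc)
    then show ?thesis by (simp add: g_def algebra_simps)
  qed
  have count: "(\<Sum>\<Xi><w. \<Sum>n<N. of_bool ((Q + n) mod p ^ (k + m) = \<alpha> + p ^ k * \<Xi> + d * p ^ (k + m - 1)
        \<and> (Q + n) mod q ^ l = \<beta>))
      = rotation_count (int p ^ m) (int w) (int q ^ l) (int (c div p ^ k) - int (d * w)) T"
  proof -
    have "(\<Sum>\<Xi><w. \<Sum>n<N. of_bool ((Q + n) mod p ^ (k + m) = \<alpha> + p ^ k * \<Xi> + d * p ^ (k + m - 1)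
        \<and> (Q + n) mod q ^ l = \<beta>) :: real)
      = (\<Sum>n<N. of_bool ((Q + n) mod q ^ l = \<beta>) *
          (\<Sum>\<Xi><w. of_bool ((Q + n) mod p ^ (k + m) = \<alpha> + p ^ k * \<Xi> + d * p ^ (k + m - 1))))"
      by (subst sum.swap) (simp only: of_bool_conj sum_distrib_left mult.commute)
    also have "\<dots> = (\<Sum>n<N. of_bool ((Q + n) mod p ^ k = \<alpha> \<and> (Q + n) mod q ^ l = \<beta>) * g (Q + n))"
      unfolding class_sum by (simp only: of_bool_conj ac_simps)
    also have "\<dots> = (\<Sum>t<T. g (c + p ^ k * q ^ l * t))" by (rule sum)
    finally show ?thesis unfolding gAP rotation_count_def .
  qed
  define \<mu> where "\<mu> = real w / real p ^ m"
  have \<mu>: "0 \<le> \<mu>" "\<mu> \<le> 1"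
    using assms(1) w0 by (auto simp: \<mu>_def simp flip: of_nat_power simp: pm)
  have expected: "(\<Sum>\<Xi><w. real N / (real (p ^ (k + m)) * real (q ^ l)))
      = real N / (real (p ^ k) * real (q ^ l)) * \<mu>"
    by (simp add: \<mu>_def power_add ac_simps)
  have "\<bar>(\<Sum>\<Xi><w. residue_discrepancy (p ^ (k + m)) (q ^ l) Q N (\<alpha> + p ^ k * \<Xi> + d * p ^ (k + m - 1)) \<beta>)\<bar>
      = \<bar>rotation_count (int p ^ m) (int w) (int q ^ l) (int (c div p ^ k) - int (d * w)) T
        - real N / (real (p ^ k) * real (q ^ l)) * \<mu>\<bar>"
    unfolding residue_discrepancy_def sum_subtractf count expected ..
  \<comment> \<open>Replacing \<open>T\<close> by its expected value costs at most
    \<open>\<mu> \<le> 1\<close>, the unit reserved in the rotation bound.\<close>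
  also have "\<dots> \<le> \<bar>rotation_count (int p ^ m) (int w) (int q ^ l) (int (c div p ^ k) - int (d * w)) T - real T * \<mu>\<bar>
      + \<bar>(real T - real N / (real (p ^ k) * real (q ^ l))) * \<mu>\<bar>"
    unfolding left_diff_distrib
    by (rule order.trans[OF _ abs_triangle_ineq]) (simp only: add_diff_eq diff_add_cancel order.refl)
  also have "\<bar>(real T - real N / (real (p ^ k) * real (q ^ l))) * \<mu>\<bar> \<le> 1"
    unfolding abs_mult using mult_mono[OF T \<mu>(2)] \<mu> by simp
  also have "real T * \<mu> = real T * of_int (int w) / real p ^ m" by (simp add: \<mu>_def)
  also have "\<bar>rotation_count (int p ^ m) (int w) (int q ^ l) (int (c div p ^ k) - int (d * w)) T
        - real T * of_int (int w) / real p ^ m\<bar> + 1 \<le> rotation_bound p q m l * real p ^ m"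
  proof (rule rotation_count_le_rotation_bound[OF assms(1,2)])
    have "w \<le> p ^ m" using assms(1) by (simp add: pm)
    then show "int w \<le> int p ^ m" by (simp flip: of_nat_power)
  qed simp
  finally show ?thesis by (simp add: w_def)
qed

section \<open>Correlations\<close>

text \<open>Collects the indices that first differ from \<open>u\<close> at position
  \<open>i\<close> and from \<open>v\<close> at position \<open>j\<close>, with a smaller digit both
  times, less their expected number.\<close>

definition digit_term :: "nat \<Rightarrow> nat \<Rightarrow> nat \<Rightarrow> nat \<Rightarrow> nat \<Rightarrow> nat \<Rightarrow> nat \<Rightarrow> nat \<Rightarrow> real" where
  "digit_term p q Q N i j u v =
     (\<Sum>d<u div p ^ i mod p. \<Sum>e<v div q ^ j mod q.
        residue_discrepancy (p ^ Suc i) (q ^ Suc j) Q N (u mod p ^ i + d * p ^ i) (v mod q ^ j + e * q ^ j))"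

lemma digit_term_commute: "digit_term p q Q N i j u v = digit_term q p Q N j i v u"
  unfolding digit_term_def by (subst sum.swap) (simp only: residue_discrepancy_commute)

text \<open>Both \<open>below\<close> factors and both radical inverses split by position, so count
  and expected value expand over the same index set; matching them term by term leaves residue
  discrepancies.\<close>

lemma class_discrepancy_eq_sum:
  assumes "p \<ge> 2" "q \<ge> 2" "u < p ^ a" "v < q ^ a"
  shows "class_discrepancy p q a Q N u v = (\<Sum>i<a. \<Sum>j<a. digit_term p q Q N i j u v)"
proof -
  define A where "A i d x = (of_bool (x mod p ^ Suc i = u mod p ^ i + d * p ^ i) :: real)" for i d x
  define B where "B j e x = (of_bool (x mod q ^ Suc j = v mod q ^ j + e * q ^ j) :: real)" for j e x
  have "below p a u x * below q a v x
      = (\<Sum>i<a. \<Sum>j<a. \<Sum>d<u div p ^ i mod p. \<Sum>e<v div q ^ j mod q. A i d x * B j e x)" for x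
    unfolding below_def A_def[symmetric] B_def[symmetric] by (simp only: sum_product)
  then have "(\<Sum>n<N. below p a u (Q + n) * below q a v (Q + n))
      = (\<Sum>n<N. \<Sum>i<a. \<Sum>j<a. \<Sum>d<u div p ^ i mod p. \<Sum>e<v div q ^ j mod q. A i d (Q + n) * B j e (Q + n))"
    by simp
  also have "\<dots> = (\<Sum>i<a. \<Sum>n<N. \<Sum>j<a. \<Sum>d<u div p ^ i mod p. \<Sum>e<v div q ^ j mod q. A i d (Q + n) * B j e (Q + n))"
    by (rule sum.swap)
  also have "\<dots> = (\<Sum>i<a. \<Sum>j<a. \<Sum>n<N. \<Sum>d<u div p ^ i mod p. \<Sum>e<v div q ^ j mod q. A i d (Q + n) * B j e (Q + n))"
    by (rule sum.cong[OF refl], rule sum.swap)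
  also have "\<dots> = (\<Sum>i<a. \<Sum>j<a. \<Sum>d<u div p ^ i mod p. \<Sum>n<N. \<Sum>e<v div q ^ j mod q. A i d (Q + n) * B j e (Q + n))"
    by (rule sum.cong[OF refl], rule sum.cong[OF refl], rule sum.swap)
  also have "\<dots> = (\<Sum>i<a. \<Sum>j<a. \<Sum>d<u div p ^ i mod p. \<Sum>e<v div q ^ j mod q. \<Sum>n<N. A i d (Q + n) * B j e (Q + n))"
    by (rule sum.cong[OF refl], rule sum.cong[OF refl], rule sum.cong[OF refl], rule sum.swap)
  finally have count: "(\<Sum>n<N. below p a u (Q + n) * below q a v (Q + n))
      = (\<Sum>i<a. \<Sum>j<a. \<Sum>d<u div p ^ i mod p. \<Sum>e<v div q ^ j mod q. \<Sum>n<N. A i d (Q + n) * B j e (Q + n))" .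
  have "radical_inverse p u * radical_inverse q v
      = (\<Sum>i<a. \<Sum>j<a. (real (u div p ^ i mod p) / real p ^ Suc i) * (real (v div q ^ j mod q) / real q ^ Suc j))"
    unfolding radical_inverse_eq_sum[OF assms(1,3)] radical_inverse_eq_sum[OF assms(2,4)] by (rule sum_product)
  then have "real N * radical_inverse p u * radical_inverse q v
      = (\<Sum>i<a. \<Sum>j<a. real N * ((real (u div p ^ i mod p) / real p ^ Suc i) * (real (v div q ^ j mod q) / real q ^ Suc j)))"
    by (simp only: mult.assoc sum_distrib_left)
  also have "\<dots> = (\<Sum>i<a. \<Sum>j<a. \<Sum>d<u div p ^ i mod p. \<Sum>e<v div q ^ j mod q.
      real N / (real (p ^ Suc i) * real (q ^ Suc j)))"
    by (intro sum.cong refl) (simp add: field_simps)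
  finally show ?thesis
    unfolding class_discrepancy_def count digit_term_def residue_discrepancy_def
    by (simp only: sum_subtractf A_def B_def of_bool_conj)
qed

lemma residue_less_power_Suc:
  fixes b i d u :: nat
  assumes "b > 0" "d < b"
  shows "u mod b ^ i + d * b ^ i < b ^ Suc i"
proof -
  have "u mod b ^ i + d * b ^ i < Suc d * b ^ i" using assms by simp
  also have "\<dots> \<le> b * b ^ i" using assms by (intro mult_le_mono1) simp
  finally show ?thesis by simp
qed

lemma abs_digit_term_le:
  assumes "p > 0" "q > 0" "coprime p q"
  shows "\<bar>digit_term p q Q N i j u v\<bar> \<le> real p * real q"
proof -
  have "\<bar>digit_term p q Q N i j u v\<bar> \<le> (\<Sum>d<u div p ^ i mod p. \<Sum>e<v div q ^ j mod q. 1)"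
    unfolding digit_term_def
  proof (intro order.trans[OF sum_abs] sum_mono)
    fix d e assume "d \<in> {..<u div p ^ i mod p}" "e \<in> {..<v div q ^ j mod q}"
    then have "d < p" "e < q" using assms mod_less_divisor[of p] mod_less_divisor[of q]
      by (meson lessThan_iff less_trans)+
    then show "\<bar>residue_discrepancy (p ^ Suc i) (q ^ Suc j) Q N (u mod p ^ i + d * p ^ i) (v mod q ^ j + e * q ^ j)\<bar> \<le> 1"
      using assms by (intro abs_residue_discrepancy_le_1 residue_less_power_Suc) auto
  qed
  also have "\<dots> = real (u div p ^ i mod p) * real (v div q ^ j mod q)" by simp
  also have "\<dots> \<le> real p * real q"
    using assms mod_less_divisor[of p "u div p ^ i"] mod_less_divisor[of q "v div q ^ j"]
    by (intro mult_mono) auto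
  finally show ?thesis .
qed

lemma digit_term_mod_left:
  assumes "p > 0" "i < k"
  shows "digit_term p q Q N i j (u mod p ^ k) v = digit_term p q Q N i j u v"
proof -
  have "u mod p ^ k mod p ^ i = u mod p ^ i"
    using assms by (intro mod_mod_cancel le_imp_power_dvd) simp
  moreover have "u mod p ^ k div p ^ i mod p = u div p ^ i mod p"
  proof -
    have "p ^ k = p ^ i * p ^ (k - i)" using assms by (simp flip: power_add)
    then have "u mod p ^ k div p ^ i = u div p ^ i mod p ^ (k - i)"
      using assms(1) by (simp add: mod_mult2_eq)
    moreover have "u div p ^ i mod p ^ (k - i) mod p = u div p ^ i mod p"
      using assms by (intro mod_mod_cancel dvd_power) simp
    ultimately show ?thesis by simp
  qed
  ultimately show ?thesis by (simp add: digit_term_def)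
qed

section \<open>Averaging over the high digits\<close>

lemma sum_lessThan_mult:
  fixes g :: "nat \<Rightarrow> real"
  shows "(\<Sum>u<M * K. g u) = (\<Sum>u<M. \<Sum>z<K. g (u + M * z))"
proof (induction K)
  case (Suc K)
  have "(\<Sum>u<M * Suc K. g u) = (\<Sum>u<M * K + M. g u)" by (simp add: add.commute)
  also have "\<dots> = (\<Sum>u<M * K. g u) + (\<Sum>u<M. g (M * K + u))"
  proof -
    have "(\<Sum>u<M * K + M. g u) = (\<Sum>u<M * K. g u) + (\<Sum>u=M * K..<M * K + M. g u)"
      unfolding lessThan_atLeast0 by (rule sum.atLeastLessThan_concat[symmetric]) auto
    also have "(\<Sum>u=M * K..<M * K + M. g u) = (\<Sum>u<M. g (M * K + u))"
      using sum.shift_bounds_nat_ivl[of g 0 "M * K" M]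
      unfolding lessThan_atLeast0 by (simp only: add_0 add.commute)
    finally show ?thesis .
  qed
  finally show ?case using Suc by (simp add: sum.distrib add.commute)
qed simp

lemma abs_sum_le:
  fixes f g :: "'a \<Rightarrow> real"
  assumes "\<And>x. x \<in> A \<Longrightarrow> \<bar>f x\<bar> \<le> g x"
  shows "\<bar>sum f A\<bar> \<le> sum g A"
  using assms by (rule order.trans[OF sum_abs sum_mono])

text \<open>The high digits are written \<open>z = \<Xi> + w * (d' + p * t)\<close>:
  \<open>\<Xi>\<close> holds those strictly between positions \<open>i\<close> and
  \<open>i'\<close>, \<open>d'\<close> is the digit at \<open>i'\<close>, and \<open>t\<close> holds
  those above, on which the term does not depend. Cancellation takes place in the sum over
  \<open>\<Xi>\<close>. The factors \<open>p\<close>, \<open>p\<close> and \<open>q\<close> bound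
  the choices of \<open>d'\<close> and of the two smaller digits.\<close>

lemma sum_digit_term_le:
  assumes "p > 0" "q > 0" "coprime p q" "i < i'" "i' < a" "u < p ^ Suc i"
  shows "\<bar>\<Sum>z<p ^ (a - Suc i). digit_term p q Q N i' j (u + p ^ Suc i * z) v\<bar>
    \<le> real p ^ (a - Suc i) * ((real p)\<^sup>2 * real q * rotation_bound p q (i' - i) (Suc j))"
proof -
  define m where "m = i' - i"
  define w where "w = p ^ (m - 1)"
  define y where "y = p ^ (a - Suc i')"
  define B where "B = rotation_bound p q m (Suc j) * real p ^ m"
  have m: "m \<ge> 1" "Suc i + m = Suc i'" using assms by (auto simp: m_def)
  have B0: "0 \<le> B" by (simp add: B_def rotation_bound_nonneg)
  have split: "p ^ (a - Suc i) = w * (p * y)"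
  proof -
    have "w * (p * y) = p ^ ((m - 1) + 1 + (a - Suc i'))" by (simp add: w_def y_def power_add)
    also have "(m - 1) + 1 + (a - Suc i') = a - Suc i" using assms(4,5) by (auto simp: m_def)
    finally show ?thesis by simp
  qed
  have pi': "p ^ i' = p ^ Suc i * w"
  proof -
    have "i' = Suc i + (m - 1)" using m by simp
    then show ?thesis unfolding w_def by (simp only: power_add)
  qed
  define rd where "rd \<Xi> d e = residue_discrepancy (p ^ Suc i') (q ^ Suc j) Q N
      (u + p ^ Suc i * \<Xi> + d * p ^ i') (v mod q ^ j + e * q ^ j)" for \<Xi> d e
  have split_term: "digit_term p q Q N i' j (u + p ^ Suc i * (\<Xi> + w * (d' + p * t))) v
      = (\<Sum>d<d'. \<Sum>e<v div q ^ j mod q. rd \<Xi> d e)" if "\<Xi> < w" "d' < p" for \<Xi> d' t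
  proof -
    define r where "r = u + p ^ Suc i * \<Xi>"
    have "r < p ^ Suc i * Suc \<Xi>" using assms(6) by (simp add: r_def)
    also have "\<dots> \<le> p ^ i'" unfolding pi' using that by (intro mult_le_mono) auto
    finally have r: "r < p ^ i'" .
    have eq: "u + p ^ Suc i * (\<Xi> + w * (d' + p * t)) = r + p ^ i' * (d' + p * t)"
      by (simp add: r_def pi' algebra_simps)
    have "(r + p ^ i' * (d' + p * t)) div p ^ i' mod p = d'" "(r + p ^ i' * (d' + p * t)) mod p ^ i' = r"
      using r that assms(1) by simp_all
    then show ?thesis unfolding digit_term_def eq rd_def r_def by simp
  qed
  have inner: "\<bar>\<Sum>\<Xi><w. rd \<Xi> d e\<bar> \<le> B" if "d < p" "e < q" for d e
  proof -
    have "v mod q ^ j + e * q ^ j < q ^ Suc j" using assms(2) that(2) by (rule residue_less_power_Suc)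
    from sum_residue_discrepancy_le[OF assms(1,3) m(1) assms(6) that(1) this, of Q N]
    show ?thesis unfolding rd_def B_def w_def m(2) by simp
  qed
  have "(\<Sum>z<p ^ (a - Suc i). digit_term p q Q N i' j (u + p ^ Suc i * z) v)
      = (\<Sum>\<Xi><w. \<Sum>d'<p. \<Sum>t<y. digit_term p q Q N i' j (u + p ^ Suc i * (\<Xi> + w * (d' + p * t))) v)"
    unfolding split sum_lessThan_mult[of _ w "p * y"] sum_lessThan_mult[of _ p y] ..
  also have "\<dots> = (\<Sum>\<Xi><w. \<Sum>d'<p. \<Sum>t<y. \<Sum>d<d'. \<Sum>e<v div q ^ j mod q. rd \<Xi> d e)"
    by (intro sum.cong refl split_term) auto
  also have "\<dots> = (\<Sum>d'<p. \<Sum>\<Xi><w. \<Sum>t<y. \<Sum>d<d'. \<Sum>e<v div q ^ j mod q. rd \<Xi> d e)"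
    by (rule sum.swap)
  also have "\<dots> = (\<Sum>d'<p. \<Sum>t<y. \<Sum>\<Xi><w. \<Sum>d<d'. \<Sum>e<v div q ^ j mod q. rd \<Xi> d e)"
    by (rule sum.cong[OF refl], rule sum.swap)
  also have "\<dots> = (\<Sum>d'<p. \<Sum>t<y. \<Sum>d<d'. \<Sum>\<Xi><w. \<Sum>e<v div q ^ j mod q. rd \<Xi> d e)"
    by (rule sum.cong[OF refl], rule sum.cong[OF refl], rule sum.swap)
  also have "\<dots> = (\<Sum>d'<p. \<Sum>t<y. \<Sum>d<d'. \<Sum>e<v div q ^ j mod q. \<Sum>\<Xi><w. rd \<Xi> d e)"
    by (rule sum.cong[OF refl], rule sum.cong[OF refl], rule sum.cong[OF refl], rule sum.swap)
  also have "\<bar>\<dots>\<bar> \<le> (\<Sum>d'<p. \<Sum>t<y. \<Sum>d<d'. \<Sum>e<v div q ^ j mod q. B)"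
  proof (rule abs_sum_le, rule abs_sum_le,
      rule abs_sum_le, rule abs_sum_le, rule inner)
    fix d' t d e assume *: "d' \<in> {..<p}" "t \<in> {..<y}" "d \<in> {..<d'}" "e \<in> {..<v div q ^ j mod q}"
    show "d < p" using * by simp
    show "e < q" using * assms(2) mod_less_divisor[of q "v div q ^ j"] by (meson lessThan_iff less_trans)
  qed
  also have "\<dots> = (\<Sum>d'<p. real y * (real d' * (real (v div q ^ j mod q) * B)))" by simp
  also have "\<dots> \<le> (\<Sum>d'<p. real y * (real p * (real q * B)))"
    using B0 assms(2) mod_less_divisor[of q "v div q ^ j"]
    by (intro sum_mono mult_mono mult_nonneg_nonneg) auto
  also have "\<dots> = real p * (real y * (real p * (real q * B)))" by simp
  also have "\<dots> = (real y * real p ^ m) * ((real p)\<^sup>2 * real q * rotation_bound p q m (Suc j))"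
    by (simp add: B_def power2_eq_square)
  also have "real y * real p ^ m = real p ^ (a - Suc i)"
  proof -
    have "(a - Suc i') + m = a - Suc i" using assms(4,5) by (auto simp: m_def)
    then show ?thesis unfolding y_def by (metis of_nat_power power_add)
  qed
  finally show ?thesis by (simp add: m_def)
qed


text \<open>\<open>f\<close> is constant along the fibres of reduction modulo \<open>M\<close> and
  can be pulled out, leaving the fibre sums of \<open>g\<close>.\<close>

lemma correlation_le:
  fixes f g :: "nat \<Rightarrow> nat \<Rightarrow> real"
  assumes "\<And>u v. f (u mod M) v = f u v" "\<And>u v. \<bar>f u v\<bar> \<le> c"
    and "\<And>u v. u < M \<Longrightarrow> \<bar>\<Sum>z<K. g (u + M * z) v\<bar> \<le> real K * c'"
  shows "\<bar>\<Sum>u<M * K. \<Sum>v<V. f u v * g u v\<bar> \<le> real M * real K * real V * (c * c')"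
proof -
  have c: "0 \<le> c" using assms(2)[of 0 0] by linarith
  have f: "f (u + M * z) v = f u v" for u z v
    using assms(1)[of "u + M * z" v] assms(1)[of u v] by simp
  have "(\<Sum>u<M * K. \<Sum>v<V. f u v * g u v) = (\<Sum>v<V. \<Sum>u<M * K. f u v * g u v)" by (rule sum.swap)
  also have "\<dots> = (\<Sum>v<V. \<Sum>u<M. f u v * (\<Sum>z<K. g (u + M * z) v))"
    by (simp add: sum_lessThan_mult f sum_distrib_left)
  also have "\<bar>\<dots>\<bar> \<le> (\<Sum>v<V. \<Sum>u<M. c * (real K * c'))"
  proof (rule abs_sum_le, rule abs_sum_le)
    fix u v assume "u \<in> {..<M}"
    then show "\<bar>f u v * (\<Sum>z<K. g (u + M * z) v)\<bar> \<le> c * (real K * c')"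
      unfolding abs_mult using assms(2,3) c by (intro mult_mono) auto
  qed
  also have "\<dots> = real M * real K * real V * (c * c')" by simp
  finally show ?thesis .
qed

text \<open>\<open>f\<close> ignores the high part of \<open>u\<close>, and \<open>g\<close> that of
  \<open>v\<close>. For fixed low parts the two high sums therefore factor, and both savings are
  obtained at once.\<close>

lemma correlation_opposite_le:
  fixes f g :: "nat \<Rightarrow> nat \<Rightarrow> real"
  assumes "\<And>u v. f (u mod M) v = f u v" "\<And>u v. g u (v mod M') = g u v"
    and "\<And>u v. u < M \<Longrightarrow> \<bar>\<Sum>z<K. g (u + M * z) v\<bar> \<le> real K * c"
    and "\<And>u v. v < M' \<Longrightarrow> \<bar>\<Sum>z<K'. f u (v + M' * z)\<bar> \<le> real K' * c'"
  shows "\<bar>\<Sum>u<M * K. \<Sum>v<M' * K'. f u v * g u v\<bar> \<le> real M * real K * (real M' * real K') * (c * c')"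
proof -
  have f: "f (u + M * z) v = f u v" for u z v
    using assms(1)[of "u + M * z" v] assms(1)[of u v] by simp
  have g: "g u (v + M' * z) = g u v" for u z v
    using assms(2)[of u "v + M' * z"] assms(2)[of u v] by simp
  have "(\<Sum>u<M * K. \<Sum>v<M' * K'. f u v * g u v)
      = (\<Sum>u<M. \<Sum>z<K. \<Sum>v<M'. \<Sum>z'<K'. g (u + M * z) v * f u (v + M' * z'))"
    unfolding sum_lessThan_mult f g by (simp only: mult.commute)
  also have "\<dots> = (\<Sum>u<M. \<Sum>v<M'. \<Sum>z<K. \<Sum>z'<K'. g (u + M * z) v * f u (v + M' * z'))"
    by (rule sum.cong[OF refl], rule sum.swap)
  also have "\<dots> = (\<Sum>u<M. \<Sum>v<M'. (\<Sum>z<K. g (u + M * z) v) * (\<Sum>z'<K'. f u (v + M' * z')))"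
    by (simp only: sum_product)
  also have "\<bar>\<dots>\<bar> \<le> (\<Sum>u<M. \<Sum>v<M'. (real K * c) * (real K' * c'))"
  proof (rule abs_sum_le, rule abs_sum_le)
    fix u v assume uv: "u \<in> {..<M}" "v \<in> {..<M'}"
    have "0 \<le> real K * c" using uv assms(3)[of u v] by (intro order.trans[OF abs_ge_zero]) auto
    then show "\<bar>(\<Sum>z<K. g (u + M * z) v) * (\<Sum>z'<K'. f u (v + M' * z'))\<bar> \<le> (real K * c) * (real K' * c')"
      unfolding abs_mult using uv assms(3,4) by (intro mult_mono) auto
  qed
  also have "\<dots> = real M * real K * (real M' * real K') * (c * c')" by simp
  finally show ?thesis .
qed

lemma sum_swap_pairs:
  fixes f :: "'a \<Rightarrow> 'b \<Rightarrow> 'c \<Rightarrow> 'd \<Rightarrow> real"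
  shows "(\<Sum>i\<in>A. \<Sum>j\<in>B. \<Sum>k\<in>C. \<Sum>l\<in>D. f i j k l) = (\<Sum>k\<in>C. \<Sum>l\<in>D. \<Sum>i\<in>A. \<Sum>j\<in>B. f i j k l)"
proof -
  have "(\<Sum>i\<in>A. \<Sum>j\<in>B. \<Sum>k\<in>C. \<Sum>l\<in>D. f i j k l) = (\<Sum>i\<in>A. \<Sum>k\<in>C. \<Sum>j\<in>B. \<Sum>l\<in>D. f i j k l)"
    by (rule sum.cong[OF refl], rule sum.swap)
  also have "\<dots> = (\<Sum>k\<in>C. \<Sum>i\<in>A. \<Sum>j\<in>B. \<Sum>l\<in>D. f i j k l)" by (rule sum.swap)
  also have "\<dots> = (\<Sum>k\<in>C. \<Sum>i\<in>A. \<Sum>l\<in>D. \<Sum>j\<in>B. f i j k l)"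
    by (rule sum.cong[OF refl], rule sum.cong[OF refl], rule sum.swap)
  also have "\<dots> = (\<Sum>k\<in>C. \<Sum>l\<in>D. \<Sum>i\<in>A. \<Sum>j\<in>B. f i j k l)"
    by (rule sum.cong[OF refl], rule sum.swap)
  finally show ?thesis .
qed

lemma sum_gap_le:
  fixes g :: "nat \<Rightarrow> real"
  assumes "\<And>m. 0 \<le> g m" "i < a"
  shows "(\<Sum>k<a. of_bool (k < i) * g (i - k)) \<le> (\<Sum>m=1..a. g m)"
    and "(\<Sum>k<a. of_bool (i < k) * g (k - i)) \<le> (\<Sum>m=1..a. g m)"
proof -
  have "(\<Sum>k<a. of_bool (k < i) * g (i - k)) = (\<Sum>k<i. g (i - k))"
    using assms(2) by (intro sum.mono_neutral_cong_right) auto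
  also have "\<dots> = (\<Sum>m\<in>(\<lambda>k. i - k) ` {..<i}. g m)"
    by (subst sum.reindex) (auto simp: inj_on_def)
  also have "\<dots> \<le> (\<Sum>m=1..a. g m)"
    using assms by (intro sum_mono2) auto
  finally show "(\<Sum>k<a. of_bool (k < i) * g (i - k)) \<le> (\<Sum>m=1..a. g m)" .
  have "(\<Sum>k<a. of_bool (i < k) * g (k - i)) = (\<Sum>k\<in>{i<..<a}. g (k - i))"
    by (intro sum.mono_neutral_cong_right) auto
  also have "\<dots> = (\<Sum>m\<in>(\<lambda>k. k - i) ` {i<..<a}. g m)"
    by (subst sum.reindex) (auto simp: inj_on_def)
  also have "\<dots> \<le> (\<Sum>m=1..a. g m)"
    using assms by (intro sum_mono2) auto
  finally show "(\<Sum>k<a. of_bool (i < k) * g (k - i)) \<le> (\<Sum>m=1..a. g m)" .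
qed

text \<open>Pairs of positions in opposite order gain the product of both savings, pairs in the same
  order only the better one. If one coordinate agrees, a single saving is enough because a summation
  index is lost. The final 4 is two kinds of order times the exchange of the two pairs.\<close>

lemma sum_class_discrepancy_square_le:
  fixes p q a Q N :: nat and C C' :: real
  assumes "prime p" "prime q" "p \<noteq> q"
    and C: "(\<Sum>m=1..a. \<Sum>j=1..a. sqrt (rotation_bound p q m j)) \<le> C * real a"
    and C': "(\<Sum>m=1..a. \<Sum>i=1..a. sqrt (rotation_bound q p m i)) \<le> C' * real a"
    and "0 \<le> C" "0 \<le> C'"
  shows "(\<Sum>u<p ^ a. \<Sum>v<q ^ a. (class_discrepancy p q a Q N u v)\<^sup>2)
    \<le> 4 * (real p * real q) ^ 3 * (1 + C) * (1 + C') * (real a)\<^sup>2 * (real p ^ a * real q ^ a)"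
proof -
  have p: "p \<ge> 2" "q \<ge> 2" and p0: "p > 0" "q > 0"
    using assms(1,2) by (auto simp: prime_ge_2_nat prime_gt_0_nat)
  have cop: "coprime p q" "coprime q p"
    using assms(1-3) by (auto simp: primes_coprime)
  define T where "T = digit_term p q Q N"
  define W where "W i j i' j' = (\<Sum>u<p ^ a. \<Sum>v<q ^ a. T i j u v * T i' j' u v)" for i j i' j'
  define P where "P = (real p * real q) ^ 3 * (real p ^ a * real q ^ a)"
  define \<xi> where "\<xi> m j = sqrt (rotation_bound p q m j)" for m j
  define \<zeta> where "\<zeta> m i = sqrt (rotation_bound q p m i)" for m i
  have \<xi>0: "0 \<le> \<xi> m j" "0 \<le> \<zeta> m j" for m j by (auto simp: \<xi>_def \<zeta>_def rotation_bound_nonneg)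
  have sq: "rotation_bound p q m j = \<xi> m j * \<xi> m j" "rotation_bound q p m j = \<zeta> m j * \<zeta> m j" for m j
    by (auto simp: \<xi>_def \<zeta>_def rotation_bound_nonneg)
  have \<xi>1: "\<xi> m j \<le> 1" "\<zeta> m j \<le> 1" for m j by (auto simp: \<xi>_def \<zeta>_def rotation_bound_le_1)
  have le\<xi>: "rotation_bound p q m j \<le> \<xi> m j" "rotation_bound q p m j \<le> \<zeta> m j" for m j
    using mult_left_le[OF \<xi>1(1) \<xi>0(1), of m j m j] mult_left_le[OF \<xi>1(2) \<xi>0(2), of m j m j]
    by (auto simp: sq)
  have P0: "P > 0" using p0 by (simp add: P_def)
  \<comment> \<open>The constants of the different averagings are padded to the common factor
    \<open>(p * q) ^ 3\<close>.\<close>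
  have cube: "real p * real q * ((real p)\<^sup>2 * real q * \<eta>) \<le> (real p * real q) ^ 3 * \<eta>"
    "real q * real p * ((real q)\<^sup>2 * real p * \<eta>) \<le> (real p * real q) ^ 3 * \<eta>" if "0 \<le> \<eta>" for \<eta>
  proof -
    have "1 \<le> real p" "1 \<le> real q" using p by auto
    then have "(real p) ^ 3 * (real q)\<^sup>2 * \<eta> * 1 \<le> (real p) ^ 3 * (real q)\<^sup>2 * \<eta> * real q"
      "(real q) ^ 3 * (real p)\<^sup>2 * \<eta> * 1 \<le> (real q) ^ 3 * (real p)\<^sup>2 * \<eta> * real p"
      using that by (intro mult_left_mono; simp)+
    then show "real p * real q * ((real p)\<^sup>2 * real q * \<eta>) \<le> (real p * real q) ^ 3 * \<eta>"
      "real q * real p * ((real q)\<^sup>2 * real p * \<eta>) \<le> (real p * real q) ^ 3 * \<eta>"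
      by (simp_all add: power2_eq_square power3_eq_cube ac_simps)
  qed
  have pow_split: "b ^ a = b ^ Suc i * b ^ (a - Suc i)" if "i < a" for b i :: nat
    using that by (simp flip: power_add power_Suc)
  have Wsym: "W i j i' j' = W i' j' i j" for i j i' j' by (simp add: W_def mult.commute)
  have Wleft: "\<bar>W i j i' j'\<bar> \<le> P * rotation_bound p q (i' - i) (Suc j')"
    if "i < i'" "i' < a" for i j i' j'
  proof -
    have ia: "i < a" using that by simp
    have "\<bar>\<Sum>u<p ^ Suc i * p ^ (a - Suc i). \<Sum>v<q ^ a. T i j u v * T i' j' u v\<bar>
        \<le> real (p ^ Suc i) * real (p ^ (a - Suc i)) * real (q ^ a)
          * (real p * real q * ((real p)\<^sup>2 * real q * rotation_bound p q (i' - i) (Suc j')))"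
    proof (rule correlation_le)
      show "T i j (u mod p ^ Suc i) v = T i j u v" for u v
        unfolding T_def by (rule digit_term_mod_left[OF p0(1)]) simp
      show "\<bar>T i j u v\<bar> \<le> real p * real q" for u v
        unfolding T_def by (rule abs_digit_term_le[OF p0 cop(1)])
      show "\<bar>\<Sum>z<p ^ (a - Suc i). T i' j' (u + p ^ Suc i * z) v\<bar>
          \<le> real (p ^ (a - Suc i)) * ((real p)\<^sup>2 * real q * rotation_bound p q (i' - i) (Suc j'))"
        if "u < p ^ Suc i" for u v
        unfolding T_def of_nat_power
        by (rule sum_digit_term_le[OF p0 cop(1) \<open>i < i'\<close> \<open>i' < a\<close> that])
    qed
    also have "real (p ^ Suc i) * real (p ^ (a - Suc i)) = real p ^ a"
      using pow_split[OF ia, of p] by (metis of_nat_mult of_nat_power)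
    also have "real p ^ a * real (q ^ a) * (real p * real q * ((real p)\<^sup>2 * real q * rotation_bound p q (i' - i) (Suc j')))
        \<le> real p ^ a * real (q ^ a) * ((real p * real q) ^ 3 * rotation_bound p q (i' - i) (Suc j'))"
      by (intro mult_left_mono cube) (auto simp: rotation_bound_nonneg)
    finally show ?thesis
      unfolding W_def using pow_split[OF ia, of p] by (simp add: P_def ac_simps)
  qed
  have Wright: "\<bar>W i j i' j'\<bar> \<le> P * rotation_bound q p (j' - j) (Suc i')"
    if "j < j'" "j' < a" for i j i' j'
  proof -
    have ja: "j < a" using that by simp
    have "W i j i' j' = (\<Sum>v<q ^ a. \<Sum>u<p ^ a. T i j u v * T i' j' u v)"
      unfolding W_def by (rule sum.swap)
    then have "\<bar>W i j i' j'\<bar> = \<bar>\<Sum>v<q ^ Suc j * q ^ (a - Suc j). \<Sum>u<p ^ a. T i j u v * T i' j' u v\<bar>"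
      using pow_split[OF ja, of q] by simp
    also have "\<dots> \<le> real (q ^ Suc j) * real (q ^ (a - Suc j)) * real (p ^ a)
          * (real q * real p * ((real q)\<^sup>2 * real p * rotation_bound q p (j' - j) (Suc i')))"
    proof (rule correlation_le)
      show "T i j u (v mod q ^ Suc j) = T i j u v" for u v
        unfolding T_def digit_term_commute[of p q] by (rule digit_term_mod_left[OF p0(2)]) simp
      show "\<bar>T i j u v\<bar> \<le> real q * real p" for u v
        unfolding T_def digit_term_commute[of p q] by (rule abs_digit_term_le[OF p0(2,1) cop(2)])
      show "\<bar>\<Sum>z<q ^ (a - Suc j). T i' j' u (v + q ^ Suc j * z)\<bar>
          \<le> real (q ^ (a - Suc j)) * ((real q)\<^sup>2 * real p * rotation_bound q p (j' - j) (Suc i'))"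
        if "v < q ^ Suc j" for u v
        unfolding T_def digit_term_commute[of p q] of_nat_power
        by (rule sum_digit_term_le[OF p0(2,1) cop(2) \<open>j < j'\<close> \<open>j' < a\<close> that])
    qed
    also have "real (q ^ Suc j) * real (q ^ (a - Suc j)) = real q ^ a"
      using pow_split[OF ja, of q] by (metis of_nat_mult of_nat_power)
    also have "real q ^ a * real (p ^ a) * (real q * real p * ((real q)\<^sup>2 * real p * rotation_bound q p (j' - j) (Suc i')))
        \<le> real q ^ a * real (p ^ a) * ((real p * real q) ^ 3 * rotation_bound q p (j' - j) (Suc i'))"
      by (intro mult_left_mono cube) (auto simp: rotation_bound_nonneg)
    finally show ?thesis by (simp add: P_def ac_simps)
  qed
  have Wopp: "\<bar>W i j i' j'\<bar> \<le> P * (rotation_bound p q (i' - i) (Suc j') * rotation_bound q p (j - j') (Suc i))"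
    if "i < i'" "i' < a" "j' < j" "j < a" for i j i' j'
  proof -
    have ia: "i < a" "j' < a" using that by simp_all
    have "\<bar>\<Sum>u<p ^ Suc i * p ^ (a - Suc i). \<Sum>v<q ^ Suc j' * q ^ (a - Suc j'). T i j u v * T i' j' u v\<bar>
        \<le> real (p ^ Suc i) * real (p ^ (a - Suc i)) * (real (q ^ Suc j') * real (q ^ (a - Suc j')))
          * (((real p)\<^sup>2 * real q * rotation_bound p q (i' - i) (Suc j'))
            * ((real q)\<^sup>2 * real p * rotation_bound q p (j - j') (Suc i)))"
    proof (rule correlation_opposite_le)
      show "T i j (u mod p ^ Suc i) v = T i j u v" for u v
        unfolding T_def by (rule digit_term_mod_left[OF p0(1)]) simp
      show "T i' j' u (v mod q ^ Suc j') = T i' j' u v" for u v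
        unfolding T_def digit_term_commute[of p q] by (rule digit_term_mod_left[OF p0(2)]) simp
      show "\<bar>\<Sum>z<p ^ (a - Suc i). T i' j' (u + p ^ Suc i * z) v\<bar>
          \<le> real (p ^ (a - Suc i)) * ((real p)\<^sup>2 * real q * rotation_bound p q (i' - i) (Suc j'))"
        if "u < p ^ Suc i" for u v
        unfolding T_def of_nat_power
        by (rule sum_digit_term_le[OF p0 cop(1) \<open>i < i'\<close> \<open>i' < a\<close> that])
      show "\<bar>\<Sum>z<q ^ (a - Suc j'). T i j u (v + q ^ Suc j' * z)\<bar>
          \<le> real (q ^ (a - Suc j')) * ((real q)\<^sup>2 * real p * rotation_bound q p (j - j') (Suc i))"
        if "v < q ^ Suc j'" for u v
        unfolding T_def digit_term_commute[of p q] of_nat_power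
        by (rule sum_digit_term_le[OF p0(2,1) cop(2) \<open>j' < j\<close> \<open>j < a\<close> that])
    qed
    also have "real (p ^ Suc i) * real (p ^ (a - Suc i)) = real p ^ a"
      using pow_split[OF ia(1), of p] by (metis of_nat_mult of_nat_power)
    also have "real (q ^ Suc j') * real (q ^ (a - Suc j')) = real q ^ a"
      using pow_split[OF ia(2), of q] by (metis of_nat_mult of_nat_power)
    finally show ?thesis
      unfolding W_def using pow_split[OF ia(1), of p] pow_split[OF ia(2), of q]
      by (simp add: P_def power2_eq_square power3_eq_cube ac_simps)
  qed
  have Wdiag: "\<bar>W i j i j\<bar> \<le> P" for i j
  proof -
    have "\<bar>W i j i j\<bar> \<le> (\<Sum>u<p ^ a. \<Sum>v<q ^ a. (real p * real q) * (real p * real q))"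
      unfolding W_def
    proof (rule abs_sum_le, rule abs_sum_le)
      fix u v
      show "\<bar>T i j u v * T i j u v\<bar> \<le> (real p * real q) * (real p * real q)"
        unfolding abs_mult T_def using abs_digit_term_le[OF p0 cop(1)] by (intro mult_mono) auto
    qed
    also have "\<dots> = (real p * real q)\<^sup>2 * (real p ^ a * real q ^ a)" by (simp add: power2_eq_square)
    also have "\<dots> \<le> P"
    proof -
      have "1 \<le> real p * real q" using p by (simp add: mult_ge1_I)
      then show ?thesis unfolding P_def by (intro mult_right_mono power_increasing) auto
    qed
    finally show ?thesis .
  qed
  \<comment> \<open>Both averagings act on the same factor, so they cannot be combined. From
    \<open>w \<le> x\<^sup>2\<close> and \<open>w \<le> y\<^sup>2\<close> follows
    \<open>w \<le> x * y\<close>, in which the two gaps are separated.\<close>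
  have Wsame: "\<bar>W i j i' j'\<bar> \<le> P * (\<xi> (i' - i) (Suc j') * \<zeta> (j' - j) (Suc i'))"
    if "i < i'" "i' < a" "j < j'" "j' < a" for i j i' j'
  proof -
    define x y where "x = \<xi> (i' - i) (Suc j')" and "y = \<zeta> (j' - j) (Suc i')"
    define w where "w = \<bar>W i j i' j'\<bar> / P"
    have "w \<le> x * x" "w \<le> y * y" "0 \<le> w"
      using Wleft[OF that(1,2), of j j'] Wright[OF that(3,4), of i i'] P0
      by (simp_all add: w_def x_def y_def sq divide_le_eq mult.commute)
    then have "w * w \<le> (x * x) * (y * y)" by (intro mult_mono) auto
    then have "w\<^sup>2 \<le> (x * y)\<^sup>2" by (simp add: power2_eq_square ac_simps)
    then have "w \<le> x * y" by (rule power2_le_imp_le) (simp add: x_def y_def \<xi>0)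
    then show ?thesis using P0 by (simp add: w_def x_def y_def divide_le_eq mult.commute)
  qed
  \<comment> \<open>\<open>\<alpha>\<close> majorises pairs with \<open>i \<le> i'\<close> and
    \<open>j \<le> j'\<close>, \<open>\<beta>\<close> those in opposite order. In
    \<open>\<alpha>\<close> the second arguments involve \<open>j'\<close> and \<open>i'\<close>;
    fixing these makes the sums over \<open>i\<close> and \<open>j\<close> independent. In
    \<open>\<beta>\<close> they involve \<open>j'\<close> and \<open>i\<close>, and the sums over
    \<open>i'\<close> and \<open>j\<close> become independent.\<close>
  define \<alpha> where "\<alpha> i j i' j' = (of_bool (i = i') + of_bool (i < i') * \<xi> (i' - i) (Suc j'))
      * (of_bool (j = j') + of_bool (j < j') * \<zeta> (j' - j) (Suc i'))" for i j i' j'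
  define \<beta> where "\<beta> i j i' j' = (of_bool (i < i') * \<xi> (i' - i) (Suc j'))
      * (of_bool (j' < j) * \<zeta> (j - j') (Suc i))" for i j i' j'
  have \<alpha>0: "0 \<le> \<alpha> i j i' j'" "0 \<le> \<beta> i j i' j'" for i j i' j'
    using \<xi>0 by (auto simp: \<alpha>_def \<beta>_def intro!: mult_nonneg_nonneg add_nonneg_nonneg)
  have half: "\<bar>W i j i' j'\<bar> \<le> P * (\<alpha> i j i' j' + \<beta> i j i' j')"
    if order: "i < i' \<or> (i = i' \<and> j \<le> j')" and "i < a" "j < a" "i' < a" "j' < a" for i j i' j'
  proof -
    consider "i < i'" "j < j'" | "i < i'" "j = j'" | "i < i'" "j' < j" | "i = i'" "j < j'" | "i = i'" "j = j'"
      using order by linarith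
    then show ?thesis
    proof cases
      case 1
      then show ?thesis using Wsame[of i i' j j'] that by (simp add: \<alpha>_def \<beta>_def)
    next
      case 2
      have "\<bar>W i j i' j'\<bar> \<le> P * rotation_bound p q (i' - i) (Suc j')" using 2 that by (intro Wleft) auto
      also have "\<dots> \<le> P * \<xi> (i' - i) (Suc j')" using P0 le\<xi> by (intro mult_left_mono) auto
      finally show ?thesis using 2 by (simp add: \<alpha>_def \<beta>_def)
    next
      case 3
      have "\<bar>W i j i' j'\<bar> \<le> P * (rotation_bound p q (i' - i) (Suc j') * rotation_bound q p (j - j') (Suc i))"
        using 3 that by (intro Wopp) auto
      also have "\<dots> \<le> P * (\<xi> (i' - i) (Suc j') * \<zeta> (j - j') (Suc i))"
        using P0 le\<xi> \<xi>0 by (intro mult_left_mono mult_mono) (auto simp: rotation_bound_nonneg)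
      finally show ?thesis using 3 by (simp add: \<alpha>_def \<beta>_def)
    next
      case 4
      have "\<bar>W i j i' j'\<bar> \<le> P * rotation_bound q p (j' - j) (Suc i')" using 4 that by (intro Wright) auto
      also have "\<dots> \<le> P * \<zeta> (j' - j) (Suc i')" using P0 le\<xi> by (intro mult_left_mono) auto
      finally show ?thesis using 4 by (simp add: \<alpha>_def \<beta>_def)
    next
      case 5
      then show ?thesis using Wdiag[of i j] by (simp add: \<alpha>_def \<beta>_def)
    qed
  qed
  \<comment> \<open>Adding the majorant with the two pairs exchanged covers both lexicographic
    orders.\<close>
  have Wbound: "\<bar>W i j i' j'\<bar> \<le> P * ((\<alpha> i j i' j' + \<beta> i j i' j') + (\<alpha> i' j' i j + \<beta> i' j' i j))"
    if "i < a" "j < a" "i' < a" "j' < a" for i j i' j'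
  proof (cases "i < i' \<or> (i = i' \<and> j \<le> j')")
    case True
    have "\<bar>W i j i' j'\<bar> \<le> P * (\<alpha> i j i' j' + \<beta> i j i' j')" using half[OF True that] .
    also have "\<dots> \<le> P * ((\<alpha> i j i' j' + \<beta> i j i' j') + (\<alpha> i' j' i j + \<beta> i' j' i j))"
      using P0 \<alpha>0[of i' j' i j] by (intro mult_left_mono) auto
    finally show ?thesis .
  next
    case False
    then have "i' < i \<or> (i' = i \<and> j' \<le> j)" by auto
    then have "\<bar>W i' j' i j\<bar> \<le> P * (\<alpha> i' j' i j + \<beta> i' j' i j)" using that by (intro half)
    also have "\<dots> \<le> P * ((\<alpha> i j i' j' + \<beta> i j i' j') + (\<alpha> i' j' i j + \<beta> i' j' i j))"
      using P0 \<alpha>0[of i j i' j'] by (intro mult_left_mono) auto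
    finally show ?thesis by (simp only: Wsym[of i j])
  qed
  define X where "X j = (\<Sum>m=1..a. \<xi> m j)" for j
  define Z where "Z i = (\<Sum>m=1..a. \<zeta> m i)" for i
  have X0: "0 \<le> X j" "0 \<le> Z j" for j using \<xi>0 by (auto simp: X_def Z_def intro!: sum_nonneg)
  have sumX: "(\<Sum>j<a. X (Suc j)) \<le> C * real a" "(\<Sum>i<a. Z (Suc i)) \<le> C' * real a"
  proof -
    have shift: "(\<Sum>j<a. g (Suc j)) = (\<Sum>j=1..a. g j)" for g :: "nat \<Rightarrow> real"
      using sum.shift_bounds_Suc_ivl[of g 0 a] by (simp add: lessThan_atLeast0 atLeastLessThanSuc_atLeastAtMost)
    have "(\<Sum>j<a. X (Suc j)) = (\<Sum>j=1..a. X j)" by (rule shift)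
    also have "\<dots> = (\<Sum>m=1..a. \<Sum>j=1..a. \<xi> m j)" unfolding X_def by (rule sum.swap)
    also have "\<dots> \<le> C * real a" using C by (simp only: \<xi>_def)
    finally show "(\<Sum>j<a. X (Suc j)) \<le> C * real a" .
    have "(\<Sum>j<a. Z (Suc j)) = (\<Sum>j=1..a. Z j)" by (rule shift)
    also have "\<dots> = (\<Sum>m=1..a. \<Sum>j=1..a. \<zeta> m j)" unfolding Z_def by (rule sum.swap)
    also have "\<dots> \<le> C' * real a" using C' by (simp only: \<zeta>_def)
    finally show "(\<Sum>j<a. Z (Suc j)) \<le> C' * real a" .
  qed
  have "(\<Sum>i<a. \<Sum>j<a. \<Sum>i'<a. \<Sum>j'<a. \<alpha> i j i' j') \<le> ((1 + C) * real a) * ((1 + C') * real a)"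
  proof -
    have "(\<Sum>i<a. \<Sum>j<a. \<Sum>i'<a. \<Sum>j'<a. \<alpha> i j i' j') = (\<Sum>i'<a. \<Sum>j'<a. \<Sum>i<a. \<Sum>j<a. \<alpha> i j i' j')"
      by (rule sum_swap_pairs)
    also have "\<dots> = (\<Sum>i'<a. \<Sum>j'<a. (\<Sum>i<a. of_bool (i = i') + of_bool (i < i') * \<xi> (i' - i) (Suc j'))
        * (\<Sum>j<a. of_bool (j = j') + of_bool (j < j') * \<zeta> (j' - j) (Suc i')))"
      unfolding \<alpha>_def by (simp only: sum_product)
    also have "\<dots> \<le> (\<Sum>i'<a. \<Sum>j'<a. (1 + X (Suc j')) * (1 + Z (Suc i')))"
    proof (intro sum_mono mult_mono)
      fix i' j' assume ij: "i' \<in> {..<a}" "j' \<in> {..<a}"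
      have delta: "(\<Sum>k<a. of_bool (k = l) :: real) \<le> 1" for l
        unfolding of_bool_def by simp
      show "(\<Sum>i<a. of_bool (i = i') + of_bool (i < i') * \<xi> (i' - i) (Suc j')) \<le> 1 + X (Suc j')"
        unfolding sum.distrib X_def
        using ij \<xi>0 by (intro add_mono delta sum_gap_le(1)[where g = "\<lambda>m. \<xi> m (Suc j')"]) auto
      show "(\<Sum>j<a. of_bool (j = j') + of_bool (j < j') * \<zeta> (j' - j) (Suc i')) \<le> 1 + Z (Suc i')"
        unfolding sum.distrib Z_def
        using ij \<xi>0 by (intro add_mono delta sum_gap_le(1)[where g = "\<lambda>m. \<zeta> m (Suc i')"]) auto
    qed (use X0 \<xi>0 in \<open>auto intro!: sum_nonneg add_nonneg_nonneg mult_nonneg_nonneg\<close>)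
    also have "\<dots> = (\<Sum>i'<a. 1 + Z (Suc i')) * (\<Sum>j'<a. 1 + X (Suc j'))"
      unfolding sum_product by (intro sum.cong refl mult.commute)
    also have "\<dots> \<le> ((1 + C') * real a) * ((1 + C) * real a)"
      using sumX X0 assms(6,7) by (intro mult_mono) (auto simp: sum.distrib algebra_simps intro!: sum_nonneg add_nonneg_nonneg)
    finally show ?thesis by (simp only: mult.commute)
  qed
  moreover have "(\<Sum>i<a. \<Sum>j<a. \<Sum>i'<a. \<Sum>j'<a. \<beta> i j i' j') \<le> ((1 + C) * real a) * ((1 + C') * real a)"
  proof -
    have "(\<Sum>i<a. \<Sum>j<a. \<Sum>i'<a. \<Sum>j'<a. \<beta> i j i' j') = (\<Sum>i<a. \<Sum>j<a. \<Sum>j'<a. \<Sum>i'<a. \<beta> i j i' j')"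
      by (rule sum.cong[OF refl], rule sum.cong[OF refl], rule sum.swap)
    also have "\<dots> = (\<Sum>i<a. \<Sum>j'<a. \<Sum>j<a. \<Sum>i'<a. \<beta> i j i' j')"
      by (rule sum.cong[OF refl], rule sum.swap)
    also have "\<dots> = (\<Sum>i<a. \<Sum>j'<a. \<Sum>i'<a. \<Sum>j<a. \<beta> i j i' j')"
      by (rule sum.cong[OF refl], rule sum.cong[OF refl], rule sum.swap)
    also have "\<dots> = (\<Sum>i<a. \<Sum>j'<a. (\<Sum>i'<a. of_bool (i < i') * \<xi> (i' - i) (Suc j'))
        * (\<Sum>j<a. of_bool (j' < j) * \<zeta> (j - j') (Suc i)))"
      unfolding \<beta>_def by (simp only: sum_product)
    also have "\<dots> \<le> (\<Sum>i<a. \<Sum>j'<a. X (Suc j') * Z (Suc i))"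
      unfolding X_def Z_def using \<xi>0
      by (intro sum_mono mult_mono sum_gap_le(2)[where g = "\<lambda>m. \<xi> m (Suc _)"]
          sum_gap_le(2)[where g = "\<lambda>m. \<zeta> m (Suc _)"]) (auto intro!: sum_nonneg)
    also have "\<dots> = (\<Sum>i<a. Z (Suc i)) * (\<Sum>j'<a. X (Suc j'))"
      unfolding sum_product by (intro sum.cong refl mult.commute)
    also have "\<dots> \<le> ((1 + C') * real a) * ((1 + C) * real a)"
    proof (rule mult_mono)
      have "C' * real a \<le> (1 + C') * real a" "C * real a \<le> (1 + C) * real a"
        by (simp_all add: algebra_simps)
      then show "(\<Sum>i<a. Z (Suc i)) \<le> (1 + C') * real a" "(\<Sum>j'<a. X (Suc j')) \<le> (1 + C) * real a"
        using sumX by linarith+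
    qed (use X0 assms(7) in \<open>auto intro!: sum_nonneg\<close>)
    finally show ?thesis by (simp only: mult.commute)
  qed
  ultimately have \<alpha>\<beta>: "(\<Sum>i<a. \<Sum>j<a. \<Sum>i'<a. \<Sum>j'<a. \<alpha> i j i' j' + \<beta> i j i' j')
      \<le> 2 * (((1 + C) * real a) * ((1 + C') * real a))"
    by (simp add: sum.distrib)
  have "(\<Sum>u<p ^ a. \<Sum>v<q ^ a. (class_discrepancy p q a Q N u v)\<^sup>2)
      = (\<Sum>u<p ^ a. \<Sum>v<q ^ a. \<Sum>i<a. \<Sum>j<a. \<Sum>i'<a. \<Sum>j'<a. T i j u v * T i' j' u v)"
  proof (intro sum.cong refl)
    fix u v assume "u \<in> {..<p ^ a}" "v \<in> {..<q ^ a}"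
    then have "class_discrepancy p q a Q N u v = (\<Sum>i<a. \<Sum>j<a. T i j u v)"
      unfolding T_def using p by (intro class_discrepancy_eq_sum) auto
    then show "(class_discrepancy p q a Q N u v)\<^sup>2 = (\<Sum>i<a. \<Sum>j<a. \<Sum>i'<a. \<Sum>j'<a. T i j u v * T i' j' u v)"
      by (simp only: power2_eq_square sum_distrib_left sum_distrib_right) (rule sum_swap_pairs)
  qed
  also have "\<dots> = (\<Sum>i<a. \<Sum>j<a. \<Sum>u<p ^ a. \<Sum>v<q ^ a. \<Sum>i'<a. \<Sum>j'<a. T i j u v * T i' j' u v)"
    by (rule sum_swap_pairs)
  also have "\<dots> = (\<Sum>i<a. \<Sum>j<a. \<Sum>i'<a. \<Sum>j'<a. W i j i' j')"
    unfolding W_def by (rule sum.cong[OF refl], rule sum.cong[OF refl], rule sum_swap_pairs)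
  also have "\<dots> \<le> (\<Sum>i<a. \<Sum>j<a. \<Sum>i'<a. \<Sum>j'<a.
      P * ((\<alpha> i j i' j' + \<beta> i j i' j') + (\<alpha> i' j' i j + \<beta> i' j' i j)))"
    by (intro sum_mono order.trans[OF abs_ge_self Wbound]) auto
  also have "\<dots> = P * ((\<Sum>i<a. \<Sum>j<a. \<Sum>i'<a. \<Sum>j'<a. \<alpha> i j i' j' + \<beta> i j i' j')
      + (\<Sum>i<a. \<Sum>j<a. \<Sum>i'<a. \<Sum>j'<a. \<alpha> i' j' i j + \<beta> i' j' i j))"
    by (simp only: sum_distrib_left[symmetric] sum.distrib)
  also have "(\<Sum>i<a. \<Sum>j<a. \<Sum>i'<a. \<Sum>j'<a. \<alpha> i' j' i j + \<beta> i' j' i j)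
      = (\<Sum>i<a. \<Sum>j<a. \<Sum>i'<a. \<Sum>j'<a. \<alpha> i j i' j' + \<beta> i j i' j')"
    by (rule sum_swap_pairs)
  also have "P * ((\<Sum>i<a. \<Sum>j<a. \<Sum>i'<a. \<Sum>j'<a. \<alpha> i j i' j' + \<beta> i j i' j')
      + (\<Sum>i<a. \<Sum>j<a. \<Sum>i'<a. \<Sum>j'<a. \<alpha> i j i' j' + \<beta> i j i' j'))
      \<le> P * (2 * (((1 + C) * real a) * ((1 + C') * real a)) + 2 * (((1 + C) * real a) * ((1 + C') * real a)))"
    using P0 \<alpha>\<beta> by (intro mult_left_mono add_mono) auto
  also have "\<dots> = 4 * (real p * real q) ^ 3 * (1 + C) * (1 + C') * (real a)\<^sup>2 * (real p ^ a * real q ^ a)"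
    unfolding P_def by (simp add: power2_eq_square algebra_simps)
  finally show ?thesis .
qed

theorem mainTheorem1:
  fixes p\<^sub>1 p\<^sub>2 :: nat
  assumes "prime p\<^sub>1" and "prime p\<^sub>2" and "p\<^sub>1 \<noteq> p\<^sub>2"
  shows "\<exists>C::real. \<forall>Q N :: nat. N \<ge> 2 \<longrightarrow>
    L2_discrepancy N (\<lambda>n. halton2 p\<^sub>1 p\<^sub>2 (Q + n)) \<le> C * ln (real N)"
proof -
  have p: "p\<^sub>1 \<ge> 2" "p\<^sub>2 \<ge> 2" using assms by (auto simp: prime_ge_2_nat)
  have cop: "coprime p\<^sub>1 p\<^sub>2" "coprime p\<^sub>2 p\<^sub>1" using assms by (auto simp: primes_coprime)
  obtain C where C: "\<And>a. (\<Sum>m=1..a. \<Sum>j=1..a. sqrt (rotation_bound p\<^sub>1 p\<^sub>2 m j)) \<le> C * real a"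
    using sum_sqrt_rotation_bound[OF assms(1) cop(1) p(2)] by blast
  obtain C' where C': "\<And>a. (\<Sum>m=1..a. \<Sum>j=1..a. sqrt (rotation_bound p\<^sub>2 p\<^sub>1 m j)) \<le> C' * real a"
    using sum_sqrt_rotation_bound[OF assms(2) cop(2) p(1)] by blast
  have nonneg: "0 \<le> C" "0 \<le> C'"
  proof -
    have "0 \<le> (\<Sum>m=1..1. \<Sum>j=1..1. sqrt (rotation_bound p\<^sub>1 p\<^sub>2 m j))"
      "0 \<le> (\<Sum>m=1..1. \<Sum>j=1..1. sqrt (rotation_bound p\<^sub>2 p\<^sub>1 m j))"
      by (auto simp: rotation_bound_nonneg)
    then show "0 \<le> C" "0 \<le> C'" using C[of 1] C'[of 1] by linarith+
  qed
  \<comment> \<open>8 is twice the 4 of the mean square estimate and 32 is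
    \<open>2 * 4\<^sup>2\<close>, both from
    \<open>(x + 4)\<^sup>2 \<le> 2 * x\<^sup>2 + 32\<close>.\<close>
  define A where "A = 8 * (real p\<^sub>1 * real p\<^sub>2) ^ 3 * (1 + C) * (1 + C') + 32"
  have A0: "A \<ge> 0" using nonneg by (simp add: A_def)
  have "L2_discrepancy N (\<lambda>n. halton2 p\<^sub>1 p\<^sub>2 (Q + n)) \<le> (sqrt A * (2 / ln 2)) * ln (real N)"
    if "N \<ge> 2" for Q N :: nat
  proof -
    \<comment> \<open>Both primes are at least 2, so \<open>2 ^ a \<ge> N\<close> serves both bases;
      \<open>N \<ge> 2\<close> gives \<open>log 2 N \<ge> 1\<close>, so rounding up at most doubles
      the logarithm.\<close>
    define a where "a = nat \<lceil>log 2 (real N)\<rceil>"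
    have log1: "log 2 (real N) \<ge> 1" using that by simp
    have a: "log 2 (real N) \<le> real a" "real a \<le> 2 * log 2 (real N)" "a \<ge> 1"
      using log1 unfolding a_def by linarith+
    have "real N = 2 powr log 2 (real N)" using that by simp
    also have "\<dots> \<le> 2 powr real a" using a(1) by simp
    finally have "real N \<le> real (2 ^ a)" by (simp add: powr_realpow)
    then have "N \<le> 2 ^ a" by (simp only: of_nat_le_iff)
    then have Na: "N \<le> p\<^sub>1 ^ a" "N \<le> p\<^sub>2 ^ a"
      using power_mono[of 2 p\<^sub>1 a] power_mono[of 2 p\<^sub>2 a] p by linarith+
    define V where "V = real p\<^sub>1 ^ a * real p\<^sub>2 ^ a"
    have V0: "V > 0" using p by (simp add: V_def)
    define D where "D = L2_discrepancy N (\<lambda>n. halton2 p\<^sub>1 p\<^sub>2 (Q + n))"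
    have "D\<^sup>2 * V \<le> (\<Sum>u<p\<^sub>1 ^ a. \<Sum>v<p\<^sub>2 ^ a. (\<bar>class_discrepancy p\<^sub>1 p\<^sub>2 a Q N u v\<bar> + 4)\<^sup>2)"
      unfolding D_def V_def by (rule L2_discrepancy_le[OF p Na])
    also have "\<dots> \<le> (\<Sum>u<p\<^sub>1 ^ a. \<Sum>v<p\<^sub>2 ^ a. 2 * (class_discrepancy p\<^sub>1 p\<^sub>2 a Q N u v)\<^sup>2 + 32)"
    proof (intro sum_mono)
      fix u v
      have "0 \<le> (\<bar>class_discrepancy p\<^sub>1 p\<^sub>2 a Q N u v\<bar> - 4)\<^sup>2" by simp
      then show "(\<bar>class_discrepancy p\<^sub>1 p\<^sub>2 a Q N u v\<bar> + 4)\<^sup>2 \<le> 2 * (class_discrepancy p\<^sub>1 p\<^sub>2 a Q N u v)\<^sup>2 + 32"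
        by (simp add: power2_sum power2_diff)
    qed
    also have "\<dots> = 2 * (\<Sum>u<p\<^sub>1 ^ a. \<Sum>v<p\<^sub>2 ^ a. (class_discrepancy p\<^sub>1 p\<^sub>2 a Q N u v)\<^sup>2) + 32 * V"
      by (simp add: sum.distrib sum_distrib_left V_def)
    also have "\<dots> \<le> 2 * (4 * (real p\<^sub>1 * real p\<^sub>2) ^ 3 * (1 + C) * (1 + C') * (real a)\<^sup>2 * V) + 32 * V"
      unfolding V_def
      by (intro add_mono mult_left_mono sum_class_discrepancy_square_le assms C C' nonneg) auto
    also have "\<dots> \<le> A * (real a)\<^sup>2 * V"
    proof -
      have "1 \<le> (real a)\<^sup>2" using a(3) by simp
      then have "32 * V * 1 \<le> 32 * V * (real a)\<^sup>2" using V0 by (intro mult_left_mono) auto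
      then show ?thesis by (simp add: A_def algebra_simps)
    qed
    finally have "D\<^sup>2 \<le> A * (real a)\<^sup>2" using V0 by simp
    also have "\<dots> = (sqrt A * real a)\<^sup>2" using A0 by (simp add: power_mult_distrib)
    finally have "D \<le> sqrt A * real a" by (rule power2_le_imp_le) (simp add: A0)
    also have "\<dots> \<le> sqrt A * (2 * log 2 (real N))" using a(2) A0 by (intro mult_left_mono) auto
    also have "\<dots> = (sqrt A * (2 / ln 2)) * ln (real N)" by (simp add: log_def)
    finally show ?thesis by (simp add: D_def)
  qed
  then show ?thesis by blast
qed

end
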